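(* Let $n\ge 2$, $N\ge 2$ and let $\mathcal{K}$ be a partial categorical $\dot{\mathcal{U}}_{0,N}(L\mathfrak{sl}_n)$ action. Let $\underline{k}=(k_1,\dots,k_n)\in C(n,N)$, $K_i=\sum_{j=1}^{i}k_j$ for $1\le i\le n-1$, and $\eta=(0,\dots,0,N)$. For $\boldsymbol{\lambda}(i)=(\lambda(i)_1,\dots,\lambda(i)_{K_i})\in P(k_{i+1},K_i)$, $1\le i\le n-1$, put $\mathsf{F}_{i,\boldsymbol{\lambda}(i)}:=\mathsf{F}_{i,\lambda(i)_1}\cdots\mathsf{F}_{i,\lambda(i)_{K_i}}$ and let $\mathrm{Im}\,\mathsf{F}_{1,\boldsymbol{\lambda}(1)}\cdots\mathsf{F}_{n-1,\boldsymbol{\lambda}(n-1)}\mathbf{1}_\eta$ denote the minimal full triangulated subcategory of $\mathcal{K}(\underline{k})$ generated by the objects in the essential image of the functor $\mathsf{F}_{1,\boldsymbol{\lambda}(1)}\cdots\mathsf{F}_{n-1,\boldsymbol{\lambda}(n-1)}\mathbf{1}_\eta:\mathcal{K}(\eta)\to\mathcal{K}(\underline{k})$. Then there is a semiorthogonal decomposition $$\mathcal{K}(\underline{k})=\big\langle \mathcal{A}(\underline{k}),\ \mathrm{Im}\,\mathsf{F}_{1,\boldsymbol{\lambda}(1)}\mathsf{F}_{2,\boldsymbol{\lambda}(2)}\cdots\mathsf{F}_{n-1,\boldsymbol{\lambda}(n-1)}\mathbf{1}_\eta\big\rangle_{\boldsymbol{\lambda}(i)\in P(k_{i+1},K_i),\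 1\le i\le n-1},$$ where $\mathcal{A}(\underline{k})=\langle \mathrm{Im}\,\mathsf{F}_{1,\boldsymbol{\lambda}(1)}\cdots\mathsf{F}_{n-1,\boldsymbol{\lambda}(n-1)}\mathbf{1}_\eta\rangle_{\boldsymbol{\lambda}(i)\in P(k_{i+1},K_i)}^{\perp}$, and the components $\mathrm{Im}\,\mathsf{F}_{1,\boldsymbol{\lambda}(1)}\cdots\mathsf{F}_{n-1,\boldsymbol{\lambda}(n-1)}\mathbf{1}_\eta$ are arranged from left to right in decreasing order of $(\boldsymbol{\lambda}(1),\dots,\boldsymbol{\lambda}(n-1))$ with respect to $<_{pl}$.
   Context: **Semiorthogonal decompositions.** For a triangulated category $\mathcal{D}$ and a full triangulated subcategory $\mathcal{A}$, $\mathcal{A}^\perp=\{X:\mathrm{Hom}_{\mathcal{D}}(A,X)=0\ \forall A\in\mathcal{A}\}$. For a class (or sequence of subcategories) $\mathcal{E}$, $\langle\mathcal{E}\rangle$ is the minimal full triangulated subcategory containing it (closed under direct summands for a class of objects). A semiorthogonal decomposition $\mathcal{D}=\langle\mathcal{A}_1,\dots,\mathcal{A}_m\rangle$ is a sequence of full triangulated subcategories with $\mathrm{Hom}_{\mathcal{D}}(A_i,A_j)=0$ for all $A_i\in\mathcal{A}_i$, $A_j\in\mathcal{A}_j$, $j<i$, such that the smallest full triangulated subcategory containing all $\mathcal{A}_i$ is $\mathcal{D}$. **Young diagrams and orders.** $P(a,b)$ is the set of sequences of integers $\boldsymbol{\lambda}=(\lambda_1,\dots,\lambda_b)$ with $a\ge\lambda_1\ge\dots\ge\lambda_b\ge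 0$. $\boldsymbol{\lambda}<_l\boldsymbol{\lambda}'$ iff there is $j$ with $\lambda_a=\lambda'_a$ for all $a<j$ and $\lambda_j<\lambda'_j$. $(\boldsymbol{\lambda}(1),\dots,\boldsymbol{\lambda}(n-1))<_{pl}(\boldsymbol{\lambda}(1)',\dots,\boldsymbol{\lambda}(n-1)')$ iff there is $1\le i\le n-1$ with $\boldsymbol{\lambda}(j)=\boldsymbol{\lambda}(j)'$ for all $j<i$ and $\boldsymbol{\lambda}(i)<_l\boldsymbol{\lambda}(i)'$. **Weights.** $C(n,N)=\{\underline{k}=(k_1,\dots,k_n)\in\mathbb{Z}_{\ge0}^n: k_1+\dots+k_n=N\}$; $\alpha_i=(0,\dots,0,-1,1,0,\dots,0)\in\mathbb{Z}^n$ with $-1$ in position $i$, $1\le i\le n-1$; $\langle\cdot,\cdot\rangle$ is the standard pairing on $\mathbb{Z}^n$. **Partial categorical $\dot{\mathcal{U}}_{0,N}(L\mathfrak{sl}_n)$ action.** It consists of a 2-category $\mathcal{K}$ which is triangulated (Hom-categories are triangulated and composition is exact), $\mathbb{C}$-linear and idempotent complete. Its objects are $\mathcal{K}(\underline{k})$, $\underline{k}\in C(n,N)$, each a triangulated category; 1-morphisms are (exact) functors between these categories, and $\mathrm{Hom}(\mathcal{K}(\underline{k}),\mathcal{K}(\underline{l}))$ is a triangulated category for all $\underline{k},\underline{l}$. There are 1-morphisms: the identity $\mathbf{1}_{\underline{k}}$ of $\mathcal{K}(\underline{k})$; $\mathsf{E}_{i,r}\mathbf{1}_{\underline{k}}=\mathbf{1}_{\underline{k}+\alpha_i}\mathsf{E}_{i,r}:\mathcal{K}(\underline{k})\to\mathcal{K}(\underline{k}+\alpha_i)$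 for $-k_i-1\le r\le 0$; $\mathsf{F}_{i,s}\mathbf{1}_{\underline{k}}=\mathbf{1}_{\underline{k}-\alpha_i}\mathsf{F}_{i,s}:\mathcal{K}(\underline{k})\to\mathcal{K}(\underline{k}-\alpha_i)$ for $0\le s\le k_{i+1}+1$; $(\mathsf{\Psi}_i^{\pm})^{\pm1}\mathbf{1}_{\underline{k}}=\mathbf{1}_{\underline{k}}(\mathsf{\Psi}_i^{\pm})^{\pm1}$, with $(\mathsf{\Psi}_i^{\pm})^{-1}$ inverse to $\mathsf{\Psi}_i^{\pm}$; and $\mathsf{H}_{i,\pm1}\mathbf{1}_{\underline{k}}=\mathbf{1}_{\underline{k}}\mathsf{H}_{i,\pm1}$, on which no conditions are imposed ($1\le i\le n-1$). Weights outside $C(n,N)$ are treated as zero: $\mathbf{1}_{\underline{k}}=0$ for $\underline{k}\notin C(n,N)$, and any 1-morphism through such a weight is $0$. The conditions are, for all $r,s$ for which they make sense (isomorphisms are abstract; no specific 2-morphisms are prescribed): 1. The space of maps between any two 1-morphisms is finite-dimensional. 2. If $\alpha=\alpha_i$, or $\alpha=\alpha_i+\alpha_j$ for some $i,j$ with $\langle\alpha_i,\alpha_j\rangle=-1$, then $\mathbf{1}_{\underline{k}+r\alpha}=0$ for $r\gg0$ or $r\ll0$. 3. If $i\ne j$ and $\mathbf{1}_{\underline{k}+\alpha_i},\mathbf{1}_{\underline{k}+\alpha_j}$ are nonzero, then $\mathbf{1}_{\underline{k}}$ and $\mathbf{1}_{\underline{k}+\alpha_i+\alpha_j}$ are nonzero.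 4. Right adjoints: (a) $(\mathsf{E}_{i,r}\mathbf{1}_{\underline{k}})^R\cong\mathbf{1}_{\underline{k}}(\mathsf{\Psi}_i^+)^{r+1}\mathsf{F}_{i,k_{i+1}+2}(\mathsf{\Psi}_i^+)^{-r-2}[-r-1]$; (b) $(\mathsf{F}_{i,s}\mathbf{1}_{\underline{k}})^R\cong\mathbf{1}_{\underline{k}}(\mathsf{\Psi}_i^-)^{-s+1}\mathsf{E}_{i,-k_i-2}(\mathsf{\Psi}_i^-)^{s-2}[s-1]$. 5. (a) $\mathsf{\Psi}_i^{\pm}\mathsf{E}_{i,r}\mathbf{1}_{\underline{k}}\cong\mathsf{E}_{i,r+1}\mathsf{\Psi}_i^{\pm}\mathbf{1}_{\underline{k}}[\mp1]$; (b) $\mathsf{\Psi}_i^{\pm}\mathsf{F}_{i,s}\mathbf{1}_{\underline{k}}\cong\mathsf{F}_{i,s-1}\mathsf{\Psi}_i^{\pm}\mathbf{1}_{\underline{k}}[\pm1]$. 6. (a) if $r+s=k_{i+1}$ there is an exact triangle $\mathsf{F}_{i,s}\mathsf{E}_{i,r}\mathbf{1}_{\underline{k}}\to\mathsf{E}_{i,r}\mathsf{F}_{i,s}\mathbf{1}_{\underline{k}}\to\mathsf{\Psi}_i^+\mathbf{1}_{\underline{k}}$; (b) if $r+s=-k_i$ there is an exact triangle $\mathsf{E}_{i,r}\mathsf{F}_{i,s}\mathbf{1}_{\underline{k}}\to\mathsf{F}_{i,s}\mathsf{E}_{i,r}\mathbf{1}_{\underline{k}}\to\mathsf{\Psi}_i^-\mathbf{1}_{\underline{k}}$;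 (c) if $-k_i+1\le r+s\le k_{i+1}-1$ then $\mathsf{F}_{i,s}\mathsf{E}_{i,r}\mathbf{1}_{\underline{k}}\cong\mathsf{E}_{i,r}\mathsf{F}_{i,s}\mathbf{1}_{\underline{k}}$. *)

theory Defs
  imports Complex_Main "HOL-Library.FuncSet" "HOL-Library.Function_Algebras" "HOL-Algebra.Module"
begin

section \<open>Triangulated categories\<close>

text \<open>
  One record carries a category, the abelian group structure on its hom-sets, the shift functors
  \<open>[m]\<close> on objects (\<open>Sh m\<close>) and on morphisms (\<open>ShM m\<close>), and the distinguished triangles
  \<open>X \<rightarrow> Y \<rightarrow> Z \<rightarrow> X[1]\<close> (\<open>Tri X Y Z f g h\<close>).  The shift is a strict action of the integers, that is,
  \<open>[1]\<close> is an automorphism.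
\<close>

record ('o, 'm) tcat =
  Obj :: "'o set"
  Mor :: "'o \<Rightarrow> 'o \<Rightarrow> 'm set"
  Idt :: "'o \<Rightarrow> 'm"
  Cmp :: "'m \<Rightarrow> 'm \<Rightarrow> 'm" (infixr \<open>\<cdot>\<index>\<close> 70)
  Zer :: "'o \<Rightarrow> 'o \<Rightarrow> 'm"
  Pls :: "'m \<Rightarrow> 'm \<Rightarrow> 'm" (infixl \<open>\<boxplus>\<index>\<close> 65)
  Sh :: "int \<Rightarrow> 'o \<Rightarrow> 'o"
  ShM :: "int \<Rightarrow> 'm \<Rightarrow> 'm"
  Tri :: "'o \<Rightarrow> 'o \<Rightarrow> 'o \<Rightarrow> 'm \<Rightarrow> 'm \<Rightarrow> 'm \<Rightarrow> bool"

text \<open>The multiplicative fields are irrelevant for \<^locale>\<open>abelian_group\<close>.\<close>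

definition hom_group :: "('o, 'm, 'z) tcat_scheme \<Rightarrow> 'o \<Rightarrow> 'o \<Rightarrow> 'm ring" where
  "hom_group C X Y =
     \<lparr>carrier = Mor C X Y, mult = (\<lambda>_ _. undefined), one = undefined,
      zero = Zer C X Y, add = Pls C\<rparr>"

definition is_iso :: "('o, 'm, 'z) tcat_scheme \<Rightarrow> 'o \<Rightarrow> 'o \<Rightarrow> 'm \<Rightarrow> bool" where
  "is_iso C X Y f \<longleftrightarrow> f \<in> Mor C X Y \<and>
     (\<exists>g \<in> Mor C Y X. g \<cdot>\<^bsub>C\<^esub> f = Idt C X \<and> f \<cdot>\<^bsub>C\<^esub> g = Idt C Y)"

definition isomorphic :: "('o, 'm, 'z) tcat_scheme \<Rightarrow> 'o \<Rightarrow> 'o \<Rightarrow> bool" (infix \<open>\<simeq>\<index>\<close> 50) where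
  "X \<simeq>\<^bsub>C\<^esub> Y \<longleftrightarrow> X \<in> Obj C \<and> Y \<in> Obj C \<and> (\<exists>f. is_iso C X Y f)"

definition zero_object :: "('o, 'm, 'z) tcat_scheme \<Rightarrow> 'o \<Rightarrow> bool" where
  "zero_object C X \<longleftrightarrow> X \<in> Obj C \<and>
     (\<forall>Y \<in> Obj C. (\<exists>!f. f \<in> Mor C X Y) \<and> (\<exists>!f. f \<in> Mor C Y X))"

locale is_category =
  fixes C :: "('o, 'm, 'z) tcat_scheme" (structure)
  assumes mor_obj: "f \<in> Mor C X Y \<Longrightarrow> X \<in> Obj C \<and> Y \<in> Obj C"
    and mor_disjoint: "f \<in> Mor C X Y \<Longrightarrow> f \<in> Mor C X' Y' \<Longrightarrow> X = X' \<and> Y = Y'"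
    and idt_mor: "X \<in> Obj C \<Longrightarrow> Idt C X \<in> Mor C X X"
    and cmp_mor: "f \<in> Mor C X Y \<Longrightarrow> g \<in> Mor C Y Z \<Longrightarrow> g \<cdot> f \<in> Mor C X Z"
    and cmp_assoc: "f \<in> Mor C W X \<Longrightarrow> g \<in> Mor C X Y \<Longrightarrow> h \<in> Mor C Y Z \<Longrightarrow>
          (h \<cdot> g) \<cdot> f = h \<cdot> (g \<cdot> f)"
    and cmp_idt_right: "f \<in> Mor C X Y \<Longrightarrow> f \<cdot> Idt C X = f"
    and cmp_idt_left: "f \<in> Mor C X Y \<Longrightarrow> Idt C Y \<cdot> f = f"

locale additive_category = is_category +
  assumes hom_abelian: "X \<in> Obj C \<Longrightarrow> Y \<in> Obj C \<Longrightarrow> abelian_group (hom_group C X Y)"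
    and cmp_add_right: "f \<in> Mor C X Y \<Longrightarrow> f' \<in> Mor C X Y \<Longrightarrow> g \<in> Mor C Y Z \<Longrightarrow>
          g \<cdot> (f \<boxplus> f') = (g \<cdot> f) \<boxplus> (g \<cdot> f')"
    and cmp_add_left: "f \<in> Mor C X Y \<Longrightarrow> g \<in> Mor C Y Z \<Longrightarrow> g' \<in> Mor C Y Z \<Longrightarrow>
          (g \<boxplus> g') \<cdot> f = (g \<cdot> f) \<boxplus> (g' \<cdot> f)"
    and has_zero_object: "\<exists>X. zero_object C X"
    and has_biproducts: "X \<in> Obj C \<Longrightarrow> Y \<in> Obj C \<Longrightarrow>
          \<exists>S i j p q. i \<in> Mor C X S \<and> j \<in> Mor C Y S \<and> p \<in> Mor C S X \<and> q \<in> Mor C S Y \<and>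
            p \<cdot> i = Idt C X \<and> q \<cdot> j = Idt C Y \<and> p \<cdot> j = Zer C Y X \<and> q \<cdot> i = Zer C X Y \<and>
            (i \<cdot> p) \<boxplus> (j \<cdot> q) = Idt C S"

locale triangulated_category = additive_category +
  assumes sh_obj: "X \<in> Obj C \<Longrightarrow> Sh C m X \<in> Obj C"
    and sh_zero: "X \<in> Obj C \<Longrightarrow> Sh C 0 X = X"
    and sh_add: "X \<in> Obj C \<Longrightarrow> Sh C (m + m') X = Sh C m (Sh C m' X)"
    and shm_mor: "f \<in> Mor C X Y \<Longrightarrow> ShM C m f \<in> Mor C (Sh C m X) (Sh C m Y)"
    and shm_zero: "f \<in> Mor C X Y \<Longrightarrow> ShM C 0 f = f"
    and shm_add: "f \<in> Mor C X Y \<Longrightarrow> ShM C (m + m') f = ShM C m (ShM C m' f)"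
    and shm_idt: "X \<in> Obj C \<Longrightarrow> ShM C m (Idt C X) = Idt C (Sh C m X)"
    and shm_cmp: "f \<in> Mor C X Y \<Longrightarrow> g \<in> Mor C Y Z \<Longrightarrow> ShM C m (g \<cdot> f) = ShM C m g \<cdot> ShM C m f"
    and shm_pls: "f \<in> Mor C X Y \<Longrightarrow> g \<in> Mor C X Y \<Longrightarrow>
          ShM C m (f \<boxplus> g) = ShM C m f \<boxplus> ShM C m g"
    and tri_mor: "Tri C X Y Z f g h \<Longrightarrow>
          f \<in> Mor C X Y \<and> g \<in> Mor C Y Z \<and> h \<in> Mor C Z (Sh C 1 X)"
    and TR1_iso: "Tri C X Y Z f g h \<Longrightarrow>
          f' \<in> Mor C X' Y' \<Longrightarrow> g' \<in> Mor C Y' Z' \<Longrightarrow> h' \<in> Mor C Z' (Sh C 1 X') \<Longrightarrow>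
          is_iso C X X' a \<Longrightarrow> is_iso C Y Y' b \<Longrightarrow> is_iso C Z Z' c \<Longrightarrow>
          f' \<cdot> a = b \<cdot> f \<Longrightarrow> g' \<cdot> b = c \<cdot> g \<Longrightarrow> h' \<cdot> c = ShM C 1 a \<cdot> h \<Longrightarrow>
          Tri C X' Y' Z' f' g' h'"
    and TR1_idt: "X \<in> Obj C \<Longrightarrow> zero_object C Z \<Longrightarrow>
          Tri C X X Z (Idt C X) (Zer C X Z) (Zer C Z (Sh C 1 X))"
    and TR1_cone: "f \<in> Mor C X Y \<Longrightarrow> \<exists>Z g h. Tri C X Y Z f g h"
    and TR2: "f \<in> Mor C X Y \<Longrightarrow> g \<in> Mor C Y Z \<Longrightarrow> h \<in> Mor C Z (Sh C 1 X) \<Longrightarrow>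
          Tri C X Y Z f g h \<longleftrightarrow>
          Tri C Y Z (Sh C 1 X) g h (\<ominus>\<^bsub>hom_group C (Sh C 1 X) (Sh C 1 Y)\<^esub> ShM C 1 f)"
    and TR3: "Tri C X Y Z f g h \<Longrightarrow> Tri C X' Y' Z' f' g' h' \<Longrightarrow>
          a \<in> Mor C X X' \<Longrightarrow> b \<in> Mor C Y Y' \<Longrightarrow> f' \<cdot> a = b \<cdot> f \<Longrightarrow>
          \<exists>c \<in> Mor C Z Z'. g' \<cdot> b = c \<cdot> g \<and> h' \<cdot> c = ShM C 1 a \<cdot> h"
    and TR4: "Tri C X Y Q1 f p1 d1 \<Longrightarrow> Tri C X Z Q2 (g \<cdot> f) p2 d2 \<Longrightarrow> Tri C Y Z Q3 g p3 d3 \<Longrightarrow>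
          \<exists>a b. Tri C Q1 Q2 Q3 a b (ShM C 1 p1 \<cdot> d3) \<and>
            a \<cdot> p1 = p2 \<cdot> g \<and> d2 \<cdot> a = d1 \<and> b \<cdot> p2 = p3 \<and> d3 \<cdot> b = ShM C 1 f \<cdot> d2"

definition idempotent_complete :: "('o, 'm, 'z) tcat_scheme \<Rightarrow> bool" where
  "idempotent_complete C \<longleftrightarrow>
     (\<forall>X \<in> Obj C. \<forall>e \<in> Mor C X X. e \<cdot>\<^bsub>C\<^esub> e = e \<longrightarrow>
       (\<exists>Y \<in> Obj C. \<exists>p \<in> Mor C X Y. \<exists>i \<in> Mor C Y X. i \<cdot>\<^bsub>C\<^esub> p = e \<and> p \<cdot>\<^bsub>C\<^esub> i = Idt C Y))"

text \<open>
  An exact functor, given by its object map \<open>F\<close> and its morphism map \<open>Fm\<close>: additive, and commuting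
  with \<open>[1]\<close> up to some natural isomorphism \<open>\<xi>\<close> through which distinguished triangles are preserved.
\<close>

locale exact_functor =
  fixes C :: "('o, 'm, 'z) tcat_scheme" and D :: "('o2, 'm2, 'z2) tcat_scheme"
    and F :: "'o \<Rightarrow> 'o2" and Fm :: "'m \<Rightarrow> 'm2"
  assumes fun_obj: "X \<in> Obj C \<Longrightarrow> F X \<in> Obj D"
    and fun_mor: "f \<in> Mor C X Y \<Longrightarrow> Fm f \<in> Mor D (F X) (F Y)"
    and fun_idt: "X \<in> Obj C \<Longrightarrow> Fm (Idt C X) = Idt D (F X)"
    and fun_cmp: "f \<in> Mor C X Y \<Longrightarrow> g \<in> Mor C Y Z \<Longrightarrow> Fm (g \<cdot>\<^bsub>C\<^esub> f) = Fm g \<cdot>\<^bsub>D\<^esub> Fm f"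
    and fun_pls: "f \<in> Mor C X Y \<Longrightarrow> g \<in> Mor C X Y \<Longrightarrow> Fm (f \<boxplus>\<^bsub>C\<^esub> g) = Fm f \<boxplus>\<^bsub>D\<^esub> Fm g"
    and fun_exact: "\<exists>\<xi>. (\<forall>X \<in> Obj C. is_iso D (F (Sh C 1 X)) (Sh D 1 (F X)) (\<xi> X)) \<and>
          (\<forall>X Y. \<forall>f \<in> Mor C X Y. \<xi> Y \<cdot>\<^bsub>D\<^esub> Fm (ShM C 1 f) = ShM D 1 (Fm f) \<cdot>\<^bsub>D\<^esub> \<xi> X) \<and>
          (\<forall>X Y Z f g h. Tri C X Y Z f g h \<longrightarrow>
             Tri D (F X) (F Y) (F Z) (Fm f) (Fm g) (\<xi> X \<cdot>\<^bsub>D\<^esub> Fm h))"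

section \<open>Semiorthogonal decompositions\<close>

text \<open>
  Full subcategories are sets of objects; full triangulated subcategories are taken to be strictly
  full (closed under isomorphism).
\<close>

definition tri_subcat :: "('o, 'm, 'z) tcat_scheme \<Rightarrow> 'o set \<Rightarrow> bool" where
  "tri_subcat C S \<longleftrightarrow> S \<subseteq> Obj C \<and> S \<noteq> {} \<and>
     (\<forall>X Y. X \<in> S \<and> X \<simeq>\<^bsub>C\<^esub> Y \<longrightarrow> Y \<in> S) \<and>
     (\<forall>X \<in> S. \<forall>m. Sh C m X \<in> S) \<and>
     (\<forall>X Y Z f g h. Tri C X Y Z f g h \<and> X \<in> S \<and> Y \<in> S \<longrightarrow> Z \<in> S)"

definition tri_hull :: "('o, 'm, 'z) tcat_scheme \<Rightarrow> 'o set \<Rightarrow> 'o set" where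
  "tri_hull C S = \<Inter> {T. tri_subcat C T \<and> S \<subseteq> T}"

definition right_orth :: "('o, 'm, 'z) tcat_scheme \<Rightarrow> 'o set \<Rightarrow> 'o set" where
  "right_orth C S = {X \<in> Obj C. \<forall>A \<in> S. Mor C A X = {Zer C A X}}"

definition semiorthogonal_decomposition :: "('o, 'm, 'z) tcat_scheme \<Rightarrow> 'o set list \<Rightarrow> bool" where
  "semiorthogonal_decomposition C As \<longleftrightarrow>
     (\<forall>A \<in> set As. tri_subcat C A) \<and>
     (\<forall>i < length As. \<forall>j < i. \<forall>X \<in> As ! i. \<forall>Y \<in> As ! j. Mor C X Y = {Zer C X Y}) \<and>
     tri_hull C (\<Union> (set As)) = Obj C"

section \<open>Complex linear structure\<close>

record ('o, 'm) lcat = "('o, 'm) tcat" +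
  Scl :: "complex \<Rightarrow> 'm \<Rightarrow> 'm"

definition complex_ring :: "complex ring" where
  "complex_ring = \<lparr>carrier = UNIV, mult = (*), one = 1, zero = 0, add = (+)\<rparr>"

definition hom_module :: "('o, 'm, 'z) lcat_scheme \<Rightarrow> 'o \<Rightarrow> 'o \<Rightarrow> (complex, 'm) module" where
  "hom_module C X Y =
     \<lparr>carrier = Mor C X Y, mult = (\<lambda>_ _. undefined), one = undefined,
      zero = Zer C X Y, add = Pls C, smult = Scl C\<rparr>"

locale linear_triangulated_category = triangulated_category C
  for C :: "('o, 'm, 'z) lcat_scheme" (structure) +
  assumes hom_linear: "X \<in> Obj C \<Longrightarrow> Y \<in> Obj C \<Longrightarrow> module complex_ring (hom_module C X Y)"
    and cmp_scl: "f \<in> Mor C X Y \<Longrightarrow> g \<in> Mor C Y Z \<Longrightarrow>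
          Scl C c g \<cdot> f = Scl C c (g \<cdot> f) \<and> g \<cdot> Scl C c f = Scl C c (g \<cdot> f)"
    and shm_scl: "f \<in> Mor C X Y \<Longrightarrow> ShM C m (Scl C c f) = Scl C c (ShM C m f)"

definition fin_dim_hom :: "('o, 'm, 'z) lcat_scheme \<Rightarrow> 'o \<Rightarrow> 'o \<Rightarrow> bool" where
  "fin_dim_hom C X Y \<longleftrightarrow>
     (\<exists>B \<subseteq> Mor C X Y. finite B \<and>
       (\<forall>f \<in> Mor C X Y. \<exists>c. f = finsum (hom_module C X Y) (\<lambda>b. Scl C (c b) b) B))"

section \<open>Triangulated 2-categories of exact functors\<close>

text \<open>
  A strict 2-category with objects indexed by \<open>'w\<close>.  \<open>Hm k l\<close> is the category of 1-morphisms from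
  \<open>k\<close> to \<open>l\<close>, \<open>G \<star> F\<close> is composition of 1-morphisms (first \<open>F\<close>, then \<open>G\<close>), \<open>\<sigma> \<diamondop> \<tau>\<close> is horizontal
  composition of 2-morphisms; vertical composition is the composition of \<open>Hm k l\<close>.

  The 2-category acts on triangulated categories \<open>Ct k\<close>: a 1-morphism \<open>F\<close> acts as a functor
  (\<open>FOb F\<close>, \<open>FMo F\<close>), and a 2-morphism \<open>\<tau>\<close> acts as a natural transformation with components
  \<open>NT \<tau> A\<close>.  Neither assignment need be injective, so that 1-morphisms may be literally functors, or,
  say, Fourier-Mukai kernels together with the functors they induce.
\<close>

record ('w, 'o, 'm, 'f, 't) two_cat =
  Hm :: "'w \<Rightarrow> 'w \<Rightarrow> ('f, 't) lcat"
  Id1 :: "'w \<Rightarrow> 'f"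
  Cmp1 :: "'f \<Rightarrow> 'f \<Rightarrow> 'f" (infixr \<open>\<star>\<index>\<close> 75)
  Cmp2 :: "'t \<Rightarrow> 't \<Rightarrow> 't" (infixr \<open>\<diamondop>\<index>\<close> 75)
  Ct :: "'w \<Rightarrow> ('o, 'm) tcat"
  FOb :: "'f \<Rightarrow> 'o \<Rightarrow> 'o"
  FMo :: "'f \<Rightarrow> 'm \<Rightarrow> 'm"
  NT :: "'t \<Rightarrow> 'o \<Rightarrow> 'm"

locale strict_two_category =
  fixes W :: "'w set" and K :: "('w, 'o, 'm, 'f, 't, 'z) two_cat_scheme" (structure)
  assumes hm_category: "k \<in> W \<Longrightarrow> l \<in> W \<Longrightarrow> is_category (Hm K k l)"
    and hm_disjoint: "k \<in> W \<Longrightarrow> l \<in> W \<Longrightarrow> k' \<in> W \<Longrightarrow> l' \<in> W \<Longrightarrow>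
          F \<in> Obj (Hm K k l) \<Longrightarrow> F \<in> Obj (Hm K k' l') \<Longrightarrow> k = k' \<and> l = l'"
    and hm_mor_disjoint: "k \<in> W \<Longrightarrow> l \<in> W \<Longrightarrow> k' \<in> W \<Longrightarrow> l' \<in> W \<Longrightarrow>
          \<tau> \<in> Mor (Hm K k l) F G \<Longrightarrow> \<tau> \<in> Mor (Hm K k' l') F' G' \<Longrightarrow> k = k' \<and> l = l'"
    and id1: "k \<in> W \<Longrightarrow> Id1 K k \<in> Obj (Hm K k k)"
    and cmp1: "k \<in> W \<Longrightarrow> l \<in> W \<Longrightarrow> m \<in> W \<Longrightarrow> F \<in> Obj (Hm K k l) \<Longrightarrow> G \<in> Obj (Hm K l m) \<Longrightarrow>
          G \<star> F \<in> Obj (Hm K k m)"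
    and cmp1_assoc: "k \<in> W \<Longrightarrow> l \<in> W \<Longrightarrow> m \<in> W \<Longrightarrow> p \<in> W \<Longrightarrow>
          F \<in> Obj (Hm K k l) \<Longrightarrow> G \<in> Obj (Hm K l m) \<Longrightarrow> H \<in> Obj (Hm K m p) \<Longrightarrow>
          (H \<star> G) \<star> F = H \<star> (G \<star> F)"
    and cmp1_id: "k \<in> W \<Longrightarrow> l \<in> W \<Longrightarrow> F \<in> Obj (Hm K k l) \<Longrightarrow>
          F \<star> Id1 K k = F \<and> Id1 K l \<star> F = F"
    and cmp2: "k \<in> W \<Longrightarrow> l \<in> W \<Longrightarrow> m \<in> W \<Longrightarrow>
          \<tau> \<in> Mor (Hm K k l) F F' \<Longrightarrow> \<sigma> \<in> Mor (Hm K l m) G G' \<Longrightarrow>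
          \<sigma> \<diamondop> \<tau> \<in> Mor (Hm K k m) (G \<star> F) (G' \<star> F')"
    and cmp2_assoc: "k \<in> W \<Longrightarrow> l \<in> W \<Longrightarrow> m \<in> W \<Longrightarrow> p \<in> W \<Longrightarrow>
          \<tau> \<in> Mor (Hm K k l) F F' \<Longrightarrow> \<sigma> \<in> Mor (Hm K l m) G G' \<Longrightarrow> \<rho> \<in> Mor (Hm K m p) H H' \<Longrightarrow>
          (\<rho> \<diamondop> \<sigma>) \<diamondop> \<tau> = \<rho> \<diamondop> (\<sigma> \<diamondop> \<tau>)"
    and cmp2_unit: "k \<in> W \<Longrightarrow> l \<in> W \<Longrightarrow> \<tau> \<in> Mor (Hm K k l) F F' \<Longrightarrow>
          \<tau> \<diamondop> Idt (Hm K k k) (Id1 K k) = \<tau> \<and> Idt (Hm K l l) (Id1 K l) \<diamondop> \<tau> = \<tau>"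
    and cmp2_idt: "k \<in> W \<Longrightarrow> l \<in> W \<Longrightarrow> m \<in> W \<Longrightarrow> F \<in> Obj (Hm K k l) \<Longrightarrow> G \<in> Obj (Hm K l m) \<Longrightarrow>
          Idt (Hm K l m) G \<diamondop> Idt (Hm K k l) F = Idt (Hm K k m) (G \<star> F)"
    and interchange: "k \<in> W \<Longrightarrow> l \<in> W \<Longrightarrow> m \<in> W \<Longrightarrow>
          \<tau> \<in> Mor (Hm K k l) F F' \<Longrightarrow> \<tau>' \<in> Mor (Hm K k l) F' F'' \<Longrightarrow>
          \<sigma> \<in> Mor (Hm K l m) G G' \<Longrightarrow> \<sigma>' \<in> Mor (Hm K l m) G' G'' \<Longrightarrow>
          (\<sigma>' \<cdot>\<^bsub>Hm K l m\<^esub> \<sigma>) \<diamondop> (\<tau>' \<cdot>\<^bsub>Hm K k l\<^esub> \<tau>) = (\<sigma>' \<diamondop> \<tau>') \<cdot>\<^bsub>Hm K k m\<^esub> (\<sigma> \<diamondop> \<tau>)"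

text \<open>
  In \<open>nt_exact\<close>, evaluation at an object of \<open>Ct k\<close> is exact: this is the counterpart of exactness of
  composition for the action on objects, and says that shifts and distinguished triangles of
  1-morphisms induce those of the values of the functors.
\<close>

locale triangulated_two_category = strict_two_category +
  assumes hm_linear_triangulated: "k \<in> W \<Longrightarrow> l \<in> W \<Longrightarrow> linear_triangulated_category (Hm K k l)"
    and hm_idempotent_complete: "k \<in> W \<Longrightarrow> l \<in> W \<Longrightarrow> idempotent_complete (Hm K k l)"
    and cmp2_scl: "k \<in> W \<Longrightarrow> l \<in> W \<Longrightarrow> m \<in> W \<Longrightarrow>
          \<tau> \<in> Mor (Hm K k l) F F' \<Longrightarrow> \<sigma> \<in> Mor (Hm K l m) G G' \<Longrightarrow>
          Scl (Hm K l m) c \<sigma> \<diamondop> \<tau> = Scl (Hm K k m) c (\<sigma> \<diamondop> \<tau>) \<and>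
          \<sigma> \<diamondop> Scl (Hm K k l) c \<tau> = Scl (Hm K k m) c (\<sigma> \<diamondop> \<tau>)"
    and cmp_exact_left: "k \<in> W \<Longrightarrow> l \<in> W \<Longrightarrow> m \<in> W \<Longrightarrow> G \<in> Obj (Hm K l m) \<Longrightarrow>
          exact_functor (Hm K k l) (Hm K k m) (\<lambda>F. G \<star> F) (\<lambda>\<tau>. Idt (Hm K l m) G \<diamondop> \<tau>)"
    and cmp_exact_right: "k \<in> W \<Longrightarrow> l \<in> W \<Longrightarrow> m \<in> W \<Longrightarrow> F \<in> Obj (Hm K k l) \<Longrightarrow>
          exact_functor (Hm K l m) (Hm K k m) (\<lambda>G. G \<star> F) (\<lambda>\<sigma>. \<sigma> \<diamondop> Idt (Hm K k l) F)"
    and ct_triangulated: "k \<in> W \<Longrightarrow> triangulated_category (Ct K k)"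
    and fun_exact: "k \<in> W \<Longrightarrow> l \<in> W \<Longrightarrow> F \<in> Obj (Hm K k l) \<Longrightarrow>
          exact_functor (Ct K k) (Ct K l) (FOb K F) (FMo K F)"
    and fun_id1: "k \<in> W \<Longrightarrow> (\<forall>A \<in> Obj (Ct K k). FOb K (Id1 K k) A = A) \<and>
          (\<forall>A B. \<forall>f \<in> Mor (Ct K k) A B. FMo K (Id1 K k) f = f)"
    and fun_cmp1: "k \<in> W \<Longrightarrow> l \<in> W \<Longrightarrow> m \<in> W \<Longrightarrow> F \<in> Obj (Hm K k l) \<Longrightarrow> G \<in> Obj (Hm K l m) \<Longrightarrow>
          (\<forall>A \<in> Obj (Ct K k). FOb K (G \<star> F) A = FOb K G (FOb K F A)) \<and>
          (\<forall>A B. \<forall>f \<in> Mor (Ct K k) A B. FMo K (G \<star> F) f = FMo K G (FMo K F f))"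
    and nt_natural: "k \<in> W \<Longrightarrow> l \<in> W \<Longrightarrow> \<tau> \<in> Mor (Hm K k l) F G \<Longrightarrow> f \<in> Mor (Ct K k) A B \<Longrightarrow>
          NT K \<tau> B \<cdot>\<^bsub>Ct K l\<^esub> FMo K F f = FMo K G f \<cdot>\<^bsub>Ct K l\<^esub> NT K \<tau> A"
    and nt_cmp2: "k \<in> W \<Longrightarrow> l \<in> W \<Longrightarrow> m \<in> W \<Longrightarrow>
          \<tau> \<in> Mor (Hm K k l) F F' \<Longrightarrow> \<sigma> \<in> Mor (Hm K l m) G G' \<Longrightarrow> A \<in> Obj (Ct K k) \<Longrightarrow>
          NT K (\<sigma> \<diamondop> \<tau>) A = NT K \<sigma> (FOb K F' A) \<cdot>\<^bsub>Ct K m\<^esub> FMo K G (NT K \<tau> A)"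
    and nt_exact: "k \<in> W \<Longrightarrow> l \<in> W \<Longrightarrow> A \<in> Obj (Ct K k) \<Longrightarrow>
          exact_functor (Hm K k l) (Ct K l) (\<lambda>F. FOb K F A) (\<lambda>\<tau>. NT K \<tau> A)"

text \<open>\<open>R : l \<rightarrow> k\<close> is right adjoint to \<open>L : k \<rightarrow> l\<close> in the 2-category \<open>K\<close>.\<close>

definition is_right_adjoint ::
  "('w, 'o, 'm, 'f, 't, 'z) two_cat_scheme \<Rightarrow> 'w \<Rightarrow> 'w \<Rightarrow> 'f \<Rightarrow> 'f \<Rightarrow> bool" where
  "is_right_adjoint K k l L R \<longleftrightarrow> L \<in> Obj (Hm K k l) \<and> R \<in> Obj (Hm K l k) \<and>
     (\<exists>\<eta> \<in> Mor (Hm K k k) (Id1 K k) (R \<star>\<^bsub>K\<^esub> L). \<exists>\<epsilon> \<in> Mor (Hm K l l) (L \<star>\<^bsub>K\<^esub> R) (Id1 K l).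
        (\<epsilon> \<diamondop>\<^bsub>K\<^esub> Idt (Hm K k l) L) \<cdot>\<^bsub>Hm K k l\<^esub> (Idt (Hm K k l) L \<diamondop>\<^bsub>K\<^esub> \<eta>) = Idt (Hm K k l) L \<and>
        (Idt (Hm K l k) R \<diamondop>\<^bsub>K\<^esub> \<epsilon>) \<cdot>\<^bsub>Hm K l k\<^esub> (\<eta> \<diamondop>\<^bsub>K\<^esub> Idt (Hm K l k) R) = Idt (Hm K l k) R)"

section \<open>Weights, Young diagrams and orders\<close>

text \<open>Elements of \<open>\<int>\<^sup>n\<close> are integer functions vanishing outside \<open>{1..n}\<close>.\<close>

type_synonym weight = "nat \<Rightarrow> int"

definition Zn :: "nat \<Rightarrow> weight set" where
  "Zn n = {k. \<forall>j. j \<notin> {1..n} \<longrightarrow> k j = 0}"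

definition Cwt :: "nat \<Rightarrow> nat \<Rightarrow> weight set" where
  "Cwt n N = {k \<in> Zn n. (\<forall>j \<in> {1..n}. 0 \<le> k j) \<and> (\<Sum>j = 1..n. k j) = int N}"

definition alpha :: "nat \<Rightarrow> weight" where
  "alpha i = (\<lambda>j. if j = i then - 1 else if j = i + 1 then 1 else 0)"

definition pairing :: "nat \<Rightarrow> weight \<Rightarrow> weight \<Rightarrow> int" where
  "pairing n k l = (\<Sum>j = 1..n. k j * l j)"

definition eta :: "nat \<Rightarrow> nat \<Rightarrow> weight" where
  "eta n N = (\<lambda>j. if j = n then int N else 0)"

definition Ksum :: "weight \<Rightarrow> nat \<Rightarrow> nat" where
  "Ksum k i = nat (\<Sum>j = 1..i. k j)"

definition P :: "int \<Rightarrow> nat \<Rightarrow> int list set" where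
  "P a b = {xs. length xs = b \<and> (\<forall>x \<in> set xs. 0 \<le> x \<and> x \<le> a) \<and> sorted_wrt (\<ge>) xs}"

definition lt_l :: "int list \<Rightarrow> int list \<Rightarrow> bool" (infix \<open><\<^sub>l\<close> 50) where
  "xs <\<^sub>l ys \<longleftrightarrow>
     (\<exists>j. j < length xs \<and> j < length ys \<and> (\<forall>a < j. xs ! a = ys ! a) \<and> xs ! j < ys ! j)"

text \<open>The tuples \<open>(\<lambda>(1), \<dots>, \<lambda>(n - 1))\<close> with \<open>\<lambda>(i) \<in> P(k\<^sub>i\<^sub>+\<^sub>1, K\<^sub>i)\<close>, as extensional functions.\<close>

definition Lam :: "nat \<Rightarrow> weight \<Rightarrow> (nat \<Rightarrow> int list) set" where
  "Lam n k = (\<Pi>\<^sub>E i \<in> {1..n - 1}. P (k (i + 1)) (Ksum k i))"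

definition lt_pl :: "nat \<Rightarrow> (nat \<Rightarrow> int list) \<Rightarrow> (nat \<Rightarrow> int list) \<Rightarrow> bool" where
  "lt_pl n x y \<longleftrightarrow> (\<exists>i \<in> {1..n - 1}. (\<forall>j \<in> {1..<i}. x j = y j) \<and> x i <\<^sub>l y i)"

section \<open>Partial categorical actions\<close>

datatype sign = Plus | Minus

fun sg :: "sign \<Rightarrow> int" where
  "sg Plus = 1"
| "sg Minus = - 1"

text \<open>
  \<open>Ef i r k\<close> and \<open>Ff i s k\<close> are \<open>E\<^sub>i\<^sub>,\<^sub>r 1\<^sub>k\<close> and \<open>F\<^sub>i\<^sub>,\<^sub>s 1\<^sub>k\<close>; \<open>Psi\<close> and \<open>PsiInv\<close> are the \<open>\<Psi>\<^sub>i\<close> with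
  the given sign and their inverses; \<open>Hf Plus i k\<close> and \<open>Hf Minus i k\<close> are \<open>H\<^sub>i\<^sub>,\<^sub>1 1\<^sub>k\<close> and \<open>H\<^sub>i\<^sub>,\<^sub>-\<^sub>1 1\<^sub>k\<close>.
\<close>

record ('o, 'm, 'f, 't) action = "(weight, 'o, 'm, 'f, 't) two_cat" +
  Ef :: "nat \<Rightarrow> int \<Rightarrow> weight \<Rightarrow> 'f"
  Ff :: "nat \<Rightarrow> int \<Rightarrow> weight \<Rightarrow> 'f"
  Psi :: "sign \<Rightarrow> nat \<Rightarrow> weight \<Rightarrow> 'f"
  PsiInv :: "sign \<Rightarrow> nat \<Rightarrow> weight \<Rightarrow> 'f"
  Hf :: "sign \<Rightarrow> nat \<Rightarrow> weight \<Rightarrow> 'f"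

text \<open>The integer power of \<open>\<Psi>\<^sub>i\<close> at the weight \<open>k\<close>.\<close>

definition PsiPow ::
  "('o, 'm, 'f, 't, 'z) action_scheme \<Rightarrow> sign \<Rightarrow> nat \<Rightarrow> int \<Rightarrow> weight \<Rightarrow> 'f" where
  "PsiPow K e i m k =
     (if 0 \<le> m then ((\<lambda>T. Psi K e i k \<star>\<^bsub>K\<^esub> T) ^^ nat m) (Id1 K k)
      else ((\<lambda>T. PsiInv K e i k \<star>\<^bsub>K\<^esub> T) ^^ nat (- m)) (Id1 K k))"

text \<open>The ranges in which \<open>E\<^sub>i\<^sub>,\<^sub>r 1\<^sub>k\<close> and \<open>F\<^sub>i\<^sub>,\<^sub>s 1\<^sub>k\<close> are defined.\<close>

definition E_range :: "nat \<Rightarrow> int \<Rightarrow> weight \<Rightarrow> bool" where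
  "E_range i r k \<longleftrightarrow> - k i - 1 \<le> r \<and> r \<le> 0"

definition F_range :: "nat \<Rightarrow> int \<Rightarrow> weight \<Rightarrow> bool" where
  "F_range i s k \<longleftrightarrow> 0 \<le> s \<and> s \<le> k (i + 1) + 1"

text \<open>Both composites \<open>F\<^sub>i\<^sub>,\<^sub>s E\<^sub>i\<^sub>,\<^sub>r 1\<^sub>k\<close> and \<open>E\<^sub>i\<^sub>,\<^sub>r F\<^sub>i\<^sub>,\<^sub>s 1\<^sub>k\<close> are defined.\<close>

definition EF_range :: "nat \<Rightarrow> int \<Rightarrow> int \<Rightarrow> weight \<Rightarrow> bool" where
  "EF_range i r s k \<longleftrightarrow>
     E_range i r k \<and> F_range i s (k + alpha i) \<and> F_range i s k \<and> E_range i r (k - alpha i)"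

text \<open>
  Weights outside \<open>C(n, N)\<close> are zero: they are kept as objects of the 2-category, with
  \<open>1\<^sub>k = 0\<close>.  As composition is exact, every 1-morphism through such a weight is then zero, and so is
  every object of \<open>Ct k\<close>.

  In \<open>triangle_plus\<close> and \<open>triangle_minus\<close> at least one of the two composites has to pass through a weight
  in \<open>C(n, N)\<close>.  The excluded case is \<open>k\<^sub>i = k\<^sub>i\<^sub>+\<^sub>1 = 0\<close>: there both composites are zero by
  convention, and the triangles would force the invertible \<open>\<Psi>\<^sub>i\<close>, hence \<open>1\<^sub>k\<close>, to be zero, in
  particular at the weight \<open>\<eta> = (0, \<dots>, 0, N)\<close> for \<open>n \<ge> 3\<close>, contrary to the example of partial flag
  varieties.  Actions satisfying the triangles without this restriction are a special case.
\<close>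

locale partial_categorical_action = triangulated_two_category "Zn n" K
  for n :: nat and N :: nat and K :: "('o, 'm, 'f, 't, 'z) action_scheme" (structure) +
  assumes weight_zero: "k \<in> Zn n \<Longrightarrow> k \<notin> Cwt n N \<Longrightarrow> zero_object (Hm K k k) (Id1 K k)"
    and E_obj: "i \<in> {1..n - 1} \<Longrightarrow> k \<in> Zn n \<Longrightarrow> E_range i r k \<Longrightarrow>
          Ef K i r k \<in> Obj (Hm K k (k + alpha i))"
    and F_obj: "i \<in> {1..n - 1} \<Longrightarrow> k \<in> Zn n \<Longrightarrow> F_range i s k \<Longrightarrow>
          Ff K i s k \<in> Obj (Hm K k (k - alpha i))"
    and Psi_obj: "i \<in> {1..n - 1} \<Longrightarrow> k \<in> Zn n \<Longrightarrow>
          Psi K e i k \<in> Obj (Hm K k k) \<and> PsiInv K e i k \<in> Obj (Hm K k k)"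
    and Psi_inverse: "i \<in> {1..n - 1} \<Longrightarrow> k \<in> Zn n \<Longrightarrow>
          Psi K e i k \<star> PsiInv K e i k \<simeq>\<^bsub>Hm K k k\<^esub> Id1 K k \<and>
          PsiInv K e i k \<star> Psi K e i k \<simeq>\<^bsub>Hm K k k\<^esub> Id1 K k"
    and H_obj: "i \<in> {1..n - 1} \<Longrightarrow> k \<in> Zn n \<Longrightarrow> Hf K e i k \<in> Obj (Hm K k k)"
    and finite_dim: "k \<in> Zn n \<Longrightarrow> l \<in> Zn n \<Longrightarrow> F \<in> Obj (Hm K k l) \<Longrightarrow> G \<in> Obj (Hm K k l) \<Longrightarrow>
          fin_dim_hom (Hm K k l) F G"
    and integrable: "k \<in> Zn n \<Longrightarrow>
          (\<exists>i \<in> {1..n - 1}. \<alpha> = alpha i) \<or>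
          (\<exists>i \<in> {1..n - 1}. \<exists>j \<in> {1..n - 1}.
             pairing n (alpha i) (alpha j) = - 1 \<and> \<alpha> = alpha i + alpha j) \<Longrightarrow>
          (\<exists>r0. \<forall>r \<ge> r0. zero_object (Hm K (k + (\<lambda>j. r * \<alpha> j)) (k + (\<lambda>j. r * \<alpha> j)))
                                       (Id1 K (k + (\<lambda>j. r * \<alpha> j)))) \<or>
          (\<exists>r0. \<forall>r \<le> r0. zero_object (Hm K (k + (\<lambda>j. r * \<alpha> j)) (k + (\<lambda>j. r * \<alpha> j)))
                                       (Id1 K (k + (\<lambda>j. r * \<alpha> j))))"
    and nonzero_weights: "i \<in> {1..n - 1} \<Longrightarrow> j \<in> {1..n - 1} \<Longrightarrow> i \<noteq> j \<Longrightarrow> k \<in> Zn n \<Longrightarrow>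
          \<not> zero_object (Hm K (k + alpha i) (k + alpha i)) (Id1 K (k + alpha i)) \<Longrightarrow>
          \<not> zero_object (Hm K (k + alpha j) (k + alpha j)) (Id1 K (k + alpha j)) \<Longrightarrow>
          \<not> zero_object (Hm K k k) (Id1 K k) \<and>
          \<not> zero_object (Hm K (k + alpha i + alpha j) (k + alpha i + alpha j))
              (Id1 K (k + alpha i + alpha j))"
    and E_right_adjoint: "i \<in> {1..n - 1} \<Longrightarrow> k \<in> Zn n \<Longrightarrow> E_range i r k \<Longrightarrow>
          F_range i (k (i + 1) + 2) (k + alpha i) \<Longrightarrow>
          \<exists>R. is_right_adjoint K k (k + alpha i) (Ef K i r k) R \<and>
              R \<simeq>\<^bsub>Hm K (k + alpha i) k\<^esub>
                Sh (Hm K (k + alpha i) k) (- r - 1)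
                  (PsiPow K Plus i (r + 1) k \<star> Ff K i (k (i + 1) + 2) (k + alpha i)
                     \<star> PsiPow K Plus i (- r - 2) (k + alpha i))"
    and F_right_adjoint: "i \<in> {1..n - 1} \<Longrightarrow> k \<in> Zn n \<Longrightarrow> F_range i s k \<Longrightarrow>
          E_range i (- k i - 2) (k - alpha i) \<Longrightarrow>
          \<exists>R. is_right_adjoint K k (k - alpha i) (Ff K i s k) R \<and>
              R \<simeq>\<^bsub>Hm K (k - alpha i) k\<^esub>
                Sh (Hm K (k - alpha i) k) (s - 1)
                  (PsiPow K Minus i (- s + 1) k \<star> Ef K i (- k i - 2) (k - alpha i)
                     \<star> PsiPow K Minus i (s - 2) (k - alpha i))"
    and Psi_E: "i \<in> {1..n - 1} \<Longrightarrow> k \<in> Zn n \<Longrightarrow> E_range i r k \<Longrightarrow> E_range i (r + 1) k \<Longrightarrow>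
          Psi K e i (k + alpha i) \<star> Ef K i r k \<simeq>\<^bsub>Hm K k (k + alpha i)\<^esub>
            Sh (Hm K k (k + alpha i)) (- sg e) (Ef K i (r + 1) k \<star> Psi K e i k)"
    and Psi_F: "i \<in> {1..n - 1} \<Longrightarrow> k \<in> Zn n \<Longrightarrow> F_range i s k \<Longrightarrow> F_range i (s - 1) k \<Longrightarrow>
          Psi K e i (k - alpha i) \<star> Ff K i s k \<simeq>\<^bsub>Hm K k (k - alpha i)\<^esub>
            Sh (Hm K k (k - alpha i)) (sg e) (Ff K i (s - 1) k \<star> Psi K e i k)"
    and triangle_plus: "i \<in> {1..n - 1} \<Longrightarrow> k \<in> Zn n \<Longrightarrow> EF_range i r s k \<Longrightarrow>
          k + alpha i \<in> Cwt n N \<or> k - alpha i \<in> Cwt n N \<Longrightarrow> r + s = k (i + 1) \<Longrightarrow>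
          \<exists>f g h. Tri (Hm K k k) (Ff K i s (k + alpha i) \<star> Ef K i r k)
                    (Ef K i r (k - alpha i) \<star> Ff K i s k) (Psi K Plus i k) f g h"
    and triangle_minus: "i \<in> {1..n - 1} \<Longrightarrow> k \<in> Zn n \<Longrightarrow> EF_range i r s k \<Longrightarrow>
          k + alpha i \<in> Cwt n N \<or> k - alpha i \<in> Cwt n N \<Longrightarrow> r + s = - k i \<Longrightarrow>
          \<exists>f g h. Tri (Hm K k k) (Ef K i r (k - alpha i) \<star> Ff K i s k)
                    (Ff K i s (k + alpha i) \<star> Ef K i r k) (Psi K Minus i k) f g h"
    and EF_commute: "i \<in> {1..n - 1} \<Longrightarrow> k \<in> Zn n \<Longrightarrow> EF_range i r s k \<Longrightarrow>
          - k i + 1 \<le> r + s \<Longrightarrow> r + s \<le> k (i + 1) - 1 \<Longrightarrow>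
          Ff K i s (k + alpha i) \<star> Ef K i r k \<simeq>\<^bsub>Hm K k k\<^esub>
            Ef K i r (k - alpha i) \<star> Ff K i s k"

section \<open>The subcategories of the decomposition\<close>

text \<open>
  A product \<open>F\<^sub>i\<^sub>,\<^sub>s F\<^sub>j\<^sub>,\<^sub>t \<dots> 1\<^sub>k\<close> is given by the list \<open>[(i, s), (j, t), \<dots>]\<close> and the source weight \<open>k\<close>;
  the rightmost factor is applied first.
\<close>

fun Fword_target :: "(nat \<times> int) list \<Rightarrow> weight \<Rightarrow> weight" where
  "Fword_target [] k = k"
| "Fword_target ((i, s) # w) k = Fword_target w k - alpha i"

fun Fword :: "('o, 'm, 'f, 't, 'z) action_scheme \<Rightarrow> (nat \<times> int) list \<Rightarrow> weight \<Rightarrow> 'f" where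
  "Fword K [] k = Id1 K k"
| "Fword K ((i, s) # w) k = Ff K i s (Fword_target w k) \<star>\<^bsub>K\<^esub> Fword K w k"

definition lam_word :: "nat \<Rightarrow> (nat \<Rightarrow> int list) \<Rightarrow> (nat \<times> int) list" where
  "lam_word n lam = concat (map (\<lambda>i. map (Pair i) (lam i)) [1..<n])"

definition ImF ::
  "nat \<Rightarrow> nat \<Rightarrow> ('o, 'm, 'f, 't, 'z) action_scheme \<Rightarrow> weight \<Rightarrow> (nat \<Rightarrow> int list) \<Rightarrow> 'o set" where
  "ImF n N K k lam =
     tri_hull (Ct K k)
       {Y. \<exists>X \<in> Obj (Ct K (eta n N)). FOb K (Fword K (lam_word n lam) (eta n N)) X \<simeq>\<^bsub>Ct K k\<^esub> Y}"

definition Aorth ::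
  "nat \<Rightarrow> nat \<Rightarrow> ('o, 'm, 'f, 't, 'z) action_scheme \<Rightarrow> weight \<Rightarrow> 'o set" where
  "Aorth n N K k = right_orth (Ct K k) (tri_hull (Ct K k) (\<Union>lam \<in> Lam n k. ImF n N K k lam))"

end

theory Submission
  imports Defs
begin

text \<open>
  Write \<open>F\<^sub>\<lambda>\<close> for the functor \<open>K(\<eta>) \<rightarrow> K(k)\<close> belonging to a tuple \<open>\<lambda>\<close> of Young diagrams.  There are three
  things to show: \<open>Hom(F\<^sub>\<mu> X, F\<^sub>\<lambda> Y) = 0\<close> for \<open>\<mu>\<close> smaller than \<open>\<lambda>\<close>; each \<open>F\<^sub>\<lambda>\<close> is full; and each \<open>F\<^sub>\<lambda>\<close> has a right
  adjoint.  Given these, the cone of the universal map \<open>F\<^sub>\<lambda> A \<rightarrow> Y\<close> is right orthogonal to the image of \<open>F\<^sub>\<lambda>\<close>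
  (lemma \<open>approximation\<close>).  Peeling off the components in increasing order of \<open>\<lambda>\<close> reduces any object to one that
  is orthogonal to all of them (lemma \<open>approximation_list\<close>), so the components together with the orthogonal
  generate.  The right adjoints are part of the action.

  The other two points use left adjoints.  The right adjoint of \<open>E\<^sub>i\<^sub>,\<^sub>-\<^sub>1\<close> is, up to \<open>\<Psi>\<close>, the functor \<open>F\<^sub>i\<close> with
  the critical index \<open>m\<^sub>i\<^sub>+\<^sub>1 + 1\<close>, where \<open>m\<close> is the source weight.  A power \<open>\<Psi>\<^sup>-\<^sup>c\<close> moves any index \<open>s\<close> to
  \<open>s + c\<close>, so with \<open>c = m\<^sub>i\<^sub>+\<^sub>1 + 1 - s\<close> one finds that \<open>F\<^sub>i\<^sub>,\<^sub>s\<close> has a left adjoint which is \<open>E\<^sub>i\<^sub>,\<^sub>-\<^sub>1 \<Psi>\<^sup>-\<^sup>c\<close> up to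
  invertible functors.  Apply it to a word \<open>F\<^sub>i\<^sub>,\<^sub>t\<^sub>1 F\<^sub>i\<^sub>,\<^sub>t\<^sub>2 \<dots>\<close> with \<open>s > t\<^sub>1 \<ge> t\<^sub>2 \<ge> \<dots>\<close>: the indices \<open>t\<^sub>j + c\<close> lie
  below the critical one, so \<open>E\<^sub>i\<close> commutes with all these factors.  It arrives at a weight with \<open>i\<close>-th coordinate \<open>0\<close>,
  where \<open>E\<^sub>i\<close> is zero (lemma \<open>E_Psi_block_zero\<close>).  If the word starts with \<open>F\<^sub>i\<^sub>,\<^sub>s\<close> itself, the first step is
  the triangle \<open>F E \<rightarrow> E F \<rightarrow> \<Psi>\<^sup>+\<close>, whose term \<open>F E\<close> vanishes on the rest of the word, so the left adjoint strips off
  that factor.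

  As all words have the same sequence of indices \<open>i\<close>, the order on tuples is the lexicographic order of words.
  Stripping off the common prefix of two words and comparing at the first difference gives the vanishing
  (lemma \<open>orth_Fword\<close>).  Stripping off \<open>F\<^sub>i\<^sub>,\<^sub>s\<close> also gives an isomorphism of the left adjoint composed with \<open>F\<^sub>i\<^sub>,\<^sub>s\<close>
  with the identity on the image of the rest of the word.  This isomorphism is an abstract one, but its mere
  existence forces the counit to be invertible there (lemma \<open>counit_iso\<close>), and fullness of the words follows by
  induction (lemma \<open>full_Fword\<close>).
\<close>

section \<open>Triangulated categories\<close>

text \<open>
  For objects of an additive category this is the condition \<open>Mor C X Y = {Zer C X Y}\<close> of semiorthogonality
  (lemma \<open>no_mor_iff\<close>).
\<close>

definition no_mor :: "('o, 'm, 'z) tcat_scheme \<Rightarrow> 'o \<Rightarrow> 'o \<Rightarrow> bool" where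
  "no_mor C X Y \<longleftrightarrow> (\<forall>f \<in> Mor C X Y. f = Zer C X Y)"

context is_category
begin

lemma is_isoI:
  "f \<in> Mor C X Y \<Longrightarrow> g \<in> Mor C Y X \<Longrightarrow> g \<cdot> f = Idt C X \<Longrightarrow> f \<cdot> g = Idt C Y \<Longrightarrow> is_iso C X Y f"
  unfolding is_iso_def by blast

lemma isomorphicI: "is_iso C X Y f \<Longrightarrow> X \<simeq> Y"
  using mor_obj unfolding isomorphic_def is_iso_def by blast

lemma isomorphicI2:
  "f \<in> Mor C X Y \<Longrightarrow> g \<in> Mor C Y X \<Longrightarrow> g \<cdot> f = Idt C X \<Longrightarrow> f \<cdot> g = Idt C Y \<Longrightarrow> X \<simeq> Y"
  by (rule isomorphicI[OF is_isoI])

lemma isomorphicE: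
  assumes "X \<simeq> Y"
  obtains f g where "f \<in> Mor C X Y" "g \<in> Mor C Y X" "g \<cdot> f = Idt C X" "f \<cdot> g = Idt C Y"
    "X \<in> Obj C" "Y \<in> Obj C"
  using assms unfolding isomorphic_def is_iso_def by blast

lemma isomorphic_obj: "X \<simeq> Y \<Longrightarrow> X \<in> Obj C \<and> Y \<in> Obj C"
  unfolding isomorphic_def by blast

lemma isomorphic_refl: "X \<in> Obj C \<Longrightarrow> X \<simeq> X"
  using idt_mor cmp_idt_left by (blast intro: isomorphicI is_isoI)

lemma isomorphic_sym: "X \<simeq> Y \<Longrightarrow> Y \<simeq> X"
  unfolding isomorphic_def is_iso_def by blast

lemma cmp_cancel_mid:
  assumes "f \<in> Mor C X Y" "g \<in> Mor C Y Z" "g' \<in> Mor C Z Y" "f' \<in> Mor C Y X'" "g' \<cdot> g = Idt C Y"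
  shows "(f' \<cdot> g') \<cdot> (g \<cdot> f) = f' \<cdot> f"
proof -
  have "(f' \<cdot> g') \<cdot> (g \<cdot> f) = f' \<cdot> (g' \<cdot> (g \<cdot> f))"
    using assms cmp_assoc cmp_mor by metis
  also have "g' \<cdot> (g \<cdot> f) = f"
    using assms cmp_assoc[of f X Y g Z g' Y] cmp_idt_left by metis
  finally show ?thesis .
qed

lemma cancel_retraction:
  assumes "s \<in> Mor C Y X" "p \<in> Mor C X Y" "p \<cdot> s = Idt C Y"
    and "f \<in> Mor C Y Z" "g \<in> Mor C Y Z" "f \<cdot> p = g \<cdot> p"
  shows "f = g"
  using cmp_assoc[OF assms(1,2,4)] cmp_assoc[OF assms(1,2,5)] cmp_idt_right[OF assms(4)]
    cmp_idt_right[OF assms(5)] assms(3,6) by metis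

lemma isomorphic_trans:
  assumes "X \<simeq> Y" "Y \<simeq> Z"
  shows "X \<simeq> Z"
proof -
  obtain f f' where f: "f \<in> Mor C X Y" "f' \<in> Mor C Y X" "f' \<cdot> f = Idt C X" "f \<cdot> f' = Idt C Y"
    using assms(1) by (rule isomorphicE)
  obtain g g' where g: "g \<in> Mor C Y Z" "g' \<in> Mor C Z Y" "g' \<cdot> g = Idt C Y" "g \<cdot> g' = Idt C Z"
    using assms(2) by (rule isomorphicE)
  have "(f' \<cdot> g') \<cdot> (g \<cdot> f) = Idt C X" "(g \<cdot> f) \<cdot> (f' \<cdot> g') = Idt C Z"
    using cmp_cancel_mid[OF f(1) g(1,2) f(2) g(3)] cmp_cancel_mid[OF g(2) f(2,1) g(1) f(4)] f g
    by simp_all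
  then show ?thesis
    using isomorphicI2[OF cmp_mor[OF f(1) g(1)] cmp_mor[OF g(2) f(2)]] by blast
qed

end

context additive_category
begin

lemma zer_mor: "X \<in> Obj C \<Longrightarrow> Y \<in> Obj C \<Longrightarrow> Zer C X Y \<in> Mor C X Y"
  using abelian_group.axioms(1)[OF hom_abelian[of X Y]] abelian_monoid.zero_closed[of "hom_group C X Y"]
  by (simp add: hom_group_def)

lemma pls_zer: "f \<in> Mor C X Y \<Longrightarrow> f \<boxplus> Zer C X Y = f"
  using abelian_group.axioms(1)[OF hom_abelian[of X Y]] abelian_monoid.r_zero[of "hom_group C X Y" f]
    mor_obj[of f X Y]
  by (simp add: hom_group_def)

lemma idem_zer:
  assumes "f \<in> Mor C X Y" "f \<boxplus> f = f"
  shows "f = Zer C X Y"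
proof -
  interpret abelian_group "hom_group C X Y"
    using assms(1) mor_obj hom_abelian by blast
  have "f \<in> carrier (hom_group C X Y)" "f \<oplus>\<^bsub>hom_group C X Y\<^esub> f = f"
    using assms by (simp_all add: hom_group_def)
  then have "f = \<zero>\<^bsub>hom_group C X Y\<^esub>"
    by (metis add.l_cancel_one')
  then show ?thesis by (simp add: hom_group_def)
qed

lemma neg_mor: "f \<in> Mor C X Y \<Longrightarrow> \<ominus>\<^bsub>hom_group C X Y\<^esub> f \<in> Mor C X Y"
proof -
  assume f: "f \<in> Mor C X Y"
  interpret abelian_group "hom_group C X Y"
    using f mor_obj hom_abelian by blast
  have "f \<in> carrier (hom_group C X Y)" using f by (simp add: hom_group_def)
  then have "\<ominus>\<^bsub>hom_group C X Y\<^esub> f \<in> carrier (hom_group C X Y)" by simp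
  then show ?thesis by (simp add: hom_group_def)
qed

lemma pls_neg: "f \<in> Mor C X Y \<Longrightarrow> f \<boxplus> \<ominus>\<^bsub>hom_group C X Y\<^esub> f = Zer C X Y"
proof -
  assume f: "f \<in> Mor C X Y"
  interpret abelian_group "hom_group C X Y"
    using f mor_obj hom_abelian by blast
  have "f \<in> carrier (hom_group C X Y)" using f by (simp add: hom_group_def)
  then have "f \<oplus>\<^bsub>hom_group C X Y\<^esub> \<ominus>\<^bsub>hom_group C X Y\<^esub> f = \<zero>\<^bsub>hom_group C X Y\<^esub>" by (rule r_neg)
  then show ?thesis by (simp add: hom_group_def)
qed

lemma neg_unique:
  assumes "f \<in> Mor C X Y" "g \<in> Mor C X Y" "f \<boxplus> g = Zer C X Y"
  shows "g = \<ominus>\<^bsub>hom_group C X Y\<^esub> f"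
proof -
  interpret abelian_group "hom_group C X Y"
    using assms mor_obj hom_abelian by blast
  have "f \<in> carrier (hom_group C X Y)" "g \<in> carrier (hom_group C X Y)"
    "f \<oplus>\<^bsub>hom_group C X Y\<^esub> g = \<zero>\<^bsub>hom_group C X Y\<^esub>"
    using assms by (simp_all add: hom_group_def)
  then show ?thesis by (metis a_comm minus_equality)
qed

lemma neg_inj:
  assumes "f \<in> Mor C X Y" "g \<in> Mor C X Y"
    "\<ominus>\<^bsub>hom_group C X Y\<^esub> f = \<ominus>\<^bsub>hom_group C X Y\<^esub> g"
  shows "f = g"
proof -
  interpret abelian_group "hom_group C X Y"
    using assms mor_obj hom_abelian by blast
  have "f \<in> carrier (hom_group C X Y)" "g \<in> carrier (hom_group C X Y)"
    using assms by (simp_all add: hom_group_def)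
  then show ?thesis using assms(3) by (metis minus_minus)
qed

lemma cmp_zer_right:
  assumes "g \<in> Mor C Y Z" "X \<in> Obj C"
  shows "g \<cdot> Zer C X Y = Zer C X Z"
proof -
  have Y: "Y \<in> Obj C" using assms mor_obj by blast
  note z = zer_mor[OF assms(2) Y]
  show ?thesis
    by (rule idem_zer[OF cmp_mor[OF z assms(1)]])
      (simp flip: cmp_add_right[OF z z assms(1)] add: pls_zer[OF z])
qed

lemma cmp_zer_left:
  assumes "f \<in> Mor C X Y" "Z \<in> Obj C"
  shows "Zer C Y Z \<cdot> f = Zer C X Z"
proof -
  have Y: "Y \<in> Obj C" using assms mor_obj by blast
  note z = zer_mor[OF Y assms(2)]
  show ?thesis
    by (rule idem_zer[OF cmp_mor[OF assms(1) z]])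
      (simp flip: cmp_add_left[OF assms(1) z z] add: pls_zer[OF z])
qed

lemma cmp_neg_right:
  assumes "f \<in> Mor C X Y" "g \<in> Mor C Y Z"
  shows "g \<cdot> (\<ominus>\<^bsub>hom_group C X Y\<^esub> f) = \<ominus>\<^bsub>hom_group C X Z\<^esub> (g \<cdot> f)"
  using neg_unique[OF cmp_mor[OF assms] cmp_mor[OF neg_mor[OF assms(1)] assms(2)]]
    cmp_add_right[OF assms(1) neg_mor[OF assms(1)] assms(2)]
    pls_neg[OF assms(1)] cmp_zer_right[OF assms(2)] mor_obj[OF assms(1)]
  by simp

lemma cmp_neg_left:
  assumes "f \<in> Mor C X Y" "g \<in> Mor C Y Z"
  shows "(\<ominus>\<^bsub>hom_group C Y Z\<^esub> g) \<cdot> f = \<ominus>\<^bsub>hom_group C X Z\<^esub> (g \<cdot> f)"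
  using neg_unique[OF cmp_mor[OF assms] cmp_mor[OF assms(1) neg_mor[OF assms(2)]]]
    cmp_add_left[OF assms neg_mor[OF assms(2)]]
    pls_neg[OF assms(2)] cmp_zer_left[OF assms(1)] mor_obj[OF assms(2)]
  by simp

lemma neg_zer:
  assumes "X \<in> Obj C" "Y \<in> Obj C"
  shows "\<ominus>\<^bsub>hom_group C X Y\<^esub> Zer C X Y = Zer C X Y"
  using neg_unique[OF zer_mor[OF assms] zer_mor[OF assms] pls_zer[OF zer_mor[OF assms]]] by simp

lemma zero_object_obj: "zero_object C X \<Longrightarrow> X \<in> Obj C"
  unfolding zero_object_def by blast

lemma from_zero: "zero_object C X \<Longrightarrow> f \<in> Mor C X Y \<Longrightarrow> f = Zer C X Y"
  unfolding zero_object_def by (metis mor_obj zer_mor)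

lemma to_zero: "zero_object C Y \<Longrightarrow> f \<in> Mor C X Y \<Longrightarrow> f = Zer C X Y"
  unfolding zero_object_def by (metis mor_obj zer_mor)

lemma zero_objectI:
  assumes "X \<in> Obj C" "Idt C X = Zer C X X"
  shows "zero_object C X"
proof -
  have "f = Zer C X Y" if "f \<in> Mor C X Y" for f Y
    using that assms cmp_idt_right[OF that] cmp_zer_right[OF that assms(1)] by simp
  moreover have "f = Zer C Y X" if "f \<in> Mor C Y X" for f Y
    using that assms cmp_idt_left[OF that] cmp_zer_left[OF that assms(1)] by simp
  ultimately show ?thesis
    unfolding zero_object_def using assms(1) zer_mor by metis
qed

lemma zero_object_idt: "zero_object C X \<Longrightarrow> Idt C X = Zer C X X"
  using from_zero idt_mor zero_object_obj by blast

lemma zero_object_iso: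
  assumes "zero_object C X" "X \<simeq> Y"
  shows "zero_object C Y"
proof -
  obtain f g where f: "f \<in> Mor C X Y" "g \<in> Mor C Y X" "f \<cdot> g = Idt C Y" "Y \<in> Obj C"
    using assms(2) by (rule isomorphicE)
  have "f = Zer C X Y" using assms(1) f(1) by (rule from_zero)
  then have "Idt C Y = Zer C Y Y" using f cmp_zer_left by metis
  then show ?thesis using f(4) by (rule zero_objectI[rotated])
qed

lemma no_morD: "no_mor C X Y \<Longrightarrow> f \<in> Mor C X Y \<Longrightarrow> f = Zer C X Y"
  unfolding no_mor_def by blast

lemma no_mor_iff: "X \<in> Obj C \<Longrightarrow> Y \<in> Obj C \<Longrightarrow> Mor C X Y = {Zer C X Y} \<longleftrightarrow> no_mor C X Y"
  unfolding no_mor_def using zer_mor by blast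

lemma no_mor_iso:
  assumes "no_mor C X Y" "X \<simeq> X'" "Y \<simeq> Y'"
  shows "no_mor C X' Y'"
  unfolding no_mor_def
proof
  fix f assume f: "f \<in> Mor C X' Y'"
  obtain a b where a: "a \<in> Mor C X X'" "b \<in> Mor C X' X" "a \<cdot> b = Idt C X'"
    using assms(2) by (rule isomorphicE)
  obtain a' b' where a': "a' \<in> Mor C Y Y'" "b' \<in> Mor C Y' Y" "a' \<cdot> b' = Idt C Y'"
    using assms(3) by (rule isomorphicE)
  have m: "b' \<cdot> (f \<cdot> a) \<in> Mor C X Y" using a a' f cmp_mor by metis
  have "a' \<cdot> (b' \<cdot> (f \<cdot> a)) = f \<cdot> a"
    using a a' f cmp_assoc[of "f \<cdot> a" X Y' b' Y a' Y'] cmp_mor cmp_idt_left by metis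
  then have "f \<cdot> a = Zer C X Y'"
    using no_morD[OF assms(1) m] cmp_zer_right[OF a'(1)] mor_obj a(1) by metis
  moreover have "f = (f \<cdot> a) \<cdot> b"
    using a f cmp_assoc[of b X' X a X' f Y'] cmp_idt_right by metis
  ultimately show "f = Zer C X' Y'"
    using cmp_zer_left a(2) mor_obj f by metis
qed

end

context triangulated_category
begin

lemma sh_cancel: "X \<in> Obj C \<Longrightarrow> Sh C m (Sh C (- m) X) = X \<and> Sh C (- m) (Sh C m X) = X"
  using sh_add[of X m "- m"] sh_add[of X "- m" m] sh_zero by simp

lemma shm_cancel: "f \<in> Mor C X Y \<Longrightarrow> ShM C m (ShM C (- m) f) = f \<and> ShM C (- m) (ShM C m f) = f"
  using shm_add[of f X Y m "- m"] shm_add[of f X Y "- m" m] shm_zero by simp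

lemma sh_iso:
  assumes "X \<simeq> Y"
  shows "Sh C m X \<simeq> Sh C m Y"
proof -
  obtain f g where f: "f \<in> Mor C X Y" "g \<in> Mor C Y X" "g \<cdot> f = Idt C X" "f \<cdot> g = Idt C Y"
    "X \<in> Obj C" "Y \<in> Obj C"
    using assms by (rule isomorphicE)
  show ?thesis
    using f shm_mor shm_cmp[OF f(1,2), of m] shm_cmp[OF f(2,1), of m] shm_idt
    by (intro isomorphicI2[of "ShM C m f" _ _ "ShM C m g"]) auto
qed

lemma sh_iso_iff:
  assumes "Sh C m X \<simeq> Y" "X \<in> Obj C"
  shows "X \<simeq> Sh C (- m) Y"
  using sh_iso[OF assms(1), of "- m"] sh_cancel assms(2) by simp

lemma shm_zer:
  assumes "X \<in> Obj C" "Y \<in> Obj C"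
  shows "ShM C m (Zer C X Y) = Zer C (Sh C m X) (Sh C m Y)"
  using idem_zer[OF shm_mor[OF zer_mor[OF assms]]] pls_zer[OF zer_mor[OF assms]]
    shm_pls[OF zer_mor[OF assms] zer_mor[OF assms]]
  by metis

lemma shm_eq_zer:
  assumes "f \<in> Mor C X Y" "ShM C m f = Zer C (Sh C m X) (Sh C m Y)"
  shows "f = Zer C X Y"
proof -
  have X: "X \<in> Obj C" "Y \<in> Obj C" using assms mor_obj by blast+
  have "f = ShM C (- m) (ShM C m f)" using shm_cancel assms(1) by metis
  also have "\<dots> = Zer C X Y" using assms(2) shm_zer sh_obj sh_cancel X by metis
  finally show ?thesis .
qed

lemma no_mor_sh:
  assumes "no_mor C (Sh C m X) (Sh C m Y)"
  shows "no_mor C X Y"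
  unfolding no_mor_def using assms shm_mor no_morD shm_eq_zer by metis

lemma zero_object_sh:
  assumes "zero_object C X"
  shows "zero_object C (Sh C m X)"
  using zero_objectI[OF sh_obj] zero_object_idt[OF assms] zero_object_obj[OF assms] shm_idt shm_zer
  by metis

lemma tri_obj: "Tri C X Y Z f g h \<Longrightarrow> X \<in> Obj C \<and> Y \<in> Obj C \<and> Z \<in> Obj C"
  using tri_mor mor_obj by metis

lemma tri_rotate:
  "Tri C X Y Z f g h \<Longrightarrow>
     Tri C Y Z (Sh C 1 X) g h (\<ominus>\<^bsub>hom_group C (Sh C 1 X) (Sh C 1 Y)\<^esub> ShM C 1 f)"
  using TR2 tri_mor by metis

lemma tri_cmp_zer:
  assumes "Tri C X Y Z f g h"
  shows "g \<cdot> f = Zer C X Z"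
proof -
  obtain O' where O': "zero_object C O'" using has_zero_object by blast
  have m: "f \<in> Mor C X Y" "g \<in> Mor C Y Z" and X: "X \<in> Obj C" "Z \<in> Obj C"
    using tri_mor[OF assms] tri_obj[OF assms] by auto
  have "f \<cdot> Idt C X = f \<cdot> Idt C X" ..
  from TR3[OF TR1_idt[OF X(1) O'] assms idt_mor[OF X(1)] m(1) this]
  obtain c where c: "c \<in> Mor C O' Z" "g \<cdot> f = c \<cdot> Zer C X O'" by blast
  then show ?thesis using cmp_zer_right[OF c(1) X(1)] by simp
qed

text \<open>
  One half of the exactness of \<open>Hom(A, -)\<close>.  Completing the square formed by \<open>a\<close> and \<open>A \<rightarrow> 0\<close> to a morphism from the rotated triangle
  \<open>A \<rightarrow> 0 \<rightarrow> A[1]\<close> to the rotated triangle \<open>Y \<rightarrow> Z \<rightarrow> X[1]\<close> gives the lift up to a shift.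
\<close>

lemma tri_lift:
  assumes T: "Tri C X Y Z f g h" and a: "a \<in> Mor C A Y" and z: "g \<cdot> a = Zer C A Z"
  shows "\<exists>b \<in> Mor C A X. f \<cdot> b = a"
proof -
  obtain O' where O': "zero_object C O'" using has_zero_object by blast
  have m: "f \<in> Mor C X Y" "g \<in> Mor C Y Z" "h \<in> Mor C Z (Sh C 1 X)"
    using tri_mor[OF T] by auto
  have ob: "X \<in> Obj C" "Y \<in> Obj C" "Z \<in> Obj C" "A \<in> Obj C" "O' \<in> Obj C"
    using mor_obj m a O' zero_object_obj by metis+
  have sf: "ShM C 1 f \<in> Mor C (Sh C 1 X) (Sh C 1 Y)" using shm_mor m by blast
  have sa: "ShM C 1 a \<in> Mor C (Sh C 1 A) (Sh C 1 Y)" using shm_mor a by blast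
  have si: "Idt C (Sh C 1 A) \<in> Mor C (Sh C 1 A) (Sh C 1 A)" using idt_mor sh_obj ob by blast
  have T0: "Tri C A O' (Sh C 1 A) (Zer C A O') (Zer C O' (Sh C 1 A))
      (\<ominus>\<^bsub>hom_group C (Sh C 1 A) (Sh C 1 A)\<^esub> Idt C (Sh C 1 A))"
    using tri_rotate[OF TR1_idt[OF ob(4) O']] shm_idt ob(4) by simp
  have sq: "g \<cdot> a = Zer C O' Z \<cdot> Zer C A O'"
    using z cmp_zer_right[OF zer_mor ob(4)] ob by simp
  obtain c where c: "c \<in> Mor C (Sh C 1 A) (Sh C 1 X)"
    "(\<ominus>\<^bsub>hom_group C (Sh C 1 X) (Sh C 1 Y)\<^esub> ShM C 1 f) \<cdot> c =
       ShM C 1 a \<cdot> (\<ominus>\<^bsub>hom_group C (Sh C 1 A) (Sh C 1 A)\<^esub> Idt C (Sh C 1 A))"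
    using TR3[OF T0 tri_rotate[OF T] a zer_mor[OF ob(5,3)] sq] by blast
  have "\<ominus>\<^bsub>hom_group C (Sh C 1 A) (Sh C 1 Y)\<^esub> (ShM C 1 f \<cdot> c) =
      \<ominus>\<^bsub>hom_group C (Sh C 1 A) (Sh C 1 Y)\<^esub> ShM C 1 a"
    using c(2) cmp_neg_left[OF c(1) sf] cmp_neg_right[OF si sa] cmp_idt_right[OF sa] by simp
  then have e: "ShM C 1 f \<cdot> c = ShM C 1 a"
    using neg_inj cmp_mor[OF c(1) sf] sa by blast
  let ?b = "ShM C (- 1) c"
  have b: "?b \<in> Mor C A X" using shm_mor[OF c(1), of "- 1"] sh_cancel ob by simp
  have "f \<cdot> ?b = ShM C (- 1) (ShM C 1 f \<cdot> c)"
    using shm_cmp[OF c(1) sf] shm_cancel[OF m(1), of 1] by simp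
  then have "f \<cdot> ?b = a" using e shm_cancel[OF a, of 1] by simp
  with b show ?thesis by blast
qed

text \<open>
  Dually, the square formed by \<open>a\<close> and \<open>X \<rightarrow> 0\<close> is completed to a morphism to the triangle
  \<open>0 \<rightarrow> B \<rightarrow> B\<close>.
\<close>

lemma tri_colift:
  assumes T: "Tri C X Y Z f g h" and a: "a \<in> Mor C Y B" and z: "a \<cdot> f = Zer C X B"
  shows "\<exists>b \<in> Mor C Z B. b \<cdot> g = a"
proof -
  obtain O' where O': "zero_object C O'" using has_zero_object by blast
  have m: "f \<in> Mor C X Y" "g \<in> Mor C Y Z" "h \<in> Mor C Z (Sh C 1 X)"
    using tri_mor[OF T] by auto
  have ob: "X \<in> Obj C" "Y \<in> Obj C" "Z \<in> Obj C" "B \<in> Obj C" "O' \<in> Obj C"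
    using mor_obj m a O' zero_object_obj by metis+
  have "Tri C B B (Sh C 1 O') (Idt C B) (Zer C B (Sh C 1 O')) (Zer C (Sh C 1 O') (Sh C 1 B))"
    using TR1_idt[OF ob(4) zero_object_sh[OF O']] .
  moreover have "\<ominus>\<^bsub>hom_group C (Sh C 1 O') (Sh C 1 B)\<^esub> ShM C 1 (Zer C O' B) =
      Zer C (Sh C 1 O') (Sh C 1 B)"
    using shm_zer neg_zer sh_obj ob by simp
  ultimately have T0: "Tri C O' B B (Zer C O' B) (Idt C B) (Zer C B (Sh C 1 O'))"
    using TR2[of "Zer C O' B" O' B "Idt C B" B "Zer C B (Sh C 1 O')"] zer_mor idt_mor sh_obj ob
    by simp
  have sq: "Zer C O' B \<cdot> Zer C X O' = a \<cdot> f"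
    using z cmp_zer_right[OF zer_mor ob(1)] ob by simp
  obtain c where "c \<in> Mor C Z B" "Idt C B \<cdot> a = c \<cdot> g"
    using TR3[OF T T0 zer_mor[OF ob(1,5)] a sq] by blast
  then show ?thesis using cmp_idt_left[OF a] by auto
qed

lemma tri_zero_iso:
  assumes T: "Tri C X Y Z f g h" and X: "zero_object C X"
  shows "Y \<simeq> Z"
proof -
  have m: "f \<in> Mor C X Y" "g \<in> Mor C Y Z" "h \<in> Mor C Z (Sh C 1 X)"
    using tri_mor[OF T] by auto
  have ob: "Y \<in> Obj C" "Z \<in> Obj C" using mor_obj m by metis+
  have "h \<cdot> Idt C Z = Zer C Z (Sh C 1 X)"
    using to_zero[OF zero_object_sh[OF X] m(3)] cmp_idt_right[OF m(3)] by simp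
  from tri_lift[OF tri_rotate[OF T] idt_mor[OF ob(2)] this]
  obtain b where b: "b \<in> Mor C Z Y" "g \<cdot> b = Idt C Z" by blast
  have "Idt C Y \<cdot> f = Zer C X Y" using from_zero[OF X m(1)] cmp_idt_left[OF m(1)] by simp
  from tri_colift[OF T idt_mor[OF ob(1)] this]
  obtain b' where b': "b' \<in> Mor C Z Y" "b' \<cdot> g = Idt C Y" by blast
  have "b' = b" using b b' m cmp_assoc[of b Z Y g Z b' Y] cmp_idt_left cmp_idt_right by metis
  then show ?thesis using b b' m by (intro isomorphicI2[of g _ _ b]) auto
qed

lemma no_mor_cone_right:
  assumes T: "Tri C X Y Z f g h" and "no_mor C A (Sh C 1 X)" "no_mor C A Y"
  shows "no_mor C A Z"
  unfolding no_mor_def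
proof
  fix a assume a: "a \<in> Mor C A Z"
  have m: "g \<in> Mor C Y Z" "h \<in> Mor C Z (Sh C 1 X)" using tri_mor[OF T] by auto
  have "h \<cdot> a = Zer C A (Sh C 1 X)" using assms(2) cmp_mor[OF a m(2)] by (rule no_morD)
  from tri_lift[OF tri_rotate[OF T] a this] obtain b where "b \<in> Mor C A Y" "g \<cdot> b = a" by blast
  then show "a = Zer C A Z" using no_morD[OF assms(3)] cmp_zer_right[OF m(1)] mor_obj a by metis
qed

lemma no_mor_cone_left:
  assumes T: "Tri C X Y Z f g h" and "no_mor C (Sh C 1 X) B" "no_mor C Y B"
  shows "no_mor C Z B"
  unfolding no_mor_def
proof
  fix a assume a: "a \<in> Mor C Z B"
  have m: "g \<in> Mor C Y Z" "h \<in> Mor C Z (Sh C 1 X)" using tri_mor[OF T] by auto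
  have "a \<cdot> g = Zer C Y B" using assms(3) cmp_mor[OF m(1) a] by (rule no_morD)
  from tri_colift[OF tri_rotate[OF T] a this]
  obtain b where "b \<in> Mor C (Sh C 1 X) B" "b \<cdot> h = a" by blast
  then show "a = Zer C Z B" using no_morD[OF assms(2)] cmp_zer_left[OF m(2)] mor_obj a by metis
qed

section \<open>Triangulated hulls and orthogonals\<close>

lemma tri_subcatI:
  assumes "S \<subseteq> Obj C" "Z \<in> S" "\<And>X Y. X \<in> S \<Longrightarrow> X \<simeq> Y \<Longrightarrow> Y \<in> S"
    "\<And>X m. X \<in> S \<Longrightarrow> Sh C m X \<in> S"
    "\<And>X Y Z f g h. Tri C X Y Z f g h \<Longrightarrow> X \<in> S \<Longrightarrow> Y \<in> S \<Longrightarrow> Z \<in> S"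
  shows "tri_subcat C S"
  unfolding tri_subcat_def using assms(1,2) by (auto intro: assms(3-5))

lemma tri_subcatD:
  assumes "tri_subcat C S"
  shows "S \<subseteq> Obj C" "X \<in> S \<Longrightarrow> X \<simeq> Y \<Longrightarrow> Y \<in> S" "X \<in> S \<Longrightarrow> Sh C m X \<in> S"
    "Tri C X Y Z f g h \<Longrightarrow> X \<in> S \<Longrightarrow> Y \<in> S \<Longrightarrow> Z \<in> S"
  using assms unfolding tri_subcat_def by blast+

lemma tri_subcat_zero:
  assumes "tri_subcat C T" "zero_object C Z"
  shows "Z \<in> T"
proof -
  obtain X where X: "X \<in> T" "X \<in> Obj C" using assms(1) unfolding tri_subcat_def by blast
  show ?thesis using TR1_idt[OF X(2) assms(2)] X(1) assms(1) unfolding tri_subcat_def by blast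
qed

text \<open>The cone of \<open>Y \<rightarrow> Z\<close> is \<open>X[1]\<close>, so membership of \<open>X\<close> and \<open>Z\<close> forces membership of \<open>Y\<close>.\<close>

lemma tri_subcat_mid:
  assumes S: "tri_subcat C S" and T: "Tri C X Y Z f g h" and "X \<in> S" "Z \<in> S"
  shows "Y \<in> S"
proof -
  have "Sh C 1 X \<in> S" using assms tri_subcatD(3) by blast
  then have "Sh C 1 Y \<in> S"
    using tri_subcatD(4)[OF S tri_rotate[OF tri_rotate[OF T]]] \<open>Z \<in> S\<close> by blast
  then have "Sh C (- 1) (Sh C 1 Y) \<in> S" by (rule tri_subcatD(3)[OF S])
  then show ?thesis using sh_cancel[of Y 1] tri_obj[OF T] by simp
qed

lemma tri_subcat_Obj: "tri_subcat C (Obj C)"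
  unfolding tri_subcat_def
  using has_zero_object zero_object_obj isomorphic_obj sh_obj tri_obj by blast

lemma tri_hull_subset: "S \<subseteq> tri_hull C S"
  unfolding tri_hull_def by blast

lemma tri_hull_least: "tri_subcat C T \<Longrightarrow> S \<subseteq> T \<Longrightarrow> tri_hull C S \<subseteq> T"
  unfolding tri_hull_def by blast

lemma tri_subcat_tri_hull:
  assumes "S \<subseteq> Obj C"
  shows "tri_subcat C (tri_hull C S)"
proof -
  obtain Z where "zero_object C Z" using has_zero_object by blast
  then have Z: "Z \<in> tri_hull C S" unfolding tri_hull_def using tri_subcat_zero by blast
  have "tri_hull C S \<subseteq> Obj C" using tri_hull_least[OF tri_subcat_Obj assms] .
  then show ?thesis
    by (rule tri_subcatI[OF _ Z]) (auto simp: tri_hull_def dest: tri_subcatD)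
qed

lemma no_mor_shift_source:
  assumes "X \<in> Obj C" "Y \<in> Obj C" "no_mor C X (Sh C (- m) Y)"
  shows "no_mor C (Sh C m X) Y"
  using no_mor_sh[of "- m" "Sh C m X" Y] assms sh_cancel by simp

lemma no_mor_shift_target:
  assumes "X \<in> Obj C" "Y \<in> Obj C" "no_mor C (Sh C (- m) X) Y"
  shows "no_mor C X (Sh C m Y)"
  using no_mor_sh[of "- m" X "Sh C m Y"] assms sh_cancel by simp

lemma in_right_orth:
  "S \<subseteq> Obj C \<Longrightarrow> X \<in> right_orth C S \<longleftrightarrow> X \<in> Obj C \<and> (\<forall>A \<in> S. no_mor C A X)"
  unfolding right_orth_def using no_mor_iff by blast

lemma tri_subcat_right_orth:
  assumes S: "S \<subseteq> Obj C" and sh: "\<And>A m. A \<in> S \<Longrightarrow> Sh C m A \<in> S"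
  shows "tri_subcat C (right_orth C S)"
proof -
  note iff = in_right_orth[OF S]
  have shift: "Sh C m X \<in> right_orth C S" if "X \<in> right_orth C S" for X m
    using that sh S sh_obj no_mor_shift_target unfolding iff by blast
  obtain Z where "zero_object C Z" using has_zero_object by blast
  then have "Z \<in> right_orth C S" unfolding iff no_mor_def using zero_object_obj to_zero by blast
  moreover have "Y \<in> right_orth C S" if "X \<in> right_orth C S" "X \<simeq> Y" for X Y
    using that isomorphic_obj isomorphic_refl no_mor_iso S unfolding iff by blast
  moreover have "Z \<in> right_orth C S"
    if "Tri C X Y Z f g h" "X \<in> right_orth C S" "Y \<in> right_orth C S" for X Y Z f g h
    using that(1,3) shift[OF that(2), of 1] no_mor_cone_right[OF that(1)] tri_obj[OF that(1)]
    unfolding iff by blast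
  ultimately show ?thesis using shift iff by (intro tri_subcatI[of _ Z]) blast+
qed

lemma tri_subcat_left_orth:
  assumes S: "S \<subseteq> Obj C" and sh: "\<And>A m. A \<in> S \<Longrightarrow> Sh C m A \<in> S"
  shows "tri_subcat C {X \<in> Obj C. \<forall>B \<in> S. no_mor C X B}"
    (is "tri_subcat C ?L")
proof -
  have shift: "Sh C m X \<in> ?L" if "X \<in> ?L" for X m
    using that sh S sh_obj no_mor_shift_source by blast
  obtain Z where "zero_object C Z" using has_zero_object by blast
  then have "Z \<in> ?L" unfolding no_mor_def using zero_object_obj from_zero by blast
  moreover have "Y \<in> ?L" if "X \<in> ?L" "X \<simeq> Y" for X Y
    using that isomorphic_obj isomorphic_refl no_mor_iso S by blast
  moreover have "Z \<in> ?L"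
    if "Tri C X Y Z f g h" "X \<in> ?L" "Y \<in> ?L" for X Y Z f g h
    using that(3) shift[OF that(2), of 1] no_mor_cone_left[OF that(1)] tri_obj[OF that(1)]
    by blast
  ultimately show ?thesis using shift by (intro tri_subcatI[of _ Z]) blast+
qed

lemma no_mor_tri_hull_left:
  assumes "S \<subseteq> Obj C" "S' \<subseteq> Obj C" "\<And>B m. B \<in> S' \<Longrightarrow> Sh C m B \<in> S'"
    and "\<And>A B. A \<in> S \<Longrightarrow> B \<in> S' \<Longrightarrow> no_mor C A B" and "A \<in> tri_hull C S" "B \<in> S'"
  shows "no_mor C A B"
proof -
  have "S \<subseteq> {X \<in> Obj C. \<forall>B \<in> S'. no_mor C X B}" using assms by blast
  then have "tri_hull C S \<subseteq> {X \<in> Obj C. \<forall>B \<in> S'. no_mor C X B}"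
    using tri_hull_least[OF tri_subcat_left_orth[OF assms(2,3)]] by blast
  then show ?thesis using assms by blast
qed

lemma no_mor_tri_hull:
  assumes "S \<subseteq> Obj C" "S' \<subseteq> Obj C" "\<And>B m. B \<in> S' \<Longrightarrow> Sh C m B \<in> S'"
    and "\<And>A B. A \<in> S \<Longrightarrow> B \<in> S' \<Longrightarrow> no_mor C A B" and "A \<in> tri_hull C S" "B \<in> tri_hull C S'"
  shows "no_mor C A B"
proof -
  have h: "tri_subcat C (tri_hull C S)" using tri_subcat_tri_hull assms(1) .
  then have o: "tri_hull C S \<subseteq> Obj C" and sh: "\<And>A m. A \<in> tri_hull C S \<Longrightarrow> Sh C m A \<in> tri_hull C S"
    using tri_subcatD(1,3) by blast+
  have "S' \<subseteq> right_orth C (tri_hull C S)"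
    using no_mor_tri_hull_left[OF assms(1-4)] assms(2) in_right_orth[OF o] by blast
  then have "tri_hull C S' \<subseteq> right_orth C (tri_hull C S)"
    using tri_hull_least[OF tri_subcat_right_orth[OF o sh]] by blast
  then show ?thesis using assms in_right_orth[OF o] by blast
qed

text \<open>
  Peeling off the components one by one, starting with the rightmost.  The approximating object \<open>b\<close>
  taken from a component receives no morphism from the components peeled off before, so the new cone
  stays orthogonal to those.
\<close>

lemma approximation_list:
  assumes "\<And>B. B \<in> set Bs \<Longrightarrow> B \<subseteq> Obj C \<and> (\<forall>b \<in> B. \<forall>m. Sh C m b \<in> B)"
    and "sorted_wrt (\<lambda>B B'. \<forall>b \<in> B. \<forall>b' \<in> B'. no_mor C b' b) Bs"
    and "\<And>B Y. B \<in> set Bs \<Longrightarrow> Y \<in> Obj C \<Longrightarrow>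
          \<exists>b Z f g h. Tri C b Y Z f g h \<and> b \<in> B \<and> Z \<in> right_orth C B"
    and "Y \<in> Obj C"
  shows "\<exists>Z \<in> Obj C. (\<forall>B \<in> set Bs. Z \<in> right_orth C B) \<and>
          (\<forall>S. tri_subcat C S \<longrightarrow> \<Union> (set Bs) \<subseteq> S \<longrightarrow> Z \<in> S \<longrightarrow> Y \<in> S)"
  using assms
proof (induction Bs)
  case Nil
  then show ?case by auto
next
  case (Cons B Bs)
  obtain Y' where Y': "Y' \<in> Obj C" "\<forall>B \<in> set Bs. Y' \<in> right_orth C B"
    "\<forall>S. tri_subcat C S \<longrightarrow> \<Union> (set Bs) \<subseteq> S \<longrightarrow> Y' \<in> S \<longrightarrow> Y \<in> S"
    using Cons.IH[OF Cons.prems(1) _ Cons.prems(3,4)] Cons.prems(2) by fastforce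
  obtain b Z f g h where T: "Tri C b Y' Z f g h" and b: "b \<in> B" and Z: "Z \<in> right_orth C B"
    using Cons.prems(3)[of B Y'] Y'(1) by auto
  have "Z \<in> right_orth C B'" if B': "B' \<in> set Bs" for B'
  proof -
    have o: "B' \<subseteq> Obj C" and sb: "Sh C 1 b \<in> B" using Cons.prems(1) B' b by auto
    have "no_mor C b' (Sh C 1 b)" "no_mor C b' Y'" if "b' \<in> B'" for b'
      using that Cons.prems(2) B' sb Y'(2) in_right_orth[OF o] by auto
    then show ?thesis
      using in_right_orth[OF o] no_mor_cone_right[OF T] tri_obj[OF T] by blast
  qed
  moreover have "Y \<in> S" if "tri_subcat C S" "\<Union> (set (B # Bs)) \<subseteq> S" "Z \<in> S" for S
    using Y'(3) tri_subcat_mid[OF that(1) T _ that(3)] that b by auto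
  ultimately show ?case using Z tri_obj[OF T] by auto
qed

text \<open>
  Both orthogonals of a shift-closed class are triangulated, so vanishing of morphisms passes from the
  generating classes \<open>Bs\<close> to their hulls.  The object left over by \<open>approximation_list\<close> is orthogonal to
  the generators, hence to everything that they generate, which places it in the first component.
\<close>

lemma semiorthogonal_decomposition_of_approximations:
  assumes cl: "\<And>B. B \<in> set Bs \<Longrightarrow> B \<subseteq> Obj C \<and> (\<forall>b \<in> B. \<forall>m. Sh C m b \<in> B)"
    and so: "sorted_wrt (\<lambda>B B'. \<forall>b \<in> B. \<forall>b' \<in> B'. no_mor C b' b) Bs"
    and ap: "\<And>B Y. B \<in> set Bs \<Longrightarrow> Y \<in> Obj C \<Longrightarrow>
          \<exists>b Z f g h. Tri C b Y Z f g h \<and> b \<in> B \<and> Z \<in> right_orth C B"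
  shows "semiorthogonal_decomposition C
          (right_orth C (tri_hull C (\<Union>B \<in> set Bs. tri_hull C B)) # map (tri_hull C) Bs)"
proof -
  let ?U = "\<Union>B \<in> set Bs. tri_hull C B"
  let ?A = "right_orth C (tri_hull C ?U)"
  have hB: "tri_subcat C (tri_hull C B)" if "B \<in> set Bs" for B
    using tri_subcat_tri_hull cl that by blast
  have U: "?U \<subseteq> Obj C" using hB tri_subcatD(1) by blast
  have hU: "tri_subcat C (tri_hull C ?U)" using tri_subcat_tri_hull[OF U] .
  then have hUo: "tri_hull C ?U \<subseteq> Obj C"
    and hUs: "\<And>A m. A \<in> tri_hull C ?U \<Longrightarrow> Sh C m A \<in> tri_hull C ?U"
    using tri_subcatD(1,3) by blast+
  have A: "tri_subcat C ?A" using tri_subcat_right_orth[OF hUo hUs] .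
  let ?As = "?A # map (tri_hull C) Bs"
  have sub: "\<forall>A \<in> set ?As. tri_subcat C A" using A hB by auto
  have orth: "Mor C X Y = {Zer C X Y}"
    if i: "i < length ?As" and j: "j < i" and X: "X \<in> ?As ! i" and Y: "Y \<in> ?As ! j" for i j X Y
  proof -
    obtain i' where i': "i = Suc i'" "i' < length Bs" using i j by (cases i) auto
    have X': "X \<in> tri_hull C (Bs ! i')" using X i' by simp
    have Xo: "X \<in> Obj C" using X' tri_subcatD(1)[OF hB] i' nth_mem by blast
    show ?thesis
    proof (cases j)
      case 0
      have "X \<in> ?U" using X' i' nth_mem by blast
      then have "X \<in> tri_hull C ?U" using tri_hull_subset by blast
      then show ?thesis using Y 0 in_right_orth[OF hUo] no_mor_iff[OF Xo] by auto
    next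
      case (Suc j')
      then have j': "j' < i'" "j' < length Bs" using i' j by auto
      have Y': "Y \<in> tri_hull C (Bs ! j')" using Y Suc j' by simp
      have Yo: "Y \<in> Obj C" using Y' tri_subcatD(1)[OF hB] j' nth_mem by blast
      have "no_mor C X Y"
      proof (rule no_mor_tri_hull[OF _ _ _ _ X' Y'])
        show "\<And>A B. A \<in> Bs ! i' \<Longrightarrow> B \<in> Bs ! j' \<Longrightarrow> no_mor C A B"
          using sorted_wrt_nth_less[OF so j'(1) i'(2)] by blast
      qed (use cl i' j' in auto)
      then show ?thesis using no_mor_iff[OF Xo Yo] by blast
    qed
  qed
  have gen: "tri_hull C (\<Union> (set ?As)) = Obj C"
  proof
    have V: "\<Union> (set ?As) \<subseteq> Obj C" using sub tri_subcatD(1) by blast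
    then show "tri_hull C (\<Union> (set ?As)) \<subseteq> Obj C" using tri_hull_least[OF tri_subcat_Obj] by blast
    show "Obj C \<subseteq> tri_hull C (\<Union> (set ?As))"
    proof
      fix Y assume "Y \<in> Obj C"
      then obtain Z where Z: "Z \<in> Obj C" "\<forall>B \<in> set Bs. Z \<in> right_orth C B"
        "\<forall>S. tri_subcat C S \<longrightarrow> \<Union> (set Bs) \<subseteq> S \<longrightarrow> Z \<in> S \<longrightarrow> Y \<in> S"
        using approximation_list[OF cl so ap] by blast
      \<comment> \<open>The object \<open>Z\<close> is orthogonal to the generators; as these are closed under shifts, it and its
        shifts are orthogonal to the hull.\<close>
      let ?Z = "range (\<lambda>m. Sh C m Z)"
      have Zs: "?Z \<subseteq> Obj C" "\<And>B m. B \<in> ?Z \<Longrightarrow> Sh C m B \<in> ?Z"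
        using Z(1) sh_obj sh_add[OF Z(1), symmetric] by auto
      have gZ: "no_mor C b (Sh C m Z)" if "B \<in> set Bs" "b \<in> B" for B b m
        using that Z(2) cl in_right_orth[of B] no_mor_shift_target[of b Z m] Z(1) by blast
      have "no_mor C b z" if "B \<in> set Bs" "b \<in> tri_hull C B" "z \<in> ?Z" for B b z
        using no_mor_tri_hull_left[OF _ Zs _ that(2,3)] gZ[OF that(1)] cl[OF that(1)] by blast
      then have "no_mor C b z" if "b \<in> tri_hull C ?U" "z \<in> ?Z" for b z
        using no_mor_tri_hull_left[OF U Zs _ that] by blast
      moreover have "Z \<in> ?Z" using sh_zero[OF Z(1)] by (metis rangeI)
      ultimately have "Z \<in> ?A" using in_right_orth[OF hUo] Z(1) by blast
      then have "Z \<in> tri_hull C (\<Union> (set ?As))" using tri_hull_subset by fastforce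
      moreover have "\<Union> (set Bs) \<subseteq> \<Union> (set ?As)" using tri_hull_subset by fastforce
      then have "\<Union> (set Bs) \<subseteq> tri_hull C (\<Union> (set ?As))" using tri_hull_subset by blast
      ultimately show "Y \<in> tri_hull C (\<Union> (set ?As))"
        using Z(3) tri_subcat_tri_hull[OF V] by blast
    qed
  qed
  show ?thesis unfolding semiorthogonal_decomposition_def using sub orth gen by blast
qed

end

section \<open>Exact functors and approximation by their images\<close>

definition full_functor ::
  "('o, 'm, 'z) tcat_scheme \<Rightarrow> ('o2, 'm2, 'z2) tcat_scheme \<Rightarrow> ('o \<Rightarrow> 'o2) \<Rightarrow> ('m \<Rightarrow> 'm2) \<Rightarrow> bool" where
  "full_functor C D F Fm \<longleftrightarrow>
     (\<forall>X \<in> Obj C. \<forall>Y \<in> Obj C. \<forall>f \<in> Mor D (F X) (F Y). \<exists>g \<in> Mor C X Y. Fm g = f)"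

text \<open>The existence of a right adjoint, in terms of universal arrows from the functor to each object.\<close>

definition has_coreflections ::
  "('o, 'm, 'z) tcat_scheme \<Rightarrow> ('o2, 'm2, 'z2) tcat_scheme \<Rightarrow> ('o \<Rightarrow> 'o2) \<Rightarrow> ('m \<Rightarrow> 'm2) \<Rightarrow> bool" where
  "has_coreflections C D F Fm \<longleftrightarrow>
     (\<forall>Y \<in> Obj D. \<exists>A \<in> Obj C. \<exists>u \<in> Mor D (F A) Y.
        \<forall>X \<in> Obj C. \<forall>f \<in> Mor D (F X) Y. \<exists>!g. g \<in> Mor C X A \<and> u \<cdot>\<^bsub>D\<^esub> Fm g = f)"

definition ess_image ::
  "('o, 'm, 'z) tcat_scheme \<Rightarrow> ('o2, 'm2, 'z2) tcat_scheme \<Rightarrow> ('o \<Rightarrow> 'o2) \<Rightarrow> 'o2 set" where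
  "ess_image C D F = {Y. \<exists>X \<in> Obj C. F X \<simeq>\<^bsub>D\<^esub> Y}"

locale triangulated_functor =
  exact_functor C D F Fm + C: triangulated_category C + D: triangulated_category D
  for C :: "('o, 'm, 'z) tcat_scheme" and D :: "('o2, 'm2, 'z2) tcat_scheme" and F Fm
begin

lemma map_isomorphic:
  assumes "X \<simeq>\<^bsub>C\<^esub> Y"
  shows "F X \<simeq>\<^bsub>D\<^esub> F Y"
proof -
  obtain f g where f: "f \<in> Mor C X Y" "g \<in> Mor C Y X" "g \<cdot>\<^bsub>C\<^esub> f = Idt C X" "f \<cdot>\<^bsub>C\<^esub> g = Idt C Y"
    "X \<in> Obj C" "Y \<in> Obj C"
    using assms by (rule C.isomorphicE)
  show ?thesis
    using D.isomorphicI2[OF fun_mor[OF f(1)] fun_mor[OF f(2)]]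
      fun_cmp[OF f(1,2)] fun_cmp[OF f(2,1)] fun_idt f by simp
qed

lemma map_zer:
  assumes "X \<in> Obj C" "Y \<in> Obj C"
  shows "Fm (Zer C X Y) = Zer D (F X) (F Y)"
  using D.idem_zer[OF fun_mor[OF C.zer_mor[OF assms]]] C.pls_zer[OF C.zer_mor[OF assms]]
    fun_pls[OF C.zer_mor[OF assms] C.zer_mor[OF assms]]
  by metis

lemma map_zero_object: "zero_object C X \<Longrightarrow> zero_object D (F X)"
  using D.zero_objectI[OF fun_obj] C.zero_object_obj fun_idt C.zero_object_idt map_zer by metis

lemma map_sh1: "X \<in> Obj C \<Longrightarrow> F (Sh C 1 X) \<simeq>\<^bsub>D\<^esub> Sh D 1 (F X)"
  using fun_exact D.isomorphicI by blast

lemma map_sh_nat: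
  "X \<in> Obj C \<Longrightarrow> F (Sh C (int m) X) \<simeq>\<^bsub>D\<^esub> Sh D (int m) (F X)"
proof (induction m)
  case 0
  then show ?case using C.sh_zero D.sh_zero fun_obj D.isomorphic_refl by simp
next
  case (Suc m)
  have "F (Sh C 1 (Sh C (int m) X)) \<simeq>\<^bsub>D\<^esub> Sh D 1 (F (Sh C (int m) X))"
    using map_sh1 C.sh_obj Suc.prems by blast
  moreover have "Sh D 1 (F (Sh C (int m) X)) \<simeq>\<^bsub>D\<^esub> Sh D 1 (Sh D (int m) (F X))"
    using D.sh_iso Suc by blast
  ultimately show ?case
    using D.isomorphic_trans C.sh_add[OF Suc.prems, of 1 "int m"] D.sh_add[OF fun_obj[OF Suc.prems], of 1 "int m"]
    by simp
qed

lemma map_sh: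
  assumes X: "X \<in> Obj C"
  shows "F (Sh C m X) \<simeq>\<^bsub>D\<^esub> Sh D m (F X)"
proof (cases "0 \<le> m")
  case True
  then show ?thesis using map_sh_nat[OF X, of "nat m"] by simp
next
  case False
  have "F X \<simeq>\<^bsub>D\<^esub> Sh D (- m) (F (Sh C m X))"
    using map_sh_nat[OF C.sh_obj[OF X, of m], of "nat (- m)"] False C.sh_cancel[OF X, of m] by simp
  then have "Sh D (- m) (F (Sh C m X)) \<simeq>\<^bsub>D\<^esub> F X" by (rule D.isomorphic_sym)
  then show ?thesis using D.sh_iso_iff fun_obj C.sh_obj X by fastforce
qed

lemma map_tri: "Tri C X Y Z f g h \<Longrightarrow> \<exists>h'. Tri D (F X) (F Y) (F Z) (Fm f) (Fm g) h'"
  using fun_exact by blast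

lemma ess_image_subset: "ess_image C D F \<subseteq> Obj D"
  unfolding ess_image_def using D.isomorphic_obj by blast

lemma ess_image_sh:
  assumes "Y \<in> ess_image C D F"
  shows "Sh D m Y \<in> ess_image C D F"
proof -
  obtain X where X: "X \<in> Obj C" "F X \<simeq>\<^bsub>D\<^esub> Y" using assms unfolding ess_image_def by blast
  have "F (Sh C m X) \<simeq>\<^bsub>D\<^esub> Sh D m Y"
    using D.isomorphic_trans[OF map_sh[OF X(1)] D.sh_iso[OF X(2)]] .
  then show ?thesis unfolding ess_image_def using C.sh_obj X by blast
qed

text \<open>
  Let \<open>u : F A \<rightarrow> Y\<close> be universal with cone \<open>Z\<close>.  A morphism \<open>f : F X \<rightarrow> Z\<close> composed with the boundary
  \<open>Z \<rightarrow> F A [1]\<close> comes, by fullness, from a morphism to \<open>A\<close> whose image is killed by \<open>u\<close>, so it is zero by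
  uniqueness.  Hence \<open>f\<close> lifts to \<open>Y\<close>, thus factors through \<open>u\<close>, and is zero.
\<close>

lemma approximation:
  assumes full: "full_functor C D F Fm" and core: "has_coreflections C D F Fm"
    and Y: "Y \<in> Obj D"
  shows "\<exists>b Z f g h. Tri D b Y Z f g h \<and> b \<in> ess_image C D F \<and>
           Z \<in> right_orth D (ess_image C D F)"
proof -
  obtain A u where A: "A \<in> Obj C" and u: "u \<in> Mor D (F A) Y"
    and univ: "\<And>X f. X \<in> Obj C \<Longrightarrow> f \<in> Mor D (F X) Y \<Longrightarrow> \<exists>!g. g \<in> Mor C X A \<and> u \<cdot>\<^bsub>D\<^esub> Fm g = f"
    using core Y unfolding has_coreflections_def by meson
  obtain Z p h where T: "Tri D (F A) Y Z u p h" using D.TR1_cone[OF u] by blast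
  have ph: "p \<in> Mor D Y Z" "h \<in> Mor D Z (Sh D 1 (F A))" using D.tri_mor[OF T] by auto
  have Z: "Z \<in> Obj D" using D.tri_obj[OF T] by blast
  have FA: "F A \<in> Obj D" using fun_obj A .
  have uh: "ShM D 1 u \<cdot>\<^bsub>D\<^esub> h = Zer D Z (Sh D 1 Y)"
  proof -
    have su: "ShM D 1 u \<in> Mor D (Sh D 1 (F A)) (Sh D 1 Y)" using D.shm_mor u .
    have "\<ominus>\<^bsub>hom_group D Z (Sh D 1 Y)\<^esub> (ShM D 1 u \<cdot>\<^bsub>D\<^esub> h) = Zer D Z (Sh D 1 Y)"
      using D.tri_cmp_zer[OF D.tri_rotate[OF D.tri_rotate[OF T]]] D.cmp_neg_left[OF ph(2) su] by simp
    also have "\<dots> = \<ominus>\<^bsub>hom_group D Z (Sh D 1 Y)\<^esub> Zer D Z (Sh D 1 Y)"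
      using D.neg_zer Z D.sh_obj Y by simp
    finally show ?thesis
      using D.neg_inj D.cmp_mor[OF ph(2) su] D.zer_mor Z D.sh_obj Y by blast
  qed
  have van: "no_mor D (F X) Z" if X: "X \<in> Obj C" for X
    unfolding no_mor_def
  proof
    fix f assume f: "f \<in> Mor D (F X) Z"
    let ?X = "Sh C (- 1) X"
    have X': "?X \<in> Obj C" using C.sh_obj X .
    have "F ?X \<simeq>\<^bsub>D\<^esub> Sh D (- 1) (F X)" using map_sh[OF X] .
    then obtain a b where ab: "a \<in> Mor D (F ?X) (Sh D (- 1) (F X))" "b \<in> Mor D (Sh D (- 1) (F X)) (F ?X)"
      "a \<cdot>\<^bsub>D\<^esub> b = Idt D (Sh D (- 1) (F X))"
      by (rule D.isomorphicE)
    define q where "q = ShM D (- 1) (h \<cdot>\<^bsub>D\<^esub> f)"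
    have hf: "h \<cdot>\<^bsub>D\<^esub> f \<in> Mor D (F X) (Sh D 1 (F A))" using D.cmp_mor f ph by blast
    have q: "q \<in> Mor D (Sh D (- 1) (F X)) (F A)"
      unfolding q_def using D.shm_mor[OF hf, of "- 1"] D.sh_cancel[OF FA, of 1] by simp
    have su: "ShM D 1 u \<in> Mor D (Sh D 1 (F A)) (Sh D 1 Y)" using D.shm_mor u .
    have "u \<cdot>\<^bsub>D\<^esub> q = ShM D (- 1) (ShM D 1 u \<cdot>\<^bsub>D\<^esub> (h \<cdot>\<^bsub>D\<^esub> f))"
      unfolding q_def using D.shm_cmp[OF hf su] D.shm_cancel[OF u, of 1] by simp
    also have "ShM D 1 u \<cdot>\<^bsub>D\<^esub> (h \<cdot>\<^bsub>D\<^esub> f) = Zer D (F X) (Sh D 1 Y)"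
      using D.cmp_assoc[OF f ph(2) su] uh D.cmp_zer_left[OF f] D.sh_obj Y by metis
    also have "ShM D (- 1) \<dots> = Zer D (Sh D (- 1) (F X)) Y"
      using D.shm_zer fun_obj X D.sh_obj Y D.sh_cancel[OF Y, of 1] by simp
    finally have uq: "u \<cdot>\<^bsub>D\<^esub> q = Zer D (Sh D (- 1) (F X)) Y" .
    have qa: "q \<cdot>\<^bsub>D\<^esub> a \<in> Mor D (F ?X) (F A)" using D.cmp_mor ab q by blast
    then obtain g where g: "g \<in> Mor C ?X A" "Fm g = q \<cdot>\<^bsub>D\<^esub> a"
      using full X' A unfolding full_functor_def by blast
    have "u \<cdot>\<^bsub>D\<^esub> Fm g = Zer D (F ?X) Y"
      using g D.cmp_assoc[OF ab(1) q u] uq D.cmp_zer_left[OF ab(1) Y] by simp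
    moreover have "u \<cdot>\<^bsub>D\<^esub> Fm (Zer C ?X A) = Zer D (F ?X) Y"
      using map_zer[OF X' A] D.cmp_zer_right[OF u] fun_obj X' by simp
    ultimately have "g = Zer C ?X A"
      using univ[OF X' D.zer_mor[OF fun_obj[OF X'] Y]] g(1) C.zer_mor[OF X' A] by blast
    then have "q \<cdot>\<^bsub>D\<^esub> a = Zer D (F ?X) (F A)" using g map_zer[OF X' A] by simp
    then have "q = Zer D (Sh D (- 1) (F X)) (F A)"
      using D.cmp_assoc[OF ab(2,1) q] D.cmp_idt_right[OF q] ab(3) D.cmp_zer_left[OF ab(2) FA] by simp
    then have "h \<cdot>\<^bsub>D\<^esub> f = Zer D (F X) (Sh D 1 (F A))"
      unfolding q_def using D.shm_eq_zer[OF hf, of "- 1"] D.sh_cancel[OF FA, of 1] by simp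
    from D.tri_lift[OF D.tri_rotate[OF T] f this]
    obtain f' where f': "f' \<in> Mor D (F X) Y" "p \<cdot>\<^bsub>D\<^esub> f' = f" by blast
    obtain g' where g': "g' \<in> Mor C X A" "u \<cdot>\<^bsub>D\<^esub> Fm g' = f'" using univ[OF X f'(1)] by blast
    show "f = Zer D (F X) Z"
      using D.cmp_assoc[OF fun_mor[OF g'(1)] u ph(1)] f' g' D.tri_cmp_zer[OF T]
        D.cmp_zer_left[OF fun_mor[OF g'(1)] Z] by simp
  qed
  have "no_mor D B Z" if "B \<in> ess_image C D F" for B
    using that van D.no_mor_iso D.isomorphic_refl[OF Z] unfolding ess_image_def by blast
  then have "Z \<in> right_orth D (ess_image C D F)"
    using D.in_right_orth[OF ess_image_subset] Z by blast
  moreover have "F A \<in> ess_image C D F"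
    unfolding ess_image_def using A D.isomorphic_refl FA by blast
  ultimately show ?thesis using T by blast
qed

end

section \<open>1-morphisms up to isomorphism and shift\<close>

context triangulated_two_category
begin

lemma hm_tri: "k \<in> W \<Longrightarrow> l \<in> W \<Longrightarrow> triangulated_category (Hm K k l)"
  using hm_linear_triangulated linear_triangulated_category.axioms(1) by blast

lemma post_functor:
  assumes "k \<in> W" "l \<in> W" "m \<in> W" "G \<in> Obj (Hm K l m)"
  shows "triangulated_functor (Hm K k l) (Hm K k m) (\<lambda>F. G \<star> F) (\<lambda>\<tau>. Idt (Hm K l m) G \<diamondop> \<tau>)"
  using assms cmp_exact_left hm_tri by (intro triangulated_functor.intro) blast+

lemma pre_functor:
  assumes "k \<in> W" "l \<in> W" "m \<in> W" "F \<in> Obj (Hm K k l)"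
  shows "triangulated_functor (Hm K l m) (Hm K k m) (\<lambda>G. G \<star> F) (\<lambda>\<sigma>. \<sigma> \<diamondop> Idt (Hm K k l) F)"
  using assms cmp_exact_right hm_tri by (intro triangulated_functor.intro) blast+

lemma act_functor:
  assumes "k \<in> W" "l \<in> W" "F \<in> Obj (Hm K k l)"
  shows "triangulated_functor (Ct K k) (Ct K l) (FOb K F) (FMo K F)"
  using assms fun_exact ct_triangulated by (intro triangulated_functor.intro) blast+

lemma eval_functor:
  assumes "k \<in> W" "l \<in> W" "A \<in> Obj (Ct K k)"
  shows "triangulated_functor (Hm K k l) (Ct K l) (\<lambda>F. FOb K F A) (\<lambda>\<tau>. NT K \<tau> A)"
  using assms nt_exact hm_tri ct_triangulated by (intro triangulated_functor.intro) blast+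

lemma hm_iso_trans:
  "k \<in> W \<Longrightarrow> l \<in> W \<Longrightarrow> A \<simeq>\<^bsub>Hm K k l\<^esub> B \<Longrightarrow> B \<simeq>\<^bsub>Hm K k l\<^esub> D \<Longrightarrow> A \<simeq>\<^bsub>Hm K k l\<^esub> D"
  using is_category.isomorphic_trans[OF hm_category] .

lemma hm_iso_sym: "k \<in> W \<Longrightarrow> l \<in> W \<Longrightarrow> A \<simeq>\<^bsub>Hm K k l\<^esub> B \<Longrightarrow> B \<simeq>\<^bsub>Hm K k l\<^esub> A"
  using is_category.isomorphic_sym[OF hm_category] .

lemma hm_iso_refl: "k \<in> W \<Longrightarrow> l \<in> W \<Longrightarrow> A \<in> Obj (Hm K k l) \<Longrightarrow> A \<simeq>\<^bsub>Hm K k l\<^esub> A"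
  using is_category.isomorphic_refl[OF hm_category] .

lemma iso_obj: "A \<simeq>\<^bsub>Hm K k l\<^esub> B \<Longrightarrow> A \<in> Obj (Hm K k l) \<and> B \<in> Obj (Hm K k l)"
  unfolding isomorphic_def by blast

lemma iso_post:
  "k \<in> W \<Longrightarrow> l \<in> W \<Longrightarrow> m \<in> W \<Longrightarrow> G \<in> Obj (Hm K l m) \<Longrightarrow> A \<simeq>\<^bsub>Hm K k l\<^esub> B \<Longrightarrow>
     G \<star> A \<simeq>\<^bsub>Hm K k m\<^esub> G \<star> B"
  using triangulated_functor.map_isomorphic[OF post_functor] .

lemma iso_pre:
  "k \<in> W \<Longrightarrow> l \<in> W \<Longrightarrow> m \<in> W \<Longrightarrow> F \<in> Obj (Hm K k l) \<Longrightarrow> A \<simeq>\<^bsub>Hm K l m\<^esub> B \<Longrightarrow>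
     A \<star> F \<simeq>\<^bsub>Hm K k m\<^esub> B \<star> F"
  using triangulated_functor.map_isomorphic[OF pre_functor] .

lemma zero_post:
  "k \<in> W \<Longrightarrow> l \<in> W \<Longrightarrow> m \<in> W \<Longrightarrow> G \<in> Obj (Hm K l m) \<Longrightarrow> zero_object (Hm K k l) A \<Longrightarrow>
     zero_object (Hm K k m) (G \<star> A)"
  using triangulated_functor.map_zero_object[OF post_functor] .

lemma zero_pre:
  "k \<in> W \<Longrightarrow> l \<in> W \<Longrightarrow> m \<in> W \<Longrightarrow> F \<in> Obj (Hm K k l) \<Longrightarrow> zero_object (Hm K l m) A \<Longrightarrow>
     zero_object (Hm K k m) (A \<star> F)"
  using triangulated_functor.map_zero_object[OF pre_functor] .

text \<open>
  Moving \<open>\<Psi>\<close> across \<open>F\<close> introduces shifts.  Vanishing of morphisms and fullness are invariant under shifts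
  (lemmas \<open>orth1_sim\<close> and \<open>full1_sim\<close>), so most computations can be done modulo them.
\<close>

definition sim where
  "sim k l A B \<longleftrightarrow> A \<in> Obj (Hm K k l) \<and> B \<in> Obj (Hm K k l) \<and>
     (\<exists>j. A \<simeq>\<^bsub>Hm K k l\<^esub> Sh (Hm K k l) j B)"

lemma sim_obj: "sim k l A B \<Longrightarrow> A \<in> Obj (Hm K k l) \<and> B \<in> Obj (Hm K k l)"
  unfolding sim_def by blast

context
  fixes k l assumes kl: "k \<in> W" "l \<in> W"
begin

interpretation H: triangulated_category "Hm K k l"
  using hm_tri[OF kl] .

lemma sim_shift: "A \<simeq>\<^bsub>Hm K k l\<^esub> Sh (Hm K k l) j B \<Longrightarrow> B \<in> Obj (Hm K k l) \<Longrightarrow> sim k l A B"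
  unfolding sim_def using iso_obj by blast

lemma sim_iso:
  assumes "A \<simeq>\<^bsub>Hm K k l\<^esub> B"
  shows "sim k l A B"
  using sim_shift[of A 0 B] assms H.sh_zero iso_obj[OF assms] by simp

lemma sim_refl: "A \<in> Obj (Hm K k l) \<Longrightarrow> sim k l A A"
  using sim_iso H.isomorphic_refl by blast

lemma sim_sym:
  assumes "sim k l A B"
  shows "sim k l B A"
proof -
  obtain j where j: "A \<simeq>\<^bsub>Hm K k l\<^esub> Sh (Hm K k l) j B" and B: "B \<in> Obj (Hm K k l)"
    and A: "A \<in> Obj (Hm K k l)"
    using assms unfolding sim_def by blast
  show ?thesis using sim_shift[OF H.sh_iso_iff[OF H.isomorphic_sym[OF j] B] A] .
qed

lemma sim_trans:
  assumes "sim k l A B" "sim k l B D"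
  shows "sim k l A D"
proof -
  obtain j where j: "A \<simeq>\<^bsub>Hm K k l\<^esub> Sh (Hm K k l) j B"
    using assms unfolding sim_def by blast
  obtain i where i: "B \<simeq>\<^bsub>Hm K k l\<^esub> Sh (Hm K k l) i D" and D: "D \<in> Obj (Hm K k l)"
    using assms unfolding sim_def by blast
  show ?thesis
    using sim_shift[of A "j + i" D] H.isomorphic_trans[OF j H.sh_iso[OF i]] H.sh_add[OF D] D by simp
qed

lemma sim_zero:
  assumes "zero_object (Hm K k l) A" "sim k l A B"
  shows "zero_object (Hm K k l) B"
proof -
  obtain j where j: "B \<simeq>\<^bsub>Hm K k l\<^esub> Sh (Hm K k l) j A"
    using sim_sym[OF assms(2)] unfolding sim_def by blast
  show ?thesis using H.zero_object_iso[OF H.zero_object_sh[OF assms(1)] H.isomorphic_sym[OF j]] .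
qed

end

lemma sim_post:
  assumes W: "k \<in> W" "l \<in> W" "m \<in> W" and G: "G \<in> Obj (Hm K l m)" and s: "sim k l A B"
  shows "sim k m (G \<star> A) (G \<star> B)"
proof -
  obtain j where j: "A \<simeq>\<^bsub>Hm K k l\<^esub> Sh (Hm K k l) j B" and B: "B \<in> Obj (Hm K k l)"
    using s unfolding sim_def by blast
  have "G \<star> A \<simeq>\<^bsub>Hm K k m\<^esub> G \<star> Sh (Hm K k l) j B" using iso_post[OF W G j] .
  then have "G \<star> A \<simeq>\<^bsub>Hm K k m\<^esub> Sh (Hm K k m) j (G \<star> B)"
    using hm_iso_trans[OF W(1,3)] triangulated_functor.map_sh[OF post_functor[OF W G] B] by blast
  then show ?thesis using sim_shift[OF W(1,3)] cmp1[OF W B G] by blast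
qed

lemma sim_pre:
  assumes W: "k \<in> W" "l \<in> W" "m \<in> W" and F: "F \<in> Obj (Hm K k l)" and s: "sim l m A B"
  shows "sim k m (A \<star> F) (B \<star> F)"
proof -
  obtain j where j: "A \<simeq>\<^bsub>Hm K l m\<^esub> Sh (Hm K l m) j B" and B: "B \<in> Obj (Hm K l m)"
    using s unfolding sim_def by blast
  have "A \<star> F \<simeq>\<^bsub>Hm K k m\<^esub> Sh (Hm K l m) j B \<star> F" using iso_pre[OF W F j] .
  then have "A \<star> F \<simeq>\<^bsub>Hm K k m\<^esub> Sh (Hm K k m) j (B \<star> F)"
    using hm_iso_trans[OF W(1,3)] triangulated_functor.map_sh[OF pre_functor[OF W F] B] by blast
  then show ?thesis using sim_shift[OF W(1,3)] cmp1[OF W F B] by blast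
qed

lemma sim_head:
  assumes W: "k \<in> W" "l \<in> W" "m \<in> W" "p \<in> W" "p' \<in> W" and X: "X \<in> Obj (Hm K k l)"
    and A: "A \<in> Obj (Hm K p m)" "B \<in> Obj (Hm K l p)"
    and D: "D \<in> Obj (Hm K p' m)" "E \<in> Obj (Hm K l p')" and s: "sim l m (A \<star> B) (D \<star> E)"
  shows "sim k m (A \<star> B \<star> X) (D \<star> E \<star> X)"
  using sim_pre[OF W(1-3) X s] cmp1_assoc[OF W(1,2,4,3) X A(2,1)] cmp1_assoc[OF W(1,2,5,3) X D(2,1)]
  by simp

text \<open>A commutation with \<open>T\<close> turns into one with the inverse \<open>U\<close> of \<open>T\<close>.\<close>

lemma sim_conjugate:
  assumes W: "k \<in> W" "l \<in> W" and T: "T \<in> Obj (Hm K k k)" "U \<in> Obj (Hm K k k)"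
    and T': "T' \<in> Obj (Hm K l l)" "U' \<in> Obj (Hm K l l)"
    and i: "T \<star> U \<simeq>\<^bsub>Hm K k k\<^esub> Id1 K k" "U' \<star> T' \<simeq>\<^bsub>Hm K l l\<^esub> Id1 K l"
    and A: "A \<in> Obj (Hm K k l)" and B: "B \<in> Obj (Hm K k l)" and s: "sim k l (T' \<star> A) (B \<star> T)"
  shows "sim k l (U' \<star> B) (A \<star> U)"
proof -
  have AQ: "A \<star> U \<in> Obj (Hm K k l)" using cmp1[OF W(1,1,2) T(2) A] .
  have "sim k l (B \<star> (T \<star> U)) B"
    using sim_post[OF W(1,1,2) B sim_iso[OF W(1,1) i(1)]] cmp1_id[OF W B] by simp
  then have "sim k l B (B \<star> (T \<star> U))" by (rule sim_sym[OF W])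
  moreover have "sim k l (B \<star> (T \<star> U)) (T' \<star> (A \<star> U))"
    using sim_sym[OF W sim_pre[OF W(1,1,2) T(2) s]] cmp1_assoc[OF W(1,1,1,2) T(2,1) B]
      cmp1_assoc[OF W(1,1,2,2) T(2) A T'(1)] by simp
  ultimately have "sim k l B (T' \<star> (A \<star> U))" using sim_trans[OF W] by blast
  then have "sim k l (U' \<star> B) (U' \<star> (T' \<star> (A \<star> U)))" by (rule sim_post[OF W(1,2,2) T'(2)])
  moreover have "sim k l (U' \<star> (T' \<star> (A \<star> U))) (A \<star> U)"
    using sim_pre[OF W(1,2,2) AQ sim_iso[OF W(2,2) i(2)]] cmp1_id[OF W AQ]
      cmp1_assoc[OF W(1,2,2,2) AQ T'] by simp
  ultimately show ?thesis using sim_trans[OF W] by blast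
qed

section \<open>Fullness and vanishing for functors given by 1-morphisms\<close>

definition full1 where
  "full1 k l A \<longleftrightarrow> full_functor (Ct K k) (Ct K l) (FOb K A) (FMo K A)"

definition orth1 where
  "orth1 k l A B \<longleftrightarrow> (\<forall>X \<in> Obj (Ct K k). \<forall>Y \<in> Obj (Ct K k). no_mor (Ct K l) (FOb K A X) (FOb K B Y))"

definition invertible1 where
  "invertible1 k T \<longleftrightarrow> T \<in> Obj (Hm K k k) \<and> (\<exists>T' \<in> Obj (Hm K k k).
     T \<star> T' \<simeq>\<^bsub>Hm K k k\<^esub> Id1 K k \<and> T' \<star> T \<simeq>\<^bsub>Hm K k k\<^esub> Id1 K k)"

lemma cmp_act_obj:
  "k \<in> W \<Longrightarrow> l \<in> W \<Longrightarrow> m \<in> W \<Longrightarrow> F \<in> Obj (Hm K k l) \<Longrightarrow> G \<in> Obj (Hm K l m) \<Longrightarrow>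
     X \<in> Obj (Ct K k) \<Longrightarrow> FOb K (G \<star> F) X = FOb K G (FOb K F X)"
  using fun_cmp1 by blast

lemma cmp_act_mor:
  "k \<in> W \<Longrightarrow> l \<in> W \<Longrightarrow> m \<in> W \<Longrightarrow> F \<in> Obj (Hm K k l) \<Longrightarrow> G \<in> Obj (Hm K l m) \<Longrightarrow>
     f \<in> Mor (Ct K k) X Y \<Longrightarrow> FMo K (G \<star> F) f = FMo K G (FMo K F f)"
  using fun_cmp1 by blast

lemma act_obj: "k \<in> W \<Longrightarrow> l \<in> W \<Longrightarrow> F \<in> Obj (Hm K k l) \<Longrightarrow> X \<in> Obj (Ct K k) \<Longrightarrow> FOb K F X \<in> Obj (Ct K l)"
  using exact_functor.fun_obj[OF fun_exact] .

lemma act_mor: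
  "k \<in> W \<Longrightarrow> l \<in> W \<Longrightarrow> F \<in> Obj (Hm K k l) \<Longrightarrow> f \<in> Mor (Ct K k) X Y \<Longrightarrow>
     FMo K F f \<in> Mor (Ct K l) (FOb K F X) (FOb K F Y)"
  using exact_functor.fun_mor[OF fun_exact] .

lemma act_cmp:
  "k \<in> W \<Longrightarrow> l \<in> W \<Longrightarrow> F \<in> Obj (Hm K k l) \<Longrightarrow> f \<in> Mor (Ct K k) X Y \<Longrightarrow> g \<in> Mor (Ct K k) Y Z \<Longrightarrow>
     FMo K F (g \<cdot>\<^bsub>Ct K k\<^esub> f) = FMo K F g \<cdot>\<^bsub>Ct K l\<^esub> FMo K F f"
  using exact_functor.fun_cmp[OF fun_exact] .

lemma act_zer:
  "k \<in> W \<Longrightarrow> l \<in> W \<Longrightarrow> F \<in> Obj (Hm K k l) \<Longrightarrow> X \<in> Obj (Ct K k) \<Longrightarrow> Y \<in> Obj (Ct K k) \<Longrightarrow>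
     FMo K F (Zer (Ct K k) X Y) = Zer (Ct K l) (FOb K F X) (FOb K F Y)"
  using triangulated_functor.map_zer[OF act_functor] .

lemma act_idt:
  "k \<in> W \<Longrightarrow> l \<in> W \<Longrightarrow> F \<in> Obj (Hm K k l) \<Longrightarrow> X \<in> Obj (Ct K k) \<Longrightarrow>
     FMo K F (Idt (Ct K k) X) = Idt (Ct K l) (FOb K F X)"
  using exact_functor.fun_idt[OF fun_exact] .

lemma nat_isoE:
  assumes W: "k \<in> W" "l \<in> W" and i: "A \<simeq>\<^bsub>Hm K k l\<^esub> B"
  obtains \<theta> \<theta>' where
    "\<And>X. X \<in> Obj (Ct K k) \<Longrightarrow> \<theta> X \<in> Mor (Ct K l) (FOb K A X) (FOb K B X)"
    "\<And>X. X \<in> Obj (Ct K k) \<Longrightarrow> \<theta>' X \<in> Mor (Ct K l) (FOb K B X) (FOb K A X)"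
    "\<And>X. X \<in> Obj (Ct K k) \<Longrightarrow> \<theta>' X \<cdot>\<^bsub>Ct K l\<^esub> \<theta> X = Idt (Ct K l) (FOb K A X)"
    "\<And>X. X \<in> Obj (Ct K k) \<Longrightarrow> \<theta> X \<cdot>\<^bsub>Ct K l\<^esub> \<theta>' X = Idt (Ct K l) (FOb K B X)"
    "\<And>X Y f. f \<in> Mor (Ct K k) X Y \<Longrightarrow> \<theta> Y \<cdot>\<^bsub>Ct K l\<^esub> FMo K A f = FMo K B f \<cdot>\<^bsub>Ct K l\<^esub> \<theta> X"
proof -
  obtain \<tau> \<sigma> where t: "\<tau> \<in> Mor (Hm K k l) A B" "\<sigma> \<in> Mor (Hm K k l) B A"
    "\<sigma> \<cdot>\<^bsub>Hm K k l\<^esub> \<tau> = Idt (Hm K k l) A" "\<tau> \<cdot>\<^bsub>Hm K k l\<^esub> \<sigma> = Idt (Hm K k l) B"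
    "A \<in> Obj (Hm K k l)" "B \<in> Obj (Hm K k l)"
    using i by (rule is_category.isomorphicE[OF hm_category[OF W]])
  show thesis
  proof (rule that[of "NT K \<tau>" "NT K \<sigma>"])
    fix X assume X: "X \<in> Obj (Ct K k)"
    interpret E: triangulated_functor "Hm K k l" "Ct K l" "\<lambda>F. FOb K F X" "\<lambda>\<tau>. NT K \<tau> X"
      using eval_functor[OF W X] .
    show "NT K \<tau> X \<in> Mor (Ct K l) (FOb K A X) (FOb K B X)"
      "NT K \<sigma> X \<in> Mor (Ct K l) (FOb K B X) (FOb K A X)"
      using E.fun_mor t by blast+
    show "NT K \<sigma> X \<cdot>\<^bsub>Ct K l\<^esub> NT K \<tau> X = Idt (Ct K l) (FOb K A X)"
      "NT K \<tau> X \<cdot>\<^bsub>Ct K l\<^esub> NT K \<sigma> X = Idt (Ct K l) (FOb K B X)"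
      using E.fun_cmp[OF t(1,2)] E.fun_cmp[OF t(2,1)] E.fun_idt t by simp_all
  next
    show "\<And>X Y f. f \<in> Mor (Ct K k) X Y \<Longrightarrow>
        NT K \<tau> Y \<cdot>\<^bsub>Ct K l\<^esub> FMo K A f = FMo K B f \<cdot>\<^bsub>Ct K l\<^esub> NT K \<tau> X"
      using nt_natural[OF W t(1)] .
  qed
qed

lemma act_iso:
  "k \<in> W \<Longrightarrow> l \<in> W \<Longrightarrow> A \<simeq>\<^bsub>Hm K k l\<^esub> B \<Longrightarrow> X \<in> Obj (Ct K k) \<Longrightarrow> FOb K A X \<simeq>\<^bsub>Ct K l\<^esub> FOb K B X"
  using triangulated_functor.map_isomorphic[OF eval_functor] .

lemma orth1_zero:
  assumes W: "k \<in> W" "l \<in> W" and z: "zero_object (Hm K k l) A"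
  shows "orth1 k l A B"
proof -
  interpret D: triangulated_category "Ct K l" using ct_triangulated W(2) .
  show ?thesis
    unfolding orth1_def no_mor_def
    using D.from_zero triangulated_functor.map_zero_object[OF eval_functor[OF W] z] by blast
qed

lemma orth1_iso:
  assumes W: "k \<in> W" "l \<in> W" and i: "A \<simeq>\<^bsub>Hm K k l\<^esub> A'" "B \<simeq>\<^bsub>Hm K k l\<^esub> B'" and o: "orth1 k l A B"
  shows "orth1 k l A' B'"
proof -
  interpret D: triangulated_category "Ct K l" using ct_triangulated W(2) .
  show ?thesis
    using o D.no_mor_iso act_iso[OF W i(1)] act_iso[OF W i(2)] unfolding orth1_def by blast
qed

lemma full1_iso:
  assumes W: "k \<in> W" "l \<in> W" and i: "A \<simeq>\<^bsub>Hm K k l\<^esub> B" and full: "full1 k l A"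
  shows "full1 k l B"
  unfolding full1_def full_functor_def
proof (intro ballI)
  interpret C: triangulated_category "Ct K k" using ct_triangulated W(1) .
  interpret D: triangulated_category "Ct K l" using ct_triangulated W(2) .
  fix X Y f assume X: "X \<in> Obj (Ct K k)" and Y: "Y \<in> Obj (Ct K k)"
    and f: "f \<in> Mor (Ct K l) (FOb K B X) (FOb K B Y)"
  obtain \<theta> \<theta>' where
    t: "\<And>X. X \<in> Obj (Ct K k) \<Longrightarrow> \<theta> X \<in> Mor (Ct K l) (FOb K A X) (FOb K B X)"
    "\<And>X. X \<in> Obj (Ct K k) \<Longrightarrow> \<theta>' X \<in> Mor (Ct K l) (FOb K B X) (FOb K A X)"
    "\<And>X. X \<in> Obj (Ct K k) \<Longrightarrow> \<theta>' X \<cdot>\<^bsub>Ct K l\<^esub> \<theta> X = Idt (Ct K l) (FOb K A X)"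
    "\<And>X. X \<in> Obj (Ct K k) \<Longrightarrow> \<theta> X \<cdot>\<^bsub>Ct K l\<^esub> \<theta>' X = Idt (Ct K l) (FOb K B X)"
    "\<And>X Y f. f \<in> Mor (Ct K k) X Y \<Longrightarrow> \<theta> Y \<cdot>\<^bsub>Ct K l\<^esub> FMo K A f = FMo K B f \<cdot>\<^bsub>Ct K l\<^esub> \<theta> X"
    using W i by (rule nat_isoE) blast
  have B: "B \<in> Obj (Hm K k l)" using iso_obj i by blast
  have fX: "f \<cdot>\<^bsub>Ct K l\<^esub> \<theta> X \<in> Mor (Ct K l) (FOb K A X) (FOb K B Y)"
    using D.cmp_mor[OF t(1)[OF X] f] .
  have "\<theta>' Y \<cdot>\<^bsub>Ct K l\<^esub> (f \<cdot>\<^bsub>Ct K l\<^esub> \<theta> X) \<in> Mor (Ct K l) (FOb K A X) (FOb K A Y)"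
    using D.cmp_mor[OF fX t(2)[OF Y]] .
  then obtain g where g: "g \<in> Mor (Ct K k) X Y"
    "FMo K A g = \<theta>' Y \<cdot>\<^bsub>Ct K l\<^esub> (f \<cdot>\<^bsub>Ct K l\<^esub> \<theta> X)"
    using full X Y unfolding full1_def full_functor_def by blast
  have Bg: "FMo K B g \<in> Mor (Ct K l) (FOb K B X) (FOb K B Y)" using act_mor[OF W B g(1)] .
  have "FMo K B g \<cdot>\<^bsub>Ct K l\<^esub> \<theta> X = f \<cdot>\<^bsub>Ct K l\<^esub> \<theta> X"
    using t(5)[OF g(1)] g(2) D.cmp_assoc[OF fX t(2)[OF Y] t(1)[OF Y]] t(4)[OF Y]
      D.cmp_idt_left[OF fX] by simp
  then have "FMo K B g = f"
    using D.cancel_retraction[OF t(2)[OF X] t(1)[OF X] t(4)[OF X] Bg f] by blast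
  then show "\<exists>g \<in> Mor (Ct K k) X Y. FMo K B g = f" using g(1) by blast
qed

lemma full1_cmp:
  assumes W: "k \<in> W" "l \<in> W" "m \<in> W" and A: "A \<in> Obj (Hm K k l)" and B: "B \<in> Obj (Hm K l m)"
    and full: "full1 k l A" "full1 l m B"
  shows "full1 k m (B \<star> A)"
  unfolding full1_def full_functor_def
proof (intro ballI)
  fix X Y f assume X: "X \<in> Obj (Ct K k)" and Y: "Y \<in> Obj (Ct K k)"
    and f: "f \<in> Mor (Ct K m) (FOb K (B \<star> A) X) (FOb K (B \<star> A) Y)"
  note o = cmp_act_obj[OF W A B]
  obtain g where g: "g \<in> Mor (Ct K l) (FOb K A X) (FOb K A Y)" "FMo K B g = f"
    using f full(2) o[OF X] o[OF Y] act_obj[OF W(1,2) A] X Y unfolding full1_def full_functor_def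
    by metis
  obtain h where h: "h \<in> Mor (Ct K k) X Y" "FMo K A h = g"
    using g full(1) X Y unfolding full1_def full_functor_def by metis
  show "\<exists>g \<in> Mor (Ct K k) X Y. FMo K (B \<star> A) g = f"
    using h g cmp_act_mor[OF W A B h(1)] by metis
qed

lemma full1_Id1: "k \<in> W \<Longrightarrow> full1 k k (Id1 K k)"
  unfolding full1_def full_functor_def using fun_id1 by metis

lemma retraction_faithful:
  assumes W: "k \<in> W" "l \<in> W" and T: "T \<in> Obj (Hm K k l)" "T' \<in> Obj (Hm K l k)"
    and i: "T' \<star> T \<simeq>\<^bsub>Hm K k k\<^esub> Id1 K k"
    and f: "f \<in> Mor (Ct K k) X Y" "g \<in> Mor (Ct K k) X Y" and e: "FMo K T f = FMo K T g"
  shows "f = g"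
proof -
  interpret C: triangulated_category "Ct K k" using ct_triangulated W(1) .
  have X: "X \<in> Obj (Ct K k)" using C.mor_obj f by blast
  obtain \<theta> \<theta>' where
    t: "\<And>X. X \<in> Obj (Ct K k) \<Longrightarrow> \<theta> X \<in> Mor (Ct K k) (FOb K (T' \<star> T) X) (FOb K (Id1 K k) X)"
    "\<And>X. X \<in> Obj (Ct K k) \<Longrightarrow> \<theta>' X \<in> Mor (Ct K k) (FOb K (Id1 K k) X) (FOb K (T' \<star> T) X)"
    "\<And>X. X \<in> Obj (Ct K k) \<Longrightarrow> \<theta> X \<cdot>\<^bsub>Ct K k\<^esub> \<theta>' X = Idt (Ct K k) (FOb K (Id1 K k) X)"
    "\<And>X Y f. f \<in> Mor (Ct K k) X Y \<Longrightarrow>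
       \<theta> Y \<cdot>\<^bsub>Ct K k\<^esub> FMo K (T' \<star> T) f = FMo K (Id1 K k) f \<cdot>\<^bsub>Ct K k\<^esub> \<theta> X"
    using W(1) W(1) i by (rule nat_isoE) blast
  have t': "\<theta> X \<in> Mor (Ct K k) (FOb K (T' \<star> T) X) X" "\<theta>' X \<in> Mor (Ct K k) X (FOb K (T' \<star> T) X)"
    "\<theta> X \<cdot>\<^bsub>Ct K k\<^esub> \<theta>' X = Idt (Ct K k) X"
    using t(1-3)[OF X] fun_id1[OF W(1)] X by auto
  have "FMo K (T' \<star> T) f = FMo K (T' \<star> T) g"
    using cmp_act_mor[OF W W(1) T] f e by metis
  then have "f \<cdot>\<^bsub>Ct K k\<^esub> \<theta> X = g \<cdot>\<^bsub>Ct K k\<^esub> \<theta> X"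
    using t(4)[OF f(1)] t(4)[OF f(2)] fun_id1[OF W(1)] f by metis
  then show ?thesis using C.cancel_retraction[OF t'(2,1,3) f] by blast
qed

lemma invertible1E:
  assumes "invertible1 k T"
  obtains T' where "T \<in> Obj (Hm K k k)" "T' \<in> Obj (Hm K k k)"
    "T \<star> T' \<simeq>\<^bsub>Hm K k k\<^esub> Id1 K k" "T' \<star> T \<simeq>\<^bsub>Hm K k k\<^esub> Id1 K k" "invertible1 k T'"
  using assms unfolding invertible1_def by blast

text \<open>
  If \<open>T'\<close> is inverse to \<open>T\<close>, then \<open>T'\<close> applied to \<open>f : T X \<rightarrow> T Y\<close> is, up to the identification of
  \<open>T' T\<close> with the identity, of the form \<open>T' (T g)\<close>, and \<open>T'\<close> is faithful.
\<close>

lemma full1_invertible: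
  assumes W: "k \<in> W" and "invertible1 k T"
  shows "full1 k k T"
  unfolding full1_def full_functor_def
proof (intro ballI)
  interpret C: triangulated_category "Ct K k" using ct_triangulated W .
  obtain T' where T: "T \<in> Obj (Hm K k k)" "T' \<in> Obj (Hm K k k)" and
    i: "T \<star> T' \<simeq>\<^bsub>Hm K k k\<^esub> Id1 K k" "T' \<star> T \<simeq>\<^bsub>Hm K k k\<^esub> Id1 K k"
    using assms(2) by (rule invertible1E)
  have TT: "T' \<star> T \<in> Obj (Hm K k k)" using iso_obj i by blast
  have full: "full1 k k (T' \<star> T)"
    using full1_iso[OF W W hm_iso_sym[OF W W i(2)] full1_Id1[OF W]] .
  fix X Y f assume X: "X \<in> Obj (Ct K k)" and Y: "Y \<in> Obj (Ct K k)"
    and f: "f \<in> Mor (Ct K k) (FOb K T X) (FOb K T Y)"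
  have "FMo K T' f \<in> Mor (Ct K k) (FOb K (T' \<star> T) X) (FOb K (T' \<star> T) Y)"
    using act_mor[OF W W T(2) f] cmp_act_obj[OF W W W T X] cmp_act_obj[OF W W W T Y] by simp
  then obtain g where g: "g \<in> Mor (Ct K k) X Y" "FMo K (T' \<star> T) g = FMo K T' f"
    using full X Y unfolding full1_def full_functor_def by blast
  have "FMo K T g = f"
    using retraction_faithful[OF W W T(2,1) i(1) act_mor[OF W W T(1) g(1)] f] g
      cmp_act_mor[OF W W W T g(1)] by simp
  then show "\<exists>g \<in> Mor (Ct K k) X Y. FMo K T g = f" using g(1) by blast
qed

lemma invertible1_cmp:
  assumes k: "k \<in> W" and "invertible1 k S" "invertible1 k T"
  shows "invertible1 k (S \<star> T)"
proof -
  obtain S' where S: "S \<in> Obj (Hm K k k)" "S' \<in> Obj (Hm K k k)"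
    "S \<star> S' \<simeq>\<^bsub>Hm K k k\<^esub> Id1 K k" "S' \<star> S \<simeq>\<^bsub>Hm K k k\<^esub> Id1 K k"
    using assms(2) by (rule invertible1E)
  obtain T' where T: "T \<in> Obj (Hm K k k)" "T' \<in> Obj (Hm K k k)"
    "T \<star> T' \<simeq>\<^bsub>Hm K k k\<^esub> Id1 K k" "T' \<star> T \<simeq>\<^bsub>Hm K k k\<^esub> Id1 K k"
    using assms(3) by (rule invertible1E)
  have c: "(A \<star> B) \<star> (B' \<star> A') \<simeq>\<^bsub>Hm K k k\<^esub> Id1 K k"
    if A: "A \<in> Obj (Hm K k k)" "A' \<in> Obj (Hm K k k)" "A \<star> A' \<simeq>\<^bsub>Hm K k k\<^esub> Id1 K k"
      and B: "B \<in> Obj (Hm K k k)" "B' \<in> Obj (Hm K k k)" "B \<star> B' \<simeq>\<^bsub>Hm K k k\<^esub> Id1 K k"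
    for A A' B B'
  proof -
    have "(A \<star> B) \<star> (B' \<star> A') = A \<star> ((B \<star> B') \<star> A')"
      using cmp1_assoc[OF k k k k cmp1[OF k k k A(2) B(2)] B(1) A(1)]
        cmp1_assoc[OF k k k k A(2) B(2,1)] by simp
    moreover have "A \<star> ((B \<star> B') \<star> A') \<simeq>\<^bsub>Hm K k k\<^esub> A \<star> A'"
      using iso_post[OF k k k A(1) iso_pre[OF k k k A(2) B(3)]] cmp1_id[OF k k A(2)] by simp
    ultimately show ?thesis using hm_iso_trans[OF k k _ A(3)] by simp
  qed
  show ?thesis
    unfolding invertible1_def using c[OF S(1-3) T(1-3)] c[OF T(2,1,4) S(2,1,4)] cmp1[OF k k k] S T
    by blast
qed

lemma invertible1_Id1:
  assumes k: "k \<in> W"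
  shows "invertible1 k (Id1 K k)"
  unfolding invertible1_def
  using id1[OF k] cmp1_id[OF k k id1[OF k]] hm_iso_refl[OF k k id1[OF k]]
  by (intro conjI bexI[of _ "Id1 K k"]) simp_all

lemma full1_reflect:
  assumes W: "k \<in> W" "l \<in> W" and A: "A \<in> Obj (Hm K k l)" and T: "invertible1 l T"
    and full: "full1 k l (T \<star> A)"
  shows "full1 k l A"
proof -
  obtain T' where T': "T \<in> Obj (Hm K l l)" "T' \<in> Obj (Hm K l l)"
    "T' \<star> T \<simeq>\<^bsub>Hm K l l\<^esub> Id1 K l" "invertible1 l T'"
    using T by (rule invertible1E)
  have "full1 k l (T' \<star> (T \<star> A))"
    using full1_cmp[OF W(1,2,2) cmp1[OF W(1,2,2) A T'(1)] T'(2) full full1_invertible[OF W(2) T'(4)]] .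
  moreover have "T' \<star> (T \<star> A) \<simeq>\<^bsub>Hm K k l\<^esub> A"
    using iso_pre[OF W(1,2,2) A T'(3)] cmp1_assoc[OF W(1,2,2,2) A T'(1,2)] cmp1_id[OF W A] by simp
  ultimately show ?thesis using full1_iso[OF W] by blast
qed

text \<open>
  Composition is exact in each argument, so \<open>A[j]\<close> is the composite of \<open>A\<close> with \<open>1[j]\<close>, and \<open>1[j]\<close> has the
  inverse \<open>1[-j]\<close>.  This makes fullness and vanishing insensitive to shifts of 1-morphisms.
\<close>

lemma sh_invertible:
  assumes W: "k \<in> W"
  shows "invertible1 k (Sh (Hm K k k) j (Id1 K k))"
proof -
  interpret H: triangulated_category "Hm K k k" using hm_tri[OF W W] .
  let ?S = "\<lambda>j. Sh (Hm K k k) j (Id1 K k)"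
  have I: "Id1 K k \<in> Obj (Hm K k k)" using id1 W .
  have S: "?S j \<in> Obj (Hm K k k)" for j using H.sh_obj I .
  have "?S j \<star> ?S (- j) \<simeq>\<^bsub>Hm K k k\<^esub> Id1 K k" for j
    using triangulated_functor.map_sh[OF pre_functor[OF W W W S[of "- j"]] I, of j]
      cmp1_id[OF W W S] H.sh_cancel[OF I] by simp
  from this[of j] this[of "- j"] show ?thesis unfolding invertible1_def using S by auto
qed

lemma sim_as_composite:
  assumes W: "k \<in> W" "l \<in> W" and "sim k l A B"
  obtains S where "invertible1 k S" "A \<simeq>\<^bsub>Hm K k l\<^esub> B \<star> S"
proof -
  obtain j where j: "A \<simeq>\<^bsub>Hm K k l\<^esub> Sh (Hm K k l) j B" and B: "B \<in> Obj (Hm K k l)"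
    using assms unfolding sim_def by blast
  have "B \<star> Sh (Hm K k k) j (Id1 K k) \<simeq>\<^bsub>Hm K k l\<^esub> Sh (Hm K k l) j B"
    using triangulated_functor.map_sh[OF post_functor[OF W(1,1,2) B] id1[OF W(1)], of j]
      cmp1_id[OF W B] by simp
  then have "A \<simeq>\<^bsub>Hm K k l\<^esub> B \<star> Sh (Hm K k k) j (Id1 K k)"
    using hm_iso_trans[OF W j] hm_iso_sym[OF W] by blast
  then show thesis using that sh_invertible[OF W(1)] by blast
qed

lemma full1_sim:
  assumes W: "k \<in> W" "l \<in> W" and s: "sim k l A B" and full: "full1 k l B"
  shows "full1 k l A"
proof -
  obtain S where S: "invertible1 k S" "A \<simeq>\<^bsub>Hm K k l\<^esub> B \<star> S"
    using W s by (rule sim_as_composite)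
  have "full1 k l (B \<star> S)"
    using full1_cmp[OF W(1,1,2) _ _ full1_invertible[OF W(1) S(1)] full] S(1) sim_obj[OF s]
    unfolding invertible1_def by blast
  then show ?thesis using full1_iso[OF W hm_iso_sym[OF W S(2)]] by blast
qed

lemma orth1_pre:
  assumes W: "k \<in> W" "k' \<in> W" "l \<in> W" and A: "A \<in> Obj (Hm K k' l)" "B \<in> Obj (Hm K k' l)"
    and S: "S \<in> Obj (Hm K k k')" "S' \<in> Obj (Hm K k k')" and o: "orth1 k' l A B"
  shows "orth1 k l (A \<star> S) (B \<star> S')"
  using o cmp_act_obj[OF W S(1) A(1)] cmp_act_obj[OF W S(2) A(2)] act_obj[OF W(1,2)] S
  unfolding orth1_def by metis

lemma orth1_sim:
  assumes W: "k \<in> W" "l \<in> W" and s: "sim k l A A'" "sim k l B B'" and o: "orth1 k l A' B'"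
  shows "orth1 k l A B"
proof -
  obtain S where S: "invertible1 k S" "A \<simeq>\<^bsub>Hm K k l\<^esub> A' \<star> S"
    using W s(1) by (rule sim_as_composite)
  obtain S' where S': "invertible1 k S'" "B \<simeq>\<^bsub>Hm K k l\<^esub> B' \<star> S'"
    using W s(2) by (rule sim_as_composite)
  have "orth1 k l (A' \<star> S) (B' \<star> S')"
    using orth1_pre[OF W(1,1,2) _ _ _ _ o] S(1) S'(1) sim_obj[OF s(1)] sim_obj[OF s(2)]
    unfolding invertible1_def by blast
  then show ?thesis using orth1_iso[OF W hm_iso_sym[OF W S(2)] hm_iso_sym[OF W S'(2)]] by blast
qed

text \<open>Invertible 1-morphisms act faithfully, so vanishing may be tested after applying one.\<close>

lemma orth1_reflect:
  assumes W: "k \<in> W" "l \<in> W" and A: "A \<in> Obj (Hm K k l)" "B \<in> Obj (Hm K k l)"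
    and T: "invertible1 l T" and o: "orth1 k l (T \<star> A) (T \<star> B)"
  shows "orth1 k l A B"
  unfolding orth1_def no_mor_def
proof (intro ballI)
  interpret C: triangulated_category "Ct K l" using ct_triangulated W(2) .
  obtain T' where T: "T \<in> Obj (Hm K l l)" "T' \<in> Obj (Hm K l l)" and
    i: "T' \<star> T \<simeq>\<^bsub>Hm K l l\<^esub> Id1 K l"
    using T by (rule invertible1E)
  fix X Y f assume X: "X \<in> Obj (Ct K k)" and Y: "Y \<in> Obj (Ct K k)"
    and f: "f \<in> Mor (Ct K l) (FOb K A X) (FOb K B Y)"
  have ob: "FOb K A X \<in> Obj (Ct K l)" "FOb K B Y \<in> Obj (Ct K l)" using C.mor_obj f by blast+
  have "no_mor (Ct K l) (FOb K T (FOb K A X)) (FOb K T (FOb K B Y))"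
    using o X Y cmp_act_obj[OF W(1,2,2) A(1) T(1) X] cmp_act_obj[OF W(1,2,2) A(2) T(1) Y]
    unfolding orth1_def by metis
  then have "FMo K T f = FMo K T (Zer (Ct K l) (FOb K A X) (FOb K B Y))"
    using act_mor[OF W(2,2) T(1) f] act_zer[OF W(2,2) T(1) ob] C.no_morD by metis
  then show "f = Zer (Ct K l) (FOb K A X) (FOb K B Y)"
    using retraction_faithful[OF W(2,2) T i f C.zer_mor[OF ob]] by blast
qed

lemma orth1_post:
  assumes W: "k \<in> W" "l \<in> W" "m \<in> W" and A: "A \<in> Obj (Hm K k l)" "B \<in> Obj (Hm K k l)"
    and T: "T \<in> Obj (Hm K l m)" "full1 l m T" and o: "orth1 k l A B"
  shows "orth1 k m (T \<star> A) (T \<star> B)"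
  unfolding orth1_def no_mor_def
proof (intro ballI)
  interpret C: triangulated_category "Ct K l" using ct_triangulated W(2) .
  fix X Y f assume X: "X \<in> Obj (Ct K k)" and Y: "Y \<in> Obj (Ct K k)"
    and f: "f \<in> Mor (Ct K m) (FOb K (T \<star> A) X) (FOb K (T \<star> B) Y)"
  have e: "FOb K (T \<star> A) X = FOb K T (FOb K A X)" "FOb K (T \<star> B) Y = FOb K T (FOb K B Y)"
    using cmp_act_obj[OF W A(1) T(1) X] cmp_act_obj[OF W A(2) T(1) Y] .
  have ob: "FOb K A X \<in> Obj (Ct K l)" "FOb K B Y \<in> Obj (Ct K l)"
    using act_obj[OF W(1,2)] A X Y by blast+
  obtain g where g: "g \<in> Mor (Ct K l) (FOb K A X) (FOb K B Y)" "FMo K T g = f"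
    using f T(2) ob e unfolding full1_def full_functor_def by metis
  then have "g = Zer (Ct K l) (FOb K A X) (FOb K B Y)"
    using o X Y unfolding orth1_def no_mor_def by blast
  then show "f = Zer (Ct K m) (FOb K (T \<star> A) X) (FOb K (T \<star> B) Y)"
    using g(2) act_zer[OF W(2,3) T(1) ob] e by simp
qed

section \<open>Adjunctions\<close>

text \<open>An adjunction in the 2-category acts as an adjunction of functors.\<close>

lemma adjunctionE:
  assumes W: "k \<in> W" "l \<in> W" and adj: "is_right_adjoint K k l L R"
  obtains u e where
    "\<And>X. X \<in> Obj (Ct K k) \<Longrightarrow> u X \<in> Mor (Ct K k) X (FOb K R (FOb K L X))"
    "\<And>Y. Y \<in> Obj (Ct K l) \<Longrightarrow> e Y \<in> Mor (Ct K l) (FOb K L (FOb K R Y)) Y"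
    "\<And>X X' f. f \<in> Mor (Ct K k) X X' \<Longrightarrow>
       u X' \<cdot>\<^bsub>Ct K k\<^esub> f = FMo K R (FMo K L f) \<cdot>\<^bsub>Ct K k\<^esub> u X"
    "\<And>Y Y' g. g \<in> Mor (Ct K l) Y Y' \<Longrightarrow>
       e Y' \<cdot>\<^bsub>Ct K l\<^esub> FMo K L (FMo K R g) = g \<cdot>\<^bsub>Ct K l\<^esub> e Y"
    "\<And>X. X \<in> Obj (Ct K k) \<Longrightarrow>
       e (FOb K L X) \<cdot>\<^bsub>Ct K l\<^esub> FMo K L (u X) = Idt (Ct K l) (FOb K L X)"
    "\<And>Y. Y \<in> Obj (Ct K l) \<Longrightarrow>
       FMo K R (e Y) \<cdot>\<^bsub>Ct K k\<^esub> u (FOb K R Y) = Idt (Ct K k) (FOb K R Y)"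
proof -
  interpret C: triangulated_category "Ct K k" using ct_triangulated W(1) .
  interpret D: triangulated_category "Ct K l" using ct_triangulated W(2) .
  have L: "L \<in> Obj (Hm K k l)" and R: "R \<in> Obj (Hm K l k)"
    using adj unfolding is_right_adjoint_def by auto
  obtain \<eta> \<epsilon> where \<eta>: "\<eta> \<in> Mor (Hm K k k) (Id1 K k) (R \<star> L)"
    and \<epsilon>: "\<epsilon> \<in> Mor (Hm K l l) (L \<star> R) (Id1 K l)"
    and t1: "(\<epsilon> \<diamondop> Idt (Hm K k l) L) \<cdot>\<^bsub>Hm K k l\<^esub> (Idt (Hm K k l) L \<diamondop> \<eta>) = Idt (Hm K k l) L"
    and t2: "(Idt (Hm K l k) R \<diamondop> \<epsilon>) \<cdot>\<^bsub>Hm K l k\<^esub> (\<eta> \<diamondop> Idt (Hm K l k) R) = Idt (Hm K l k) R"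
    using adj unfolding is_right_adjoint_def by auto
  have iL: "Idt (Hm K k l) L \<in> Mor (Hm K k l) L L" and iR: "Idt (Hm K l k) R \<in> Mor (Hm K l k) R R"
    using is_category.idt_mor[OF hm_category] W L R by blast+
  have um: "NT K \<eta> X \<in> Mor (Ct K k) X (FOb K R (FOb K L X))" if X: "X \<in> Obj (Ct K k)" for X
    using exact_functor.fun_mor[OF nt_exact[OF W(1,1) X] \<eta>] fun_id1[OF W(1)] X
      cmp_act_obj[OF W W(1) L R X] by simp
  have em: "NT K \<epsilon> Y \<in> Mor (Ct K l) (FOb K L (FOb K R Y)) Y" if Y: "Y \<in> Obj (Ct K l)" for Y
    using exact_functor.fun_mor[OF nt_exact[OF W(2,2) Y] \<epsilon>] fun_id1[OF W(2)] Y
      cmp_act_obj[OF W(2,1,2) R L Y] by simp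
  show thesis
  proof (rule that[of "NT K \<eta>" "NT K \<epsilon>", OF um em])
    fix X X' f assume f: "f \<in> Mor (Ct K k) X X'"
    show "NT K \<eta> X' \<cdot>\<^bsub>Ct K k\<^esub> f = FMo K R (FMo K L f) \<cdot>\<^bsub>Ct K k\<^esub> NT K \<eta> X"
      using nt_natural[OF W(1,1) \<eta> f] fun_id1[OF W(1)] f cmp_act_mor[OF W W(1) L R f] by metis
  next
    fix Y Y' g assume g: "g \<in> Mor (Ct K l) Y Y'"
    show "NT K \<epsilon> Y' \<cdot>\<^bsub>Ct K l\<^esub> FMo K L (FMo K R g) = g \<cdot>\<^bsub>Ct K l\<^esub> NT K \<epsilon> Y"
      using nt_natural[OF W(2,2) \<epsilon> g] fun_id1[OF W(2)] g cmp_act_mor[OF W(2,1,2) R L g] by metis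
  next
    fix X assume X: "X \<in> Obj (Ct K k)"
    interpret E: exact_functor "Hm K k l" "Ct K l" "\<lambda>F. FOb K F X" "\<lambda>\<tau>. NT K \<tau> X"
      using nt_exact[OF W X] .
    have LX: "FOb K L X \<in> Obj (Ct K l)" using act_obj[OF W L X] .
    have LRLX: "FOb K (L \<star> R) (FOb K L X) = FOb K L (FOb K R (FOb K L X))"
      using cmp_act_obj[OF W(2,1,2) R L LX] .
    have a: "NT K (\<epsilon> \<diamondop> Idt (Hm K k l) L) X = NT K \<epsilon> (FOb K L X)"
      using nt_cmp2[OF W W(2) iL \<epsilon> X] E.fun_idt[OF L]
        act_idt[OF W(2,2) cmp1[OF W(2,1,2) R L] LX] LRLX D.cmp_idt_right[OF em[OF LX]] by simp
    have Lu: "FMo K L (NT K \<eta> X) \<in> Mor (Ct K l) (FOb K L X) (FOb K L (FOb K R (FOb K L X)))"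
      using act_mor[OF W L um[OF X]] .
    have b: "NT K (Idt (Hm K k l) L \<diamondop> \<eta>) X = FMo K L (NT K \<eta> X)"
      using nt_cmp2[OF W(1,1,2) \<eta> iL X] exact_functor.fun_idt[OF nt_exact[OF W] L]
        cmp_act_obj[OF W W(1) L R X] D.cmp_idt_left[OF Lu]
        act_obj[OF W(2,1) R LX] by simp
    have m: "Idt (Hm K k l) L \<diamondop> \<eta> \<in> Mor (Hm K k l) (L \<star> Id1 K k) (L \<star> (R \<star> L))"
      "\<epsilon> \<diamondop> Idt (Hm K k l) L \<in> Mor (Hm K k l) ((L \<star> R) \<star> L) (Id1 K l \<star> L)"
      using cmp2[OF W(1,1,2) \<eta> iL] cmp2[OF W(1,2,2) iL \<epsilon>] .
    have "NT K (Idt (Hm K k l) L) X =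
        NT K (\<epsilon> \<diamondop> Idt (Hm K k l) L) X \<cdot>\<^bsub>Ct K l\<^esub> NT K (Idt (Hm K k l) L \<diamondop> \<eta>) X"
      using E.fun_cmp[OF m(1)] m(2) cmp1_assoc[OF W W L R L] t1 by metis
    then show "NT K \<epsilon> (FOb K L X) \<cdot>\<^bsub>Ct K l\<^esub> FMo K L (NT K \<eta> X) = Idt (Ct K l) (FOb K L X)"
      using a b E.fun_idt[OF L] by simp
  next
    fix Y assume Y: "Y \<in> Obj (Ct K l)"
    interpret E: exact_functor "Hm K l k" "Ct K k" "\<lambda>F. FOb K F Y" "\<lambda>\<tau>. NT K \<tau> Y"
      using nt_exact[OF W(2,1) Y] .
    have RY: "FOb K R Y \<in> Obj (Ct K k)" using act_obj[OF W(2,1) R Y] .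
    have Re: "FMo K R (NT K \<epsilon> Y) \<in> Mor (Ct K k) (FOb K R (FOb K L (FOb K R Y))) (FOb K R Y)"
      using act_mor[OF W(2,1) R em[OF Y]] .
    have a: "NT K (\<eta> \<diamondop> Idt (Hm K l k) R) Y = NT K \<eta> (FOb K R Y)"
      using nt_cmp2[OF W(2,1,1) iR \<eta> Y] E.fun_idt[OF R]
        act_idt[OF W(1,1) id1[OF W(1)] RY] fun_id1[OF W(1)] RY C.cmp_idt_right[OF um[OF RY]] by simp
    have b: "NT K (Idt (Hm K l k) R \<diamondop> \<epsilon>) Y = FMo K R (NT K \<epsilon> Y)"
      using nt_cmp2[OF W(2,2,1) \<epsilon> iR Y] E.fun_idt[OF R] fun_id1[OF W(2)] Y
        C.cmp_idt_left[OF Re] by simp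
    have m: "\<eta> \<diamondop> Idt (Hm K l k) R \<in> Mor (Hm K l k) (Id1 K k \<star> R) ((R \<star> L) \<star> R)"
      "Idt (Hm K l k) R \<diamondop> \<epsilon> \<in> Mor (Hm K l k) (R \<star> (L \<star> R)) (R \<star> Id1 K l)"
      using cmp2[OF W(2,1,1) iR \<eta>] cmp2[OF W(2,2,1) \<epsilon> iR] .
    have "NT K (Idt (Hm K l k) R) Y =
        NT K (Idt (Hm K l k) R \<diamondop> \<epsilon>) Y \<cdot>\<^bsub>Ct K k\<^esub> NT K (\<eta> \<diamondop> Idt (Hm K l k) R) Y"
      using E.fun_cmp[OF m(1)] m(2) cmp1_assoc[OF W(2,1,2,1) R L R] t2 by metis
    then show "FMo K R (NT K \<epsilon> Y) \<cdot>\<^bsub>Ct K k\<^esub> NT K \<eta> (FOb K R Y) = Idt (Ct K k) (FOb K R Y)"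
      using a b E.fun_idt[OF R] by simp
  qed
qed

lemma orth1_adjunction:
  assumes W: "j \<in> W" "k \<in> W" "l \<in> W" and adj: "is_right_adjoint K k l L R"
    and A: "A \<in> Obj (Hm K j k)" and B: "B \<in> Obj (Hm K j l)" and o: "orth1 j l (L \<star> A) B"
  shows "orth1 j k A (R \<star> B)"
  unfolding orth1_def no_mor_def
proof (intro ballI)
  interpret C: triangulated_category "Ct K k" using ct_triangulated W(2) .
  interpret D: triangulated_category "Ct K l" using ct_triangulated W(3) .
  have L: "L \<in> Obj (Hm K k l)" and R: "R \<in> Obj (Hm K l k)"
    using adj unfolding is_right_adjoint_def by auto
  obtain u e where
    u: "\<And>X. X \<in> Obj (Ct K k) \<Longrightarrow> u X \<in> Mor (Ct K k) X (FOb K R (FOb K L X))" and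
    e: "\<And>Y. Y \<in> Obj (Ct K l) \<Longrightarrow> e Y \<in> Mor (Ct K l) (FOb K L (FOb K R Y)) Y" and
    nu: "\<And>X X' f. f \<in> Mor (Ct K k) X X' \<Longrightarrow>
       u X' \<cdot>\<^bsub>Ct K k\<^esub> f = FMo K R (FMo K L f) \<cdot>\<^bsub>Ct K k\<^esub> u X" and
    t: "\<And>Y. Y \<in> Obj (Ct K l) \<Longrightarrow>
       FMo K R (e Y) \<cdot>\<^bsub>Ct K k\<^esub> u (FOb K R Y) = Idt (Ct K k) (FOb K R Y)"
    using W(2,3) adj by (rule adjunctionE) blast
  fix X Y f assume X: "X \<in> Obj (Ct K j)" and Y: "Y \<in> Obj (Ct K j)"
    and f: "f \<in> Mor (Ct K k) (FOb K A X) (FOb K (R \<star> B) Y)"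
  let ?A = "FOb K A X" and ?B = "FOb K B Y"
  have ob: "?A \<in> Obj (Ct K k)" "?B \<in> Obj (Ct K l)" using act_obj W A B X Y by blast+
  have f': "f \<in> Mor (Ct K k) ?A (FOb K R ?B)" using f cmp_act_obj[OF W(1,3,2) B R Y] by simp
  have LA: "FOb K L ?A \<in> Obj (Ct K l)" using act_obj[OF W(2,3) L ob(1)] .
  have Lf: "FMo K L f \<in> Mor (Ct K l) (FOb K L ?A) (FOb K L (FOb K R ?B))"
    using act_mor[OF W(2,3) L f'] .
  have RLf: "FMo K R (FMo K L f) \<in> Mor (Ct K k) (FOb K R (FOb K L ?A)) (FOb K R (FOb K L (FOb K R ?B)))"
    using act_mor[OF W(3,2) R Lf] .
  have Re: "FMo K R (e ?B) \<in> Mor (Ct K k) (FOb K R (FOb K L (FOb K R ?B))) (FOb K R ?B)"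
    using act_mor[OF W(3,2) R e[OF ob(2)]] .
  have RB: "FOb K R ?B \<in> Obj (Ct K k)" using act_obj[OF W(3,2) R ob(2)] .
  have "e ?B \<cdot>\<^bsub>Ct K l\<^esub> FMo K L f = Zer (Ct K l) (FOb K L ?A) ?B"
    using o X Y cmp_act_obj[OF W A L X] D.cmp_mor[OF Lf e[OF ob(2)]]
    unfolding orth1_def no_mor_def by metis
  then have z: "FMo K R (e ?B) \<cdot>\<^bsub>Ct K k\<^esub> FMo K R (FMo K L f) =
      Zer (Ct K k) (FOb K R (FOb K L ?A)) (FOb K R ?B)"
    using act_cmp[OF W(3,2) R Lf e[OF ob(2)]] act_zer[OF W(3,2) R LA ob(2)] by simp
  have "f = (FMo K R (e ?B) \<cdot>\<^bsub>Ct K k\<^esub> u (FOb K R ?B)) \<cdot>\<^bsub>Ct K k\<^esub> f"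
    using t[OF ob(2)] C.cmp_idt_left[OF f'] by simp
  also have "\<dots> = FMo K R (e ?B) \<cdot>\<^bsub>Ct K k\<^esub> (FMo K R (FMo K L f) \<cdot>\<^bsub>Ct K k\<^esub> u ?A)"
    using C.cmp_assoc[OF f' u[OF RB] Re] nu[OF f'] by simp
  also have "\<dots> = Zer (Ct K k) (FOb K R (FOb K L ?A)) (FOb K R ?B) \<cdot>\<^bsub>Ct K k\<^esub> u ?A"
    using C.cmp_assoc[OF u[OF ob(1)] RLf Re] z by simp
  also have "\<dots> = Zer (Ct K k) ?A (FOb K R ?B)" using C.cmp_zer_left[OF u[OF ob(1)] RB] .
  finally show "f = Zer (Ct K k) ?A (FOb K (R \<star> B) Y)" using cmp_act_obj[OF W(1,3,2) B R Y] by simp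
qed

text \<open>
  Only an abstract isomorphism \<open>L R G \<cong> G\<close> is given, which need not be the counit.  Composing its inverse with
  the counit gives endomorphisms \<open>c\<close> of the objects \<open>G X\<close>.  The triangle identity at \<open>R G X\<close> exhibits a right
  inverse \<open>s\<close> of \<open>c\<close>; as \<open>G\<close> is full, \<open>s\<close> is the image of an endomorphism of \<open>X\<close>, with which \<open>c\<close> commutes
  by naturality.  So \<open>c\<close> is invertible, and the counit is an isomorphism at \<open>G X\<close>.
\<close>

lemma counit_iso:
  assumes W: "j \<in> W" "k \<in> W" "l \<in> W" and L: "L \<in> Obj (Hm K k l)" and R: "R \<in> Obj (Hm K l k)"
    and G: "G \<in> Obj (Hm K j l)" and full: "full1 j l G" and i: "L \<star> R \<star> G \<simeq>\<^bsub>Hm K j l\<^esub> G"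
    and u: "\<And>X. X \<in> Obj (Ct K k) \<Longrightarrow> u X \<in> Mor (Ct K k) X (FOb K R (FOb K L X))"
    and e: "\<And>Y. Y \<in> Obj (Ct K l) \<Longrightarrow> e Y \<in> Mor (Ct K l) (FOb K L (FOb K R Y)) Y"
    and ne: "\<And>Y Y' g. g \<in> Mor (Ct K l) Y Y' \<Longrightarrow>
       e Y' \<cdot>\<^bsub>Ct K l\<^esub> FMo K L (FMo K R g) = g \<cdot>\<^bsub>Ct K l\<^esub> e Y"
    and t1: "\<And>X. X \<in> Obj (Ct K k) \<Longrightarrow>
       e (FOb K L X) \<cdot>\<^bsub>Ct K l\<^esub> FMo K L (u X) = Idt (Ct K l) (FOb K L X)"
    and X: "X \<in> Obj (Ct K j)"
  shows "\<exists>d \<in> Mor (Ct K l) (FOb K G X) (FOb K L (FOb K R (FOb K G X))).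
           e (FOb K G X) \<cdot>\<^bsub>Ct K l\<^esub> d = Idt (Ct K l) (FOb K G X) \<and>
           d \<cdot>\<^bsub>Ct K l\<^esub> e (FOb K G X) = Idt (Ct K l) (FOb K L (FOb K R (FOb K G X)))"
proof -
  interpret C: triangulated_category "Ct K k" using ct_triangulated W(2) .
  interpret D: triangulated_category "Ct K l" using ct_triangulated W(3) .
  let ?G = "FOb K G X" and ?RG = "FOb K R (FOb K G X)" and ?H = "FOb K L (FOb K R (FOb K G X))"
  note RGo = cmp1[OF W(1,3,2) G R]
  have LRG: "FOb K (L \<star> R \<star> G) X = ?H"
    using cmp_act_obj[OF W RGo L X] cmp_act_obj[OF W(1,3,2) G R X] by simp
  obtain \<theta> \<theta>' where
    th: "\<And>X. X \<in> Obj (Ct K j) \<Longrightarrow> \<theta> X \<in> Mor (Ct K l) (FOb K (L \<star> R \<star> G) X) (FOb K G X)"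
    "\<And>X. X \<in> Obj (Ct K j) \<Longrightarrow> \<theta>' X \<in> Mor (Ct K l) (FOb K G X) (FOb K (L \<star> R \<star> G) X)"
    "\<And>X. X \<in> Obj (Ct K j) \<Longrightarrow> \<theta>' X \<cdot>\<^bsub>Ct K l\<^esub> \<theta> X = Idt (Ct K l) (FOb K (L \<star> R \<star> G) X)"
    "\<And>X. X \<in> Obj (Ct K j) \<Longrightarrow> \<theta> X \<cdot>\<^bsub>Ct K l\<^esub> \<theta>' X = Idt (Ct K l) (FOb K G X)"
    "\<And>X Y f. f \<in> Mor (Ct K j) X Y \<Longrightarrow>
       \<theta> Y \<cdot>\<^bsub>Ct K l\<^esub> FMo K (L \<star> R \<star> G) f = FMo K G f \<cdot>\<^bsub>Ct K l\<^esub> \<theta> X"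
    using W(1,3) i by (rule nat_isoE) blast
  define a where "a = \<theta> X"
  define b where "b = \<theta>' X"
  have ab: "a \<in> Mor (Ct K l) ?H ?G" "b \<in> Mor (Ct K l) ?G ?H"
    "b \<cdot>\<^bsub>Ct K l\<^esub> a = Idt (Ct K l) ?H" "a \<cdot>\<^bsub>Ct K l\<^esub> b = Idt (Ct K l) ?G"
    using th(1-4)[OF X] LRG unfolding a_def b_def by simp_all
  have Go: "?G \<in> Obj (Ct K l)" "?RG \<in> Obj (Ct K k)" "?H \<in> Obj (Ct K l)"
    using act_obj W G R L X by blast+
  define E where "E = e ?G"
  have E: "E \<in> Mor (Ct K l) ?H ?G" unfolding E_def using e[OF Go(1)] .
  define c where "c = E \<cdot>\<^bsub>Ct K l\<^esub> b"
  have c: "c \<in> Mor (Ct K l) ?G ?G" unfolding c_def using D.cmp_mor[OF ab(2) E] .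
  define v where "v = FMo K L (u ?RG)"
  have v: "v \<in> Mor (Ct K l) ?H (FOb K L (FOb K R ?H))"
    unfolding v_def using act_mor[OF W(2,3) L u[OF Go(2)]] .
  define A where "A = FMo K L (FMo K R a)"
  have A: "A \<in> Mor (Ct K l) (FOb K L (FOb K R ?H)) ?H"
    unfolding A_def using act_mor[OF W(2,3) L act_mor[OF W(3,2) R ab(1)]] .
  have EA: "E \<cdot>\<^bsub>Ct K l\<^esub> A = a \<cdot>\<^bsub>Ct K l\<^esub> e ?H" unfolding E_def A_def using ne[OF ab(1)] .
  have ev: "e ?H \<cdot>\<^bsub>Ct K l\<^esub> v = Idt (Ct K l) ?H" unfolding v_def using t1[OF Go(2)] .
  define w where "w = A \<cdot>\<^bsub>Ct K l\<^esub> (v \<cdot>\<^bsub>Ct K l\<^esub> b)"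
  have vb: "v \<cdot>\<^bsub>Ct K l\<^esub> b \<in> Mor (Ct K l) ?G (FOb K L (FOb K R ?H))" using D.cmp_mor[OF ab(2) v] .
  have w: "w \<in> Mor (Ct K l) ?G ?H" unfolding w_def using D.cmp_mor[OF vb A] .
  have "E \<cdot>\<^bsub>Ct K l\<^esub> w = (E \<cdot>\<^bsub>Ct K l\<^esub> A) \<cdot>\<^bsub>Ct K l\<^esub> (v \<cdot>\<^bsub>Ct K l\<^esub> b)"
    unfolding w_def using D.cmp_assoc[OF vb A E] by simp
  also have "\<dots> = (a \<cdot>\<^bsub>Ct K l\<^esub> e ?H) \<cdot>\<^bsub>Ct K l\<^esub> (v \<cdot>\<^bsub>Ct K l\<^esub> b)" unfolding EA ..
  also have "\<dots> = a \<cdot>\<^bsub>Ct K l\<^esub> b" using D.cmp_cancel_mid[OF ab(2) v e[OF Go(3)] ab(1) ev] .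
  finally have Ew: "E \<cdot>\<^bsub>Ct K l\<^esub> w = Idt (Ct K l) ?G" using ab(4) by simp
  define s where "s = a \<cdot>\<^bsub>Ct K l\<^esub> w"
  have s: "s \<in> Mor (Ct K l) ?G ?G" unfolding s_def using D.cmp_mor[OF w ab(1)] .
  have cs: "c \<cdot>\<^bsub>Ct K l\<^esub> s = Idt (Ct K l) ?G"
    unfolding c_def s_def using D.cmp_cancel_mid[OF w ab(1,2) E ab(3)] Ew by simp
  obtain g where g: "g \<in> Mor (Ct K j) X X" "FMo K G g = s"
    using full s X unfolding full1_def full_functor_def by blast
  define Ls where "Ls = FMo K L (FMo K R s)"
  have Ls: "Ls \<in> Mor (Ct K l) ?H ?H"
    unfolding Ls_def using act_mor[OF W(2,3) L act_mor[OF W(3,2) R s]] .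
  have "FMo K (L \<star> R \<star> G) g = Ls"
    unfolding Ls_def using cmp_act_mor[OF W RGo L g(1)] cmp_act_mor[OF W(1,3,2) G R g(1)] g(2) by simp
  then have aL: "a \<cdot>\<^bsub>Ct K l\<^esub> Ls = s \<cdot>\<^bsub>Ct K l\<^esub> a" unfolding a_def using th(5)[OF g(1)] g(2) by simp
  have EL: "E \<cdot>\<^bsub>Ct K l\<^esub> Ls = s \<cdot>\<^bsub>Ct K l\<^esub> E" unfolding E_def Ls_def using ne[OF s] .
  have bs: "b \<cdot>\<^bsub>Ct K l\<^esub> s = Ls \<cdot>\<^bsub>Ct K l\<^esub> b"
  proof -
    have "b \<cdot>\<^bsub>Ct K l\<^esub> s = b \<cdot>\<^bsub>Ct K l\<^esub> ((s \<cdot>\<^bsub>Ct K l\<^esub> a) \<cdot>\<^bsub>Ct K l\<^esub> b)"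
      using D.cmp_assoc[OF ab(2,1) s] ab(4) D.cmp_idt_right[OF s] by simp
    also have "\<dots> = b \<cdot>\<^bsub>Ct K l\<^esub> (a \<cdot>\<^bsub>Ct K l\<^esub> (Ls \<cdot>\<^bsub>Ct K l\<^esub> b))"
      unfolding aL[symmetric] using D.cmp_assoc[OF ab(2) Ls ab(1)] by simp
    also have "\<dots> = Ls \<cdot>\<^bsub>Ct K l\<^esub> b"
      using D.cmp_assoc[OF D.cmp_mor[OF ab(2) Ls] ab(1,2)] ab(3)
        D.cmp_idt_left[OF D.cmp_mor[OF ab(2) Ls]] by simp
    finally show ?thesis .
  qed
  have sc: "s \<cdot>\<^bsub>Ct K l\<^esub> c = Idt (Ct K l) ?G"
  proof -
    have "s \<cdot>\<^bsub>Ct K l\<^esub> c = (s \<cdot>\<^bsub>Ct K l\<^esub> E) \<cdot>\<^bsub>Ct K l\<^esub> b"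
      unfolding c_def using D.cmp_assoc[OF ab(2) E s] by simp
    also have "\<dots> = E \<cdot>\<^bsub>Ct K l\<^esub> (b \<cdot>\<^bsub>Ct K l\<^esub> s)"
      unfolding EL[symmetric] bs using D.cmp_assoc[OF ab(2) Ls E] .
    also have "\<dots> = c \<cdot>\<^bsub>Ct K l\<^esub> s"
      unfolding c_def using D.cmp_assoc[OF s ab(2) E] by simp
    finally show ?thesis using cs by simp
  qed
  define d where "d = b \<cdot>\<^bsub>Ct K l\<^esub> s"
  have d: "d \<in> Mor (Ct K l) ?G ?H" unfolding d_def using D.cmp_mor[OF s ab(2)] .
  have Ed: "E \<cdot>\<^bsub>Ct K l\<^esub> d = Idt (Ct K l) ?G"
    using cs D.cmp_assoc[OF s ab(2) E] unfolding c_def d_def by simp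
  have "(d \<cdot>\<^bsub>Ct K l\<^esub> E) \<cdot>\<^bsub>Ct K l\<^esub> b = Idt (Ct K l) ?H \<cdot>\<^bsub>Ct K l\<^esub> b"
  proof -
    have "(d \<cdot>\<^bsub>Ct K l\<^esub> E) \<cdot>\<^bsub>Ct K l\<^esub> b = d \<cdot>\<^bsub>Ct K l\<^esub> c"
      unfolding c_def using D.cmp_assoc[OF ab(2) E d] .
    also have "\<dots> = b \<cdot>\<^bsub>Ct K l\<^esub> (s \<cdot>\<^bsub>Ct K l\<^esub> c)"
      unfolding d_def using D.cmp_assoc[OF c s ab(2)] .
    finally show ?thesis using sc D.cmp_idt_right[OF ab(2)] D.cmp_idt_left[OF ab(2)] by simp
  qed
  then have "d \<cdot>\<^bsub>Ct K l\<^esub> E = Idt (Ct K l) ?H"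
    using D.cancel_retraction[OF ab(1,2,3) D.cmp_mor[OF E d] D.idt_mor[OF Go(3)]] by blast
  with d Ed show ?thesis unfolding E_def by blast
qed

text \<open>
  With the counit invertible on the objects \<open>G X\<close>, a morphism \<open>f : R G X \<rightarrow> R G Y\<close> is \<open>R\<close> applied to
  the transpose of \<open>f\<close> precomposed with the inverse of the counit, and fullness of \<open>G\<close> takes it to \<open>X \<rightarrow> Y\<close>.
\<close>

lemma full1_adjunction:
  assumes W: "j \<in> W" "k \<in> W" "l \<in> W" and adj: "is_right_adjoint K k l L R"
    and G: "G \<in> Obj (Hm K j l)" and full: "full1 j l G" and i: "L \<star> R \<star> G \<simeq>\<^bsub>Hm K j l\<^esub> G"
  shows "full1 j k (R \<star> G)"
  unfolding full1_def full_functor_def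
proof (intro ballI)
  interpret C: triangulated_category "Ct K k" using ct_triangulated W(2) .
  interpret D: triangulated_category "Ct K l" using ct_triangulated W(3) .
  have L: "L \<in> Obj (Hm K k l)" and R: "R \<in> Obj (Hm K l k)"
    using adj unfolding is_right_adjoint_def by auto
  obtain u e where
    u: "\<And>X. X \<in> Obj (Ct K k) \<Longrightarrow> u X \<in> Mor (Ct K k) X (FOb K R (FOb K L X))" and
    e: "\<And>Y. Y \<in> Obj (Ct K l) \<Longrightarrow> e Y \<in> Mor (Ct K l) (FOb K L (FOb K R Y)) Y" and
    nu: "\<And>X X' f. f \<in> Mor (Ct K k) X X' \<Longrightarrow>
       u X' \<cdot>\<^bsub>Ct K k\<^esub> f = FMo K R (FMo K L f) \<cdot>\<^bsub>Ct K k\<^esub> u X" and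
    ne: "\<And>Y Y' g. g \<in> Mor (Ct K l) Y Y' \<Longrightarrow>
       e Y' \<cdot>\<^bsub>Ct K l\<^esub> FMo K L (FMo K R g) = g \<cdot>\<^bsub>Ct K l\<^esub> e Y" and
    t1: "\<And>X. X \<in> Obj (Ct K k) \<Longrightarrow>
       e (FOb K L X) \<cdot>\<^bsub>Ct K l\<^esub> FMo K L (u X) = Idt (Ct K l) (FOb K L X)" and
    t2: "\<And>Y. Y \<in> Obj (Ct K l) \<Longrightarrow>
       FMo K R (e Y) \<cdot>\<^bsub>Ct K k\<^esub> u (FOb K R Y) = Idt (Ct K k) (FOb K R Y)"
    using W(2,3) adj by (rule adjunctionE) blast
  fix X Y f assume X: "X \<in> Obj (Ct K j)" and Y: "Y \<in> Obj (Ct K j)"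
    and f0: "f \<in> Mor (Ct K k) (FOb K (R \<star> G) X) (FOb K (R \<star> G) Y)"
  let ?X = "FOb K G X" and ?Y = "FOb K G Y"
  let ?RX = "FOb K R ?X" and ?RY = "FOb K R ?Y"
  have ob: "?X \<in> Obj (Ct K l)" "?Y \<in> Obj (Ct K l)" using act_obj[OF W(1,3) G] X Y by blast+
  have Rob: "?RX \<in> Obj (Ct K k)" "?RY \<in> Obj (Ct K k)" using act_obj[OF W(3,2) R] ob by blast+
  have f: "f \<in> Mor (Ct K k) ?RX ?RY"
    using f0 cmp_act_obj[OF W(1,3,2) G R X] cmp_act_obj[OF W(1,3,2) G R Y] by simp
  obtain d where d: "d \<in> Mor (Ct K l) ?X (FOb K L ?RX)" "e ?X \<cdot>\<^bsub>Ct K l\<^esub> d = Idt (Ct K l) ?X"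
    "d \<cdot>\<^bsub>Ct K l\<^esub> e ?X = Idt (Ct K l) (FOb K L ?RX)"
    using counit_iso[OF W L R G full i u e ne t1 X] by blast
  have Rd: "FMo K R d \<in> Mor (Ct K k) ?RX (FOb K R (FOb K L ?RX))" using act_mor[OF W(3,2) R d(1)] .
  have Re: "FMo K R (e ?X) \<in> Mor (Ct K k) (FOb K R (FOb K L ?RX)) ?RX"
    "FMo K R (e ?Y) \<in> Mor (Ct K k) (FOb K R (FOb K L ?RY)) ?RY"
    using act_mor[OF W(3,2) R] e ob by blast+
  \<comment> \<open>The unit at \<open>R (G X)\<close> is a one-sided inverse of the image of the counit, hence equals \<open>R d\<close>.\<close>
  have uX: "u ?RX = FMo K R d"
  proof -
    have "FMo K R d \<cdot>\<^bsub>Ct K k\<^esub> FMo K R (e ?X) = Idt (Ct K k) (FOb K R (FOb K L ?RX))"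
      using act_cmp[OF W(3,2) R e[OF ob(1)] d(1)] d(3) act_idt[OF W(3,2) R] act_obj[OF W(2,3) L Rob(1)]
      by simp
    then show ?thesis
      using C.cmp_assoc[OF u[OF Rob(1)] Re(1) Rd] t2[OF ob(1)] C.cmp_idt_right[OF Rd]
        C.cmp_idt_left[OF u[OF Rob(1)]] by simp
  qed
  define h where "h = e ?Y \<cdot>\<^bsub>Ct K l\<^esub> (FMo K L f \<cdot>\<^bsub>Ct K l\<^esub> d)"
  have Lf: "FMo K L f \<in> Mor (Ct K l) (FOb K L ?RX) (FOb K L ?RY)" using act_mor[OF W(2,3) L f] .
  have RLf: "FMo K R (FMo K L f) \<in> Mor (Ct K k) (FOb K R (FOb K L ?RX)) (FOb K R (FOb K L ?RY))"
    using act_mor[OF W(3,2) R Lf] .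
  have Lfd: "FMo K L f \<cdot>\<^bsub>Ct K l\<^esub> d \<in> Mor (Ct K l) ?X (FOb K L ?RY)" using D.cmp_mor[OF d(1) Lf] .
  have h: "h \<in> Mor (Ct K l) ?X ?Y" unfolding h_def using D.cmp_mor[OF Lfd e[OF ob(2)]] .
  have "FMo K R h = FMo K R (e ?Y) \<cdot>\<^bsub>Ct K k\<^esub> (FMo K R (FMo K L f) \<cdot>\<^bsub>Ct K k\<^esub> u ?RX)"
    unfolding h_def uX using act_cmp[OF W(3,2) R Lfd e[OF ob(2)]] act_cmp[OF W(3,2) R d(1) Lf] by simp
  also have "\<dots> = FMo K R (e ?Y) \<cdot>\<^bsub>Ct K k\<^esub> (u ?RY \<cdot>\<^bsub>Ct K k\<^esub> f)" using nu[OF f] by simp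
  also have "\<dots> = f"
    using C.cmp_assoc[OF f u[OF Rob(2)] Re(2)] t2[OF ob(2)] C.cmp_idt_left[OF f] by simp
  finally have Rh: "FMo K R h = f" .
  obtain g where "g \<in> Mor (Ct K j) X Y" "FMo K G g = h"
    using full X Y h unfolding full1_def full_functor_def by blast
  then show "\<exists>g \<in> Mor (Ct K j) X Y. FMo K (R \<star> G) g = f"
    using Rh cmp_act_mor[OF W(1,3,2) G R] by metis
qed

definition coreflective1 where
  "coreflective1 k l A \<longleftrightarrow> has_coreflections (Ct K k) (Ct K l) (FOb K A) (FMo K A)"

lemma coreflective1_Id1:
  assumes k: "k \<in> W"
  shows "coreflective1 k k (Id1 K k)"
  unfolding coreflective1_def has_coreflections_def
proof
  interpret C: triangulated_category "Ct K k" using ct_triangulated k .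
  fix Y assume Y: "Y \<in> Obj (Ct K k)"
  note I = fun_id1[OF k]
  have "\<exists>!g. g \<in> Mor (Ct K k) X Y \<and> Idt (Ct K k) Y \<cdot>\<^bsub>Ct K k\<^esub> FMo K (Id1 K k) g = f"
    if "X \<in> Obj (Ct K k)" "f \<in> Mor (Ct K k) (FOb K (Id1 K k) X) Y" for X f
  proof -
    have "f \<in> Mor (Ct K k) X Y" using that I by simp
    then show ?thesis using I C.cmp_idt_left by (intro ex1I[of _ f]) auto
  qed
  moreover have "Idt (Ct K k) Y \<in> Mor (Ct K k) (FOb K (Id1 K k) Y) Y" using C.idt_mor Y I by simp
  ultimately show "\<exists>A \<in> Obj (Ct K k). \<exists>u \<in> Mor (Ct K k) (FOb K (Id1 K k) A) Y.
      \<forall>X \<in> Obj (Ct K k). \<forall>f \<in> Mor (Ct K k) (FOb K (Id1 K k) X) Y.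
        \<exists>!g. g \<in> Mor (Ct K k) X A \<and> u \<cdot>\<^bsub>Ct K k\<^esub> FMo K (Id1 K k) g = f"
    using Y by blast
qed

lemma coreflective1_adjoint:
  assumes W: "k \<in> W" "l \<in> W" and adj: "is_right_adjoint K k l L R"
  shows "coreflective1 k l L"
  unfolding coreflective1_def has_coreflections_def
proof
  interpret C: triangulated_category "Ct K k" using ct_triangulated W(1) .
  interpret D: triangulated_category "Ct K l" using ct_triangulated W(2) .
  have L: "L \<in> Obj (Hm K k l)" and R: "R \<in> Obj (Hm K l k)"
    using adj unfolding is_right_adjoint_def by auto
  obtain u e where
    u: "\<And>X. X \<in> Obj (Ct K k) \<Longrightarrow> u X \<in> Mor (Ct K k) X (FOb K R (FOb K L X))" and
    e: "\<And>Y. Y \<in> Obj (Ct K l) \<Longrightarrow> e Y \<in> Mor (Ct K l) (FOb K L (FOb K R Y)) Y" and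
    nu: "\<And>X X' f. f \<in> Mor (Ct K k) X X' \<Longrightarrow>
       u X' \<cdot>\<^bsub>Ct K k\<^esub> f = FMo K R (FMo K L f) \<cdot>\<^bsub>Ct K k\<^esub> u X" and
    ne: "\<And>Y Y' g. g \<in> Mor (Ct K l) Y Y' \<Longrightarrow>
       e Y' \<cdot>\<^bsub>Ct K l\<^esub> FMo K L (FMo K R g) = g \<cdot>\<^bsub>Ct K l\<^esub> e Y" and
    t1: "\<And>X. X \<in> Obj (Ct K k) \<Longrightarrow>
       e (FOb K L X) \<cdot>\<^bsub>Ct K l\<^esub> FMo K L (u X) = Idt (Ct K l) (FOb K L X)" and
    t2: "\<And>Y. Y \<in> Obj (Ct K l) \<Longrightarrow>
       FMo K R (e Y) \<cdot>\<^bsub>Ct K k\<^esub> u (FOb K R Y) = Idt (Ct K k) (FOb K R Y)"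
    using W adj by (rule adjunctionE) blast
  fix Y assume Y: "Y \<in> Obj (Ct K l)"
  let ?R = "FOb K R Y"
  have Ro: "?R \<in> Obj (Ct K k)" using act_obj[OF W(2,1) R Y] .
  have Re: "FMo K R (e Y) \<in> Mor (Ct K k) (FOb K R (FOb K L ?R)) ?R"
    using act_mor[OF W(2,1) R e[OF Y]] .
  have "\<exists>!g. g \<in> Mor (Ct K k) X ?R \<and> e Y \<cdot>\<^bsub>Ct K l\<^esub> FMo K L g = f"
    if X: "X \<in> Obj (Ct K k)" and f: "f \<in> Mor (Ct K l) (FOb K L X) Y" for X f
  proof (rule ex1I[of _ "FMo K R f \<cdot>\<^bsub>Ct K k\<^esub> u X"])
    have Rf: "FMo K R f \<in> Mor (Ct K k) (FOb K R (FOb K L X)) ?R" using act_mor[OF W(2,1) R f] .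
    have LRf: "FMo K L (FMo K R f) \<in> Mor (Ct K l) (FOb K L (FOb K R (FOb K L X))) (FOb K L ?R)"
      using act_mor[OF W L Rf] .
    have LX: "FOb K L X \<in> Obj (Ct K l)" using act_obj[OF W L X] .
    have Lu: "FMo K L (u X) \<in> Mor (Ct K l) (FOb K L X) (FOb K L (FOb K R (FOb K L X)))"
      using act_mor[OF W L u[OF X]] .
    have "e Y \<cdot>\<^bsub>Ct K l\<^esub> FMo K L (FMo K R f \<cdot>\<^bsub>Ct K k\<^esub> u X) =
        (e Y \<cdot>\<^bsub>Ct K l\<^esub> FMo K L (FMo K R f)) \<cdot>\<^bsub>Ct K l\<^esub> FMo K L (u X)"
      using act_cmp[OF W L u[OF X] Rf] D.cmp_assoc[OF Lu LRf e[OF Y]] by simp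
    also have "\<dots> = f \<cdot>\<^bsub>Ct K l\<^esub> (e (FOb K L X) \<cdot>\<^bsub>Ct K l\<^esub> FMo K L (u X))"
      unfolding ne[OF f] using D.cmp_assoc[OF Lu e[OF LX] f] .
    also have "\<dots> = f" using t1[OF X] D.cmp_idt_right[OF f] by simp
    finally show "FMo K R f \<cdot>\<^bsub>Ct K k\<^esub> u X \<in> Mor (Ct K k) X ?R \<and>
        e Y \<cdot>\<^bsub>Ct K l\<^esub> FMo K L (FMo K R f \<cdot>\<^bsub>Ct K k\<^esub> u X) = f"
      using C.cmp_mor[OF u[OF X] Rf] by blast
    fix g assume g: "g \<in> Mor (Ct K k) X ?R \<and> e Y \<cdot>\<^bsub>Ct K l\<^esub> FMo K L g = f"
    then have g1: "g \<in> Mor (Ct K k) X ?R" and g2: "f = e Y \<cdot>\<^bsub>Ct K l\<^esub> FMo K L g" by auto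
    have Lg: "FMo K L g \<in> Mor (Ct K l) (FOb K L X) (FOb K L ?R)" using act_mor[OF W L g1] .
    have "FMo K R f \<cdot>\<^bsub>Ct K k\<^esub> u X =
        FMo K R (e Y) \<cdot>\<^bsub>Ct K k\<^esub> (FMo K R (FMo K L g) \<cdot>\<^bsub>Ct K k\<^esub> u X)"
      unfolding g2 act_cmp[OF W(2,1) R Lg e[OF Y]]
      using C.cmp_assoc[OF u[OF X] act_mor[OF W(2,1) R Lg] Re] .
    also have "\<dots> = (FMo K R (e Y) \<cdot>\<^bsub>Ct K k\<^esub> u ?R) \<cdot>\<^bsub>Ct K k\<^esub> g"
      unfolding nu[OF g1, symmetric] using C.cmp_assoc[OF g1 u[OF Ro] Re] by simp
    also have "\<dots> = g" using t2[OF Y] C.cmp_idt_left[OF g1] by simp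
    finally show "g = FMo K R f \<cdot>\<^bsub>Ct K k\<^esub> u X" by simp
  qed
  then show "\<exists>A \<in> Obj (Ct K k). \<exists>u \<in> Mor (Ct K l) (FOb K L A) Y.
      \<forall>X \<in> Obj (Ct K k). \<forall>f \<in> Mor (Ct K l) (FOb K L X) Y.
        \<exists>!g. g \<in> Mor (Ct K k) X A \<and> u \<cdot>\<^bsub>Ct K l\<^esub> FMo K L g = f"
    using Ro e[OF Y] by blast
qed

lemma coreflective1_cmp:
  assumes W: "k \<in> W" "l \<in> W" "m \<in> W" and A: "A \<in> Obj (Hm K k l)" and B: "B \<in> Obj (Hm K l m)"
    and core: "coreflective1 k l A" "coreflective1 l m B"
  shows "coreflective1 k m (B \<star> A)"
  unfolding coreflective1_def has_coreflections_def
proof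
  interpret D: triangulated_category "Ct K l" using ct_triangulated W(2) .
  interpret M: triangulated_category "Ct K m" using ct_triangulated W(3) .
  fix Y assume Y: "Y \<in> Obj (Ct K m)"
  note o = cmp_act_obj[OF W A B]
  obtain Q v where Q: "Q \<in> Obj (Ct K l)" and v: "v \<in> Mor (Ct K m) (FOb K B Q) Y"
    and v_univ: "\<And>X f. X \<in> Obj (Ct K l) \<Longrightarrow> f \<in> Mor (Ct K m) (FOb K B X) Y \<Longrightarrow>
      \<exists>!g. g \<in> Mor (Ct K l) X Q \<and> v \<cdot>\<^bsub>Ct K m\<^esub> FMo K B g = f"
    using core(2) Y unfolding coreflective1_def has_coreflections_def by meson
  obtain P w where P: "P \<in> Obj (Ct K k)" and w: "w \<in> Mor (Ct K l) (FOb K A P) Q"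
    and w_univ: "\<And>X f. X \<in> Obj (Ct K k) \<Longrightarrow> f \<in> Mor (Ct K l) (FOb K A X) Q \<Longrightarrow>
      \<exists>!g. g \<in> Mor (Ct K k) X P \<and> w \<cdot>\<^bsub>Ct K l\<^esub> FMo K A g = f"
    using core(1) Q unfolding coreflective1_def has_coreflections_def by meson
  have Bw: "FMo K B w \<in> Mor (Ct K m) (FOb K B (FOb K A P)) (FOb K B Q)"
    using act_mor[OF W(2,3) B w] .
  define z where "z = v \<cdot>\<^bsub>Ct K m\<^esub> FMo K B w"
  have z: "z \<in> Mor (Ct K m) (FOb K (B \<star> A) P) Y"
    unfolding z_def o[OF P] using M.cmp_mor[OF Bw v] .
  have zg: "z \<cdot>\<^bsub>Ct K m\<^esub> FMo K (B \<star> A) g = v \<cdot>\<^bsub>Ct K m\<^esub> FMo K B (w \<cdot>\<^bsub>Ct K l\<^esub> FMo K A g)"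
    if g: "g \<in> Mor (Ct K k) X P" for X g
    unfolding z_def cmp_act_mor[OF W A B g] act_cmp[OF W(2,3) B act_mor[OF W(1,2) A g] w]
    using M.cmp_assoc[OF act_mor[OF W(2,3) B act_mor[OF W(1,2) A g]] Bw v] .
  have "\<exists>!g. g \<in> Mor (Ct K k) X P \<and> z \<cdot>\<^bsub>Ct K m\<^esub> FMo K (B \<star> A) g = f"
    if X: "X \<in> Obj (Ct K k)" and f: "f \<in> Mor (Ct K m) (FOb K (B \<star> A) X) Y" for X f
  proof -
    have AX: "FOb K A X \<in> Obj (Ct K l)" using act_obj[OF W(1,2) A X] .
    have f': "f \<in> Mor (Ct K m) (FOb K B (FOb K A X)) Y" using f o[OF X] by simp
    obtain h where h: "h \<in> Mor (Ct K l) (FOb K A X) Q" "v \<cdot>\<^bsub>Ct K m\<^esub> FMo K B h = f"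
      using v_univ[OF AX f'] by blast
    obtain g where g: "g \<in> Mor (Ct K k) X P" "w \<cdot>\<^bsub>Ct K l\<^esub> FMo K A g = h"
      using w_univ[OF X h(1)] by blast
    show ?thesis
    proof (rule ex1I[of _ g])
      show "g \<in> Mor (Ct K k) X P \<and> z \<cdot>\<^bsub>Ct K m\<^esub> FMo K (B \<star> A) g = f" using g h zg by simp
      fix g' assume g': "g' \<in> Mor (Ct K k) X P \<and> z \<cdot>\<^bsub>Ct K m\<^esub> FMo K (B \<star> A) g' = f"
      have "w \<cdot>\<^bsub>Ct K l\<^esub> FMo K A g' \<in> Mor (Ct K l) (FOb K A X) Q"
        using D.cmp_mor act_mor[OF W(1,2) A] g' w by blast
      then have "w \<cdot>\<^bsub>Ct K l\<^esub> FMo K A g' = h" using v_univ[OF AX f'] h g' zg by metis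
      then show "g' = g" using w_univ[OF X h(1)] g g' by blast
    qed
  qed
  then show "\<exists>A' \<in> Obj (Ct K k). \<exists>u \<in> Mor (Ct K m) (FOb K (B \<star> A) A') Y.
      \<forall>X \<in> Obj (Ct K k). \<forall>f \<in> Mor (Ct K m) (FOb K (B \<star> A) X) Y.
        \<exists>!g. g \<in> Mor (Ct K k) X A' \<and> u \<cdot>\<^bsub>Ct K m\<^esub> FMo K (B \<star> A) g = f"
    using P z by blast
qed

end

section \<open>Weights\<close>

lemma alpha_simps [simp]: "alpha i i = - 1" "alpha i (Suc i) = 1"
  by (simp_all add: alpha_def)

lemma alpha_Zn: "i \<in> {1..n - 1} \<Longrightarrow> alpha i \<in> Zn n"
  unfolding Zn_def alpha_def by auto

lemma Zn_plus: "k \<in> Zn n \<Longrightarrow> l \<in> Zn n \<Longrightarrow> k + l \<in> Zn n"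
  unfolding Zn_def by simp

lemma Zn_minus: "k \<in> Zn n \<Longrightarrow> l \<in> Zn n \<Longrightarrow> k - l \<in> Zn n"
  unfolding Zn_def by simp

lemma Cwt_Zn: "k \<in> Cwt n N \<Longrightarrow> k \<in> Zn n"
  unfolding Cwt_def by blast

lemma Cwt_nonneg: "k \<in> Cwt n N \<Longrightarrow> 0 \<le> k j"
  unfolding Cwt_def Zn_def by (cases "j \<in> {1..n}") auto

lemma Cwt_minus_alpha:
  assumes i: "i \<in> {1..n - 1}" and m: "m \<in> Cwt n N" and pos: "0 < m (Suc i)"
  shows "m - alpha i \<in> Cwt n N"
proof -
  have "(\<Sum>j = 1..n. alpha i j) = (\<Sum>j \<in> {i, Suc i}. alpha i j)"
    by (rule sum.mono_neutral_right) (use i in \<open>auto simp: alpha_def\<close>)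
  also have "\<dots> = 0" by simp
  finally have s: "(\<Sum>j = 1..n. alpha i j) = 0" .
  have "0 \<le> (m - alpha i) j" for j
    using Cwt_nonneg[OF m, of j] Cwt_nonneg[OF m, of i] pos by (simp add: alpha_def)
  then show ?thesis
    using Zn_minus[OF Cwt_Zn[OF m] alpha_Zn[OF i]] m s unfolding Cwt_def by (simp add: sum_subtractf)
qed

section \<open>Commuting \<open>F\<close> with powers of \<open>\<Psi>\<close>\<close>

context partial_categorical_action
begin

text \<open>The powers \<open>(\<Psi>\<^sub>i\<^sup>+)\<^sup>-\<^sup>c\<close>, which raise the second index of \<open>F\<^sub>i\<close> by \<open>c\<close> when moved across it.\<close>

abbreviation Qpow :: "nat \<Rightarrow> nat \<Rightarrow> weight \<Rightarrow> 'f" where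
  "Qpow i c k \<equiv> PsiPow K Plus i (- int c) k"

lemma Qpow_0: "Qpow i 0 k = Id1 K k"
  by (simp add: PsiPow_def)

lemma Qpow_Suc: "Qpow i (Suc c) k = PsiInv K Plus i k \<star> Qpow i c k"
proof -
  have "nat (int c + 1) = Suc c" by simp
  then show ?thesis by (cases "c = 0") (simp_all add: PsiPow_def)
qed

lemma Psi_invertible:
  assumes "i \<in> {1..n - 1}" "k \<in> Zn n"
  shows "invertible1 k (Psi K e i k)" "invertible1 k (PsiInv K e i k)"
  unfolding invertible1_def using Psi_obj[OF assms] Psi_inverse[OF assms] by blast+

lemma Qpow_invertible:
  assumes "i \<in> {1..n - 1}" "k \<in> Zn n"
  shows "invertible1 k (Qpow i c k)"
proof (induction c)
  case 0
  then show ?case using invertible1_Id1 assms Qpow_0 by simp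
next
  case (Suc c)
  then show ?case unfolding Qpow_Suc using invertible1_cmp Psi_invertible assms by blast
qed

lemma Qpow_obj:
  assumes "i \<in> {1..n - 1}" "k \<in> Zn n"
  shows "Qpow i c k \<in> Obj (Hm K k k)"
  using Qpow_invertible[OF assms] unfolding invertible1_def by blast

lemma Zn_alpha:
  assumes "i \<in> {1..n - 1}" "k \<in> Zn n"
  shows "k - alpha i \<in> Zn n" "k + alpha i \<in> Zn n"
  using assms alpha_Zn Zn_minus Zn_plus by blast+

lemma PsiInv_F:
  assumes i: "i \<in> {1..n - 1}" and m: "m \<in> Zn n" and r: "F_range i s m" "F_range i (s + 1) m"
  shows "sim m (m - alpha i) (PsiInv K Plus i (m - alpha i) \<star> Ff K i s m)
           (Ff K i (s + 1) m \<star> PsiInv K Plus i m)"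
proof -
  note k = Zn_alpha(1)[OF i m]
  have F: "Ff K i s m \<in> Obj (Hm K m (m - alpha i))" "Ff K i (s + 1) m \<in> Obj (Hm K m (m - alpha i))"
    using F_obj[OF i m] r by blast+
  have "sim m (m - alpha i) (Psi K Plus i (m - alpha i) \<star> Ff K i (s + 1) m) (Ff K i s m \<star> Psi K Plus i m)"
    using sim_shift[OF m k] Psi_F[OF i m r(2), of Plus] r(1)
      cmp1[OF m m k _ F(1)] Psi_obj[OF i m] by simp
  then show ?thesis
    using sim_conjugate[OF m k _ _ _ _ _ _ F(2,1)] Psi_obj[OF i m] Psi_obj[OF i k]
      Psi_inverse[OF i m] Psi_inverse[OF i k] by blast
qed

lemma Qpow_F:
  assumes i: "i \<in> {1..n - 1}" and m: "m \<in> Zn n" and s: "0 \<le> s" "s + int c \<le> m (i + 1) + 1"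
  shows "sim m (m - alpha i) (Qpow i c (m - alpha i) \<star> Ff K i s m) (Ff K i (s + int c) m \<star> Qpow i c m)"
  using s(2)
proof (induction c)
  case 0
  have F: "Ff K i s m \<in> Obj (Hm K m (m - alpha i))" using F_obj[OF i m] s 0 by (simp add: F_range_def)
  note k = Zn_alpha(1)[OF i m]
  show ?case
    unfolding Qpow_0 unfolding of_nat_0 add_0_right
    using sim_refl[OF m k F] cmp1_id[OF m k F] by metis
next
  case (Suc c)
  let ?k = "m - alpha i"
  let ?F = "Ff K i s m" and ?F' = "Ff K i (s + int c) m" and ?F'' = "Ff K i (s + int c + 1) m"
  let ?q = "PsiInv K Plus i ?k" and ?q' = "PsiInv K Plus i m"
  note k = Zn_alpha(1)[OF i m]
  have r: "F_range i s m" "F_range i (s + int c) m" "F_range i (s + int c + 1) m"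
    using s(1) Suc.prems by (auto simp: F_range_def)
  have F: "?F \<in> Obj (Hm K m ?k)" "?F' \<in> Obj (Hm K m ?k)" "?F'' \<in> Obj (Hm K m ?k)"
    using F_obj[OF i m] r by blast+
  have q: "?q \<in> Obj (Hm K ?k ?k)" "?q' \<in> Obj (Hm K m m)" using Psi_obj i m k by blast+
  note Q = Qpow_obj[OF i k, of c] and Q' = Qpow_obj[OF i m, of c]
  have "sim m ?k (?q \<star> (Qpow i c ?k \<star> ?F)) (?q \<star> (?F' \<star> Qpow i c m))"
    using sim_post[OF m k k q(1) Suc.IH] Suc.prems by linarith
  moreover have "sim m ?k (?q \<star> ?F' \<star> Qpow i c m) (?F'' \<star> ?q' \<star> Qpow i c m)"
    using sim_head[OF m m k k m Q' q(1) F(2) F(3) q(2) PsiInv_F[OF i m r(2,3)]] .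
  ultimately have "sim m ?k (?q \<star> Qpow i c ?k \<star> ?F) (?F'' \<star> ?q' \<star> Qpow i c m)"
    using sim_trans[OF m k] by blast
  moreover have "s + int (Suc c) = s + int c + 1" by simp
  ultimately show ?case
    unfolding Qpow_Suc using cmp1_assoc[OF m k k k F(1) Q q(1)] by metis
qed

section \<open>The left adjoint of the first factor of a word\<close>

lemma zero_of_target:
  assumes "j \<in> Zn n" "l \<in> Zn n" "l \<notin> Cwt n N" "A \<in> Obj (Hm K j l)"
  shows "zero_object (Hm K j l) A"
  using zero_pre[OF assms(1,2,2,4) weight_zero[OF assms(2,3)]] cmp1_id[OF assms(1,2,4)] by simp

lemma E_top_obj:
  assumes "i \<in> {1..n - 1}" "m \<in> Zn n" "0 \<le> m i"
  shows "Ef K i (- 1) m \<in> Obj (Hm K m (m + alpha i))"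
  using E_obj[OF assms(1,2)] assms(3) by (simp add: E_range_def)

lemma E_below_obj:
  assumes "i \<in> {1..n - 1}" "m \<in> Zn n" "0 \<le> m i"
  shows "Ef K i (- 1) (m - alpha i) \<in> Obj (Hm K (m - alpha i) m)"
  using E_top_obj[OF assms(1) Zn_alpha(1)[OF assms(1,2)]] assms(3) by simp

text \<open>
  Moving \<open>(\<Psi>\<^sub>i\<^sup>+)\<^sup>-\<^sup>c\<close> across \<open>F\<^sub>i\<close> turns the index \<open>t\<close> into \<open>t + c\<close>.  With the index \<open>-1\<close> of \<open>E\<^sub>i\<close>, the bounds on
  \<open>t + c\<close> put the sum of the indices into the range in which \<open>E\<^sub>i\<close> and \<open>F\<^sub>i\<close> commute; the lower bound \<open>2\<close> suffices
  for every \<open>m\<^sub>i \<ge> 0\<close>.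
\<close>

lemma E_Psi_F_zero:
  assumes i: "i \<in> {1..n - 1}" and j: "j \<in> Zn n" and m: "m \<in> Zn n" "0 \<le> m i"
    and A: "A \<in> Obj (Hm K j m)" and t: "0 \<le> t" "2 \<le> t + int c" "t + int c \<le> m (i + 1)"
    and z: "zero_object (Hm K j (m + alpha i)) (Ef K i (- 1) m \<star> Qpow i c m \<star> A)"
  shows "zero_object (Hm K j m) (Ef K i (- 1) (m - alpha i) \<star> Qpow i c (m - alpha i) \<star> Ff K i t m \<star> A)"
proof -
  let ?k = "m - alpha i" and ?l = "m + alpha i"
  let ?F = "Ff K i t m" and ?F' = "Ff K i (t + int c) m" and ?F'' = "Ff K i (t + int c) ?l"
  let ?E = "Ef K i (- 1) m" and ?E' = "Ef K i (- 1) ?k"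
  note k = Zn_alpha(1)[OF i m(1)] and l = Zn_alpha(2)[OF i m(1)]
  have r: "F_range i t m" "F_range i (t + int c) m" "F_range i (t + int c) ?l"
    using t by (auto simp: F_range_def)
  have F: "?F \<in> Obj (Hm K m ?k)" "?F' \<in> Obj (Hm K m ?k)" "?F'' \<in> Obj (Hm K ?l m)"
    using F_obj[OF i m(1)] F_obj[OF i l] r by (auto simp: algebra_simps)
  note E = E_top_obj[OF i m] and E' = E_below_obj[OF i m]
  note Q = Qpow_obj[OF i k, of c] and Q' = Qpow_obj[OF i m(1), of c]
  have "?F'' \<star> ?E \<simeq>\<^bsub>Hm K m m\<^esub> ?E' \<star> ?F'"
    using EF_commute[OF i m(1), of "- 1" "t + int c"] t m(2)
    by (simp add: EF_range_def E_range_def F_range_def)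
  then have s: "sim m m (?F'' \<star> ?E) (?E' \<star> ?F')" by (rule sim_iso[OF m(1) m(1)])
  have "zero_object (Hm K j m) (?F'' \<star> ?E \<star> Qpow i c m \<star> A)" using zero_post[OF j l m(1) F(3) z] .
  moreover have "sim j m (?F'' \<star> ?E \<star> Qpow i c m \<star> A) (?E' \<star> ?F' \<star> Qpow i c m \<star> A)"
    using sim_head[OF j m(1) m(1) l k cmp1[OF j m(1) m(1) A Q'] F(3) E E' F(2) s] .
  moreover have "sim j m (?E' \<star> ?F' \<star> Qpow i c m \<star> A) (?E' \<star> Qpow i c ?k \<star> ?F \<star> A)"
    using sim_post[OF j k m(1) E' sim_head[OF j m(1) k m(1) k A F(2) Q' Q F(1)]]
      sim_sym[OF m(1) k Qpow_F[OF i m(1)]] t by simp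
  ultimately show ?thesis using sim_zero[OF j m(1)] sim_trans[OF j m(1)] by blast
qed

text \<open>
  The case \<open>r = -1\<close> of the formula for the right adjoint of \<open>E\<^sub>i\<^sub>,\<^sub>r\<close> has no shift and the power \<open>0\<close> of \<open>\<Psi>\<close> on
  the left.  The index of \<open>F\<^sub>i\<close> in it is called critical below.
\<close>

lemma E_adjoint:
  assumes i: "i \<in> {1..n - 1}" and m: "m \<in> Zn n" "0 \<le> m i" "0 \<le> m (i + 1)"
  obtains R where "is_right_adjoint K (m - alpha i) m (Ef K i (- 1) (m - alpha i)) R"
    "R \<simeq>\<^bsub>Hm K m (m - alpha i)\<^esub> Ff K i (m (i + 1) + 1) m \<star> PsiInv K Plus i m"
proof -
  let ?k = "m - alpha i" and ?F = "Ff K i (m (i + 1) + 1) m" and ?q = "PsiInv K Plus i m"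
  note k = Zn_alpha(1)[OF i m(1)]
  interpret H: triangulated_category "Hm K m ?k" using hm_tri[OF m(1) k] .
  have F: "?F \<in> Obj (Hm K m ?k)" using F_obj[OF i m(1)] m by (simp add: F_range_def)
  have q: "?q \<in> Obj (Hm K m m)" using Psi_obj[OF i m(1)] by blast
  have Fq: "?F \<star> ?q \<in> Obj (Hm K m ?k)" using cmp1[OF m(1) m(1) k q F] .
  have Q1: "PsiPow K Plus i (- 1) m = ?q"
    using Qpow_Suc[of i 0 m] Qpow_0 cmp1_id[OF m(1) m(1) q] by simp
  have Q0: "PsiPow K Plus i 0 ?k = Id1 K ?k" by (simp add: PsiPow_def)
  obtain R where R: "is_right_adjoint K ?k (?k + alpha i) (Ef K i (- 1) ?k) R"
    "R \<simeq>\<^bsub>Hm K (?k + alpha i) ?k\<^esub> Sh (Hm K (?k + alpha i) ?k) (- (- 1) - 1)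
       (PsiPow K Plus i (- 1 + 1) ?k \<star> Ff K i (?k (i + 1) + 2) (?k + alpha i)
          \<star> PsiPow K Plus i (- (- 1) - 2) (?k + alpha i))"
    using E_right_adjoint[OF i k, of "- 1"] m by (auto simp: E_range_def F_range_def)
  have c: "?k + alpha i = m" "?k (i + 1) + 2 = m (i + 1) + 1" by simp_all
  have "R \<simeq>\<^bsub>Hm K m ?k\<^esub> ?F \<star> ?q"
    using R(2) H.sh_zero[OF Fq] cmp1_id[OF m(1) k Fq] unfolding c by (simp add: Q0 Q1)
  then show thesis using that R(1) unfolding c by blast
qed

text \<open>
  At the critical index the sum of the indices is \<open>m\<^sub>i\<^sub>+\<^sub>1\<close>, where the triangle \<open>F E \<rightarrow> E F \<rightarrow> \<Psi>\<^sup>+\<close> replaces the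
  commutation; its first term vanishes on \<open>X\<close>.
\<close>

lemma EF_critical:
  assumes i: "i \<in> {1..n - 1}" and j: "j \<in> Zn n" and m: "m \<in> Cwt n N" "0 < m (i + 1)"
    and X: "X \<in> Obj (Hm K j m)" and z: "zero_object (Hm K j (m + alpha i)) (Ef K i (- 1) m \<star> X)"
  shows "Ef K i (- 1) (m - alpha i) \<star> Ff K i (m (i + 1) + 1) m \<star> X \<simeq>\<^bsub>Hm K j m\<^esub> Psi K Plus i m \<star> X"
proof -
  let ?k = "m - alpha i" and ?l = "m + alpha i" and ?s = "m (i + 1) + 1"
  have mZ: "m \<in> Zn n" "0 \<le> m i" using Cwt_Zn Cwt_nonneg m by blast+
  note k = Zn_alpha(1)[OF i mZ(1)] and l = Zn_alpha(2)[OF i mZ(1)]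
  note E = E_top_obj[OF i mZ] and E' = E_below_obj[OF i mZ]
  have F: "Ff K i ?s m \<in> Obj (Hm K m ?k)" "Ff K i ?s ?l \<in> Obj (Hm K ?l m)"
    using F_obj[OF i mZ(1), of ?s] F_obj[OF i l, of ?s] m by (auto simp: F_range_def)
  interpret H: triangulated_category "Hm K j m" using hm_tri[OF j mZ(1)] .
  have "?k \<in> Cwt n N" using Cwt_minus_alpha i m by simp
  then obtain f g h where "Tri (Hm K m m) (Ff K i ?s ?l \<star> Ef K i (- 1) m)
      (Ef K i (- 1) ?k \<star> Ff K i ?s m) (Psi K Plus i m) f g h"
    using triangle_plus[OF i mZ(1), of "- 1" ?s] mZ m
    by (auto simp: EF_range_def E_range_def F_range_def)
  then obtain f g h where "Tri (Hm K j m) ((Ff K i ?s ?l \<star> Ef K i (- 1) m) \<star> X)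
      ((Ef K i (- 1) ?k \<star> Ff K i ?s m) \<star> X) (Psi K Plus i m \<star> X) f g h"
    using triangulated_functor.map_tri[OF pre_functor[OF j mZ(1) mZ(1) X]] by blast
  moreover have "zero_object (Hm K j m) ((Ff K i ?s ?l \<star> Ef K i (- 1) m) \<star> X)"
    using zero_post[OF j l mZ(1) F(2) z] cmp1_assoc[OF j mZ(1) l mZ(1) X E F(2)] by simp
  ultimately show ?thesis
    using H.tri_zero_iso cmp1_assoc[OF j mZ(1) k mZ(1) X F(1) E'] by metis
qed

lemma E_Psi_F_critical:
  assumes i: "i \<in> {1..n - 1}" and j: "j \<in> Zn n" and m: "m \<in> Cwt n N"
    and A: "A \<in> Obj (Hm K j m)" and s: "0 \<le> s" "s < m (i + 1)" and c: "s + int c = m (i + 1) + 1"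
    and z: "zero_object (Hm K j (m + alpha i)) (Ef K i (- 1) m \<star> Qpow i c m \<star> A)"
  shows "sim j m (Ef K i (- 1) (m - alpha i) \<star> Qpow i c (m - alpha i) \<star> Ff K i s m \<star> A)
           (Psi K Plus i m \<star> Qpow i c m \<star> A)"
proof -
  let ?k = "m - alpha i"
  have mZ: "m \<in> Zn n" "0 \<le> m i" using Cwt_Zn Cwt_nonneg m by blast+
  note k = Zn_alpha(1)[OF i mZ(1)]
  have F: "Ff K i s m \<in> Obj (Hm K m ?k)" "Ff K i (m (i + 1) + 1) m \<in> Obj (Hm K m ?k)"
    using F_obj[OF i mZ(1)] s by (auto simp: F_range_def)
  note E' = E_below_obj[OF i mZ]
  note Q = Qpow_obj[OF i k, of c] and Q' = Qpow_obj[OF i mZ(1), of c]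
  have "sim m ?k (Qpow i c ?k \<star> Ff K i s m) (Ff K i (m (i + 1) + 1) m \<star> Qpow i c m)"
    using Qpow_F[OF i mZ(1) s(1), of c] c by simp
  from sim_post[OF j k mZ(1) E' sim_head[OF j mZ(1) k k mZ(1) A Q F(1,2) Q' this]]
  have "sim j m (Ef K i (- 1) ?k \<star> Qpow i c ?k \<star> Ff K i s m \<star> A)
      (Ef K i (- 1) ?k \<star> Ff K i (m (i + 1) + 1) m \<star> Qpow i c m \<star> A)" .
  moreover have "sim j m (Ef K i (- 1) ?k \<star> Ff K i (m (i + 1) + 1) m \<star> Qpow i c m \<star> A)
      (Psi K Plus i m \<star> Qpow i c m \<star> A)"
    using sim_iso[OF j mZ(1) EF_critical[OF i j m _ cmp1[OF j mZ(1) mZ(1) A Q'] z]] s by simp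
  ultimately show ?thesis using sim_trans[OF j mZ(1)] by blast
qed

text \<open>
  The exponent \<open>c\<close> moves the index \<open>s\<close> to the critical one, so up to invertible 1-morphisms \<open>F\<^sub>i\<^sub>,\<^sub>s A\<close> lies in the
  image of the right adjoint \<open>R\<close> of \<open>E\<^sub>i\<^sub>,\<^sub>-\<^sub>1\<close>.  The second clause is an isomorphism without a shift, as the counit
  argument of \<open>full1_adjunction\<close> requires.
\<close>

lemma Psi_F_as_right_adjoint:
  assumes i: "i \<in> {1..n - 1}" and j: "j \<in> Zn n" and m: "m \<in> Zn n" "0 \<le> m i"
    and A: "A \<in> Obj (Hm K j m)" and s: "0 \<le> s" "s < m (i + 1)" and c: "s + int c = m (i + 1) + 1"
  obtains R where "is_right_adjoint K (m - alpha i) m (Ef K i (- 1) (m - alpha i)) R"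
    "R \<star> Psi K Plus i m \<star> Qpow i c m \<star> A
       \<simeq>\<^bsub>Hm K j (m - alpha i)\<^esub> Ff K i (m (i + 1) + 1) m \<star> Qpow i c m \<star> A"
    "sim j (m - alpha i) (Qpow i c (m - alpha i) \<star> Ff K i s m \<star> A)
       (R \<star> Psi K Plus i m \<star> Qpow i c m \<star> A)"
proof -
  let ?k = "m - alpha i" and ?F' = "Ff K i (m (i + 1) + 1) m"
  let ?q = "PsiInv K Plus i m" and ?p = "Psi K Plus i m"
  note k = Zn_alpha(1)[OF i m(1)]
  have F: "Ff K i s m \<in> Obj (Hm K m ?k)" "?F' \<in> Obj (Hm K m ?k)"
    using F_obj[OF i m(1)] s by (auto simp: F_range_def)
  note Q = Qpow_obj[OF i k, of c] and Q' = Qpow_obj[OF i m(1), of c]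
  obtain R where R: "is_right_adjoint K ?k m (Ef K i (- 1) ?k) R" "R \<simeq>\<^bsub>Hm K m ?k\<^esub> ?F' \<star> ?q"
    using E_adjoint[OF i m] s by auto
  have p: "?p \<in> Obj (Hm K m m)" "?q \<in> Obj (Hm K m m)" using Psi_obj[OF i m(1)] by blast+
  let ?X = "Qpow i c m \<star> A"
  have X: "?X \<in> Obj (Hm K j m)" using cmp1[OF j m(1) m(1) A Q'] .
  have pX: "?p \<star> ?X \<in> Obj (Hm K j m)" using cmp1[OF j m(1) m(1) X p(1)] .
  have "R \<star> ?p \<star> ?X \<simeq>\<^bsub>Hm K j ?k\<^esub> ?F' \<star> ?q \<star> ?p \<star> ?X"
    using iso_pre[OF j m(1) k pX R(2)] cmp1_assoc[OF j m(1) m(1) k pX p(2) F(2)] by simp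
  moreover have "?q \<star> ?p \<star> ?X \<simeq>\<^bsub>Hm K j m\<^esub> ?X"
    using iso_pre[OF j m(1) m(1) X, of "?q \<star> ?p" "Id1 K m"] Psi_inverse[OF i m(1), of Plus]
      cmp1_assoc[OF j m(1) m(1) m(1) X p] cmp1_id[OF j m(1) X] by simp
  ultimately have b: "R \<star> ?p \<star> ?X \<simeq>\<^bsub>Hm K j ?k\<^esub> ?F' \<star> ?X"
    using hm_iso_trans[OF j k] iso_post[OF j m(1) k F(2)] by blast
  have "sim m ?k (Qpow i c ?k \<star> Ff K i s m) (?F' \<star> Qpow i c m)"
    using Qpow_F[OF i m(1) s(1), of c] c by simp
  from sim_head[OF j m(1) k k m(1) A Q F(1,2) Q' this]
  have "sim j ?k (Qpow i c ?k \<star> Ff K i s m \<star> A) (?F' \<star> ?X)" .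
  then have "sim j ?k (Qpow i c ?k \<star> Ff K i s m \<star> A) (R \<star> ?p \<star> ?X)"
    using sim_trans[OF j k] sim_iso[OF j k hm_iso_sym[OF j k b]] by blast
  with R(1) b show thesis by (rule that)
qed

text \<open>Vanishing is moved across the adjunction: morphisms into \<open>F\<^sub>i\<^sub>,\<^sub>s A\<close> come from \<open>E\<^sub>i\<close> applied to the source.\<close>

lemma orth_F:
  assumes i: "i \<in> {1..n - 1}" and j: "j \<in> Zn n" and m: "m \<in> Zn n" "0 \<le> m i"
    and A: "A \<in> Obj (Hm K j m)" and s: "0 \<le> s" "s < m (i + 1)" and c: "s + int c = m (i + 1) + 1"
    and B: "B \<in> Obj (Hm K j (m - alpha i))"
    and o: "orth1 j m (Ef K i (- 1) (m - alpha i) \<star> Qpow i c (m - alpha i) \<star> B)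
              (Psi K Plus i m \<star> Qpow i c m \<star> A)"
  shows "orth1 j (m - alpha i) B (Ff K i s m \<star> A)"
proof -
  let ?k = "m - alpha i"
  note k = Zn_alpha(1)[OF i m(1)]
  note Q = Qpow_obj[OF i k, of c] and Q' = Qpow_obj[OF i m(1), of c]
  have F: "Ff K i s m \<in> Obj (Hm K m ?k)" using F_obj[OF i m(1)] s by (auto simp: F_range_def)
  have FA: "Ff K i s m \<star> A \<in> Obj (Hm K j ?k)" using cmp1[OF j m(1) k A F] .
  have QB: "Qpow i c ?k \<star> B \<in> Obj (Hm K j ?k)" using cmp1[OF j k k B Q] .
  have G: "Psi K Plus i m \<star> Qpow i c m \<star> A \<in> Obj (Hm K j m)"
    using cmp1[OF j m(1) m(1) cmp1[OF j m(1) m(1) A Q']] Psi_obj[OF i m(1)] by blast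
  obtain R where R: "is_right_adjoint K ?k m (Ef K i (- 1) ?k) R"
    "sim j ?k (Qpow i c ?k \<star> Ff K i s m \<star> A) (R \<star> Psi K Plus i m \<star> Qpow i c m \<star> A)"
    using Psi_F_as_right_adjoint[OF i j m A s c] by blast
  have "orth1 j ?k (Qpow i c ?k \<star> B) (R \<star> Psi K Plus i m \<star> Qpow i c m \<star> A)"
    using orth1_adjunction[OF j k m(1) R(1) QB G o] .
  then have "orth1 j ?k (Qpow i c ?k \<star> B) (Qpow i c ?k \<star> Ff K i s m \<star> A)"
    using orth1_sim[OF j k sim_refl[OF j k QB] R(2)] by blast
  then show ?thesis using orth1_reflect[OF j k B FA Qpow_invertible[OF i k]] by blast
qed

text \<open>By the triangle the left adjoint of \<open>F\<^sub>i\<^sub>,\<^sub>s\<close> undoes \<open>F\<^sub>i\<^sub>,\<^sub>s\<close> on \<open>A'\<close>, up to invertible 1-morphisms.\<close>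

lemma orth_F_same:
  assumes i: "i \<in> {1..n - 1}" and j: "j \<in> Zn n" and m: "m \<in> Cwt n N"
    and A: "A \<in> Obj (Hm K j m)" "A' \<in> Obj (Hm K j m)"
    and s: "0 \<le> s" "s < m (i + 1)" and c: "s + int c = m (i + 1) + 1"
    and z: "zero_object (Hm K j (m + alpha i)) (Ef K i (- 1) m \<star> Qpow i c m \<star> A')"
    and o: "orth1 j m A' A"
  shows "orth1 j (m - alpha i) (Ff K i s m \<star> A') (Ff K i s m \<star> A)"
proof -
  have mZ: "m \<in> Zn n" "0 \<le> m i" using Cwt_Zn Cwt_nonneg m by blast+
  note k = Zn_alpha(1)[OF i mZ(1)]
  note Q' = Qpow_obj[OF i mZ(1), of c]
  have F: "Ff K i s m \<in> Obj (Hm K m (m - alpha i))" using F_obj[OF i mZ(1)] s by (auto simp: F_range_def)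
  have p: "Psi K Plus i m \<in> Obj (Hm K m m)" using Psi_obj[OF i mZ(1)] by blast
  note QA = cmp1[OF j mZ(1) mZ(1) A(1) Q'] and QA' = cmp1[OF j mZ(1) mZ(1) A(2) Q']
  have "orth1 j m (Qpow i c m \<star> A') (Qpow i c m \<star> A)"
    using orth1_post[OF j mZ(1) mZ(1) A(2,1) Q' full1_invertible[OF mZ(1) Qpow_invertible[OF i mZ(1)]] o] .
  then have "orth1 j m (Psi K Plus i m \<star> Qpow i c m \<star> A') (Psi K Plus i m \<star> Qpow i c m \<star> A)"
    using orth1_post[OF j mZ(1) mZ(1) QA' QA p full1_invertible[OF mZ(1) Psi_invertible(1)[OF i mZ(1)]]]
    by blast
  then have "orth1 j m (Ef K i (- 1) (m - alpha i) \<star> Qpow i c (m - alpha i) \<star> Ff K i s m \<star> A')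
      (Psi K Plus i m \<star> Qpow i c m \<star> A)"
    using orth1_sim[OF j mZ(1) E_Psi_F_critical[OF i j m A(2) s c z] sim_refl[OF j mZ(1)]]
      cmp1[OF j mZ(1) mZ(1) QA p] by blast
  then show ?thesis using orth_F[OF i j mZ A(1) s c cmp1[OF j mZ(1) k A(2) F]] by blast
qed

text \<open>
  Here \<open>G = \<Psi>\<^sup>1\<^sup>-\<^sup>c A\<close>, and the triangle gives the isomorphism \<open>E R G \<cong> G\<close> to which the counit argument applies.
\<close>

lemma full_F:
  assumes i: "i \<in> {1..n - 1}" and j: "j \<in> Zn n" and m: "m \<in> Cwt n N"
    and A: "A \<in> Obj (Hm K j m)" and s: "0 \<le> s" "s < m (i + 1)" and c: "s + int c = m (i + 1) + 1"
    and z: "zero_object (Hm K j (m + alpha i)) (Ef K i (- 1) m \<star> Qpow i c m \<star> A)"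
    and full: "full1 j m A"
  shows "full1 j (m - alpha i) (Ff K i s m \<star> A)"
proof -
  let ?k = "m - alpha i" and ?G = "Psi K Plus i m \<star> Qpow i c m \<star> A"
  have mZ: "m \<in> Zn n" "0 \<le> m i" using Cwt_Zn Cwt_nonneg m by blast+
  note k = Zn_alpha(1)[OF i mZ(1)]
  note Q = Qpow_obj[OF i k, of c] and Q' = Qpow_obj[OF i mZ(1), of c]
  have F: "Ff K i s m \<in> Obj (Hm K m ?k)" using F_obj[OF i mZ(1)] s by (auto simp: F_range_def)
  have p: "Psi K Plus i m \<in> Obj (Hm K m m)" using Psi_obj[OF i mZ(1)] by blast
  note QA = cmp1[OF j mZ(1) mZ(1) A Q']
  note G = cmp1[OF j mZ(1) mZ(1) QA p]
  have "full1 j m (Qpow i c m \<star> A)"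
    using full1_cmp[OF j mZ(1) mZ(1) A Q' full full1_invertible[OF mZ(1) Qpow_invertible[OF i mZ(1)]]] .
  then have fG: "full1 j m ?G"
    using full1_cmp[OF j mZ(1) mZ(1) QA p _ full1_invertible[OF mZ(1) Psi_invertible(1)[OF i mZ(1)]]]
    by blast
  obtain R where R: "is_right_adjoint K ?k m (Ef K i (- 1) ?k) R"
    "R \<star> ?G \<simeq>\<^bsub>Hm K j ?k\<^esub> Ff K i (m (i + 1) + 1) m \<star> Qpow i c m \<star> A"
    "sim j ?k (Qpow i c ?k \<star> Ff K i s m \<star> A) (R \<star> ?G)"
    using Psi_F_as_right_adjoint[OF i j mZ A s c] by blast
  have "Ef K i (- 1) ?k \<star> R \<star> ?G \<simeq>\<^bsub>Hm K j m\<^esub> ?G"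
    using hm_iso_trans[OF j mZ(1) iso_post[OF j k mZ(1) E_below_obj[OF i mZ] R(2)]
        EF_critical[OF i j m _ QA z]] s by simp
  then have "full1 j ?k (R \<star> ?G)" using full1_adjunction[OF j k mZ(1) R(1) G fG] by blast
  then have "full1 j ?k (Qpow i c ?k \<star> Ff K i s m \<star> A)" using full1_sim[OF j k R(3)] by blast
  then show ?thesis using full1_reflect[OF j k cmp1[OF j mZ(1) k A F] Qpow_invertible[OF i k]] by blast
qed

lemma F_coreflective:
  assumes i: "i \<in> {1..n - 1}" and m: "m \<in> Cwt n N" and s: "0 \<le> s" "s < m (i + 1)"
  shows "coreflective1 m (m - alpha i) (Ff K i s m)"
proof -
  have mZ: "m \<in> Zn n" "0 \<le> m i" using Cwt_Zn Cwt_nonneg m by blast+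
  obtain R where "is_right_adjoint K m (m - alpha i) (Ff K i s m) R"
    using F_right_adjoint[OF i mZ(1), of s] s mZ(2) by (auto simp: F_range_def E_range_def)
  then show ?thesis using coreflective1_adjoint[OF mZ(1) Zn_alpha(1)[OF i mZ(1)]] by blast
qed

end

section \<open>Words of Young diagrams\<close>

lemma Fword_target_cong: "map fst w = map fst w' \<Longrightarrow> Fword_target w k = Fword_target w' k"
proof (induction w arbitrary: w')
  case (Cons a w)
  then obtain b v where "w' = b # v" by (cases w') auto
  with Cons show ?case by (cases a; cases b) auto
qed simp

text \<open>
  The leading block of letters with index \<open>i\<close> has entries in \<open>[0, s]\<close> and starts at a weight whose \<open>i\<close>-th
  coordinate vanishes, so that \<open>E\<^sub>i\<close> is zero there.
\<close>

definition leading_block :: "nat \<Rightarrow> int \<Rightarrow> (nat \<times> int) list \<Rightarrow> weight \<Rightarrow> bool" where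
  "leading_block i s w k \<longleftrightarrow>
     (\<exists>p q. w = map (Pair i) p @ q \<and> (\<forall>t \<in> set p. 0 \<le> t \<and> t \<le> s) \<and> Fword_target q k i = 0)"

lemma leading_block_Cons: "leading_block i s w k \<Longrightarrow> 0 \<le> s \<Longrightarrow> leading_block i s ((i, s) # w) k"
  unfolding leading_block_def
proof (elim exE conjE)
  fix p q assume "w = map (Pair i) p @ q" "\<forall>t \<in> set p. 0 \<le> t \<and> t \<le> s" "Fword_target q k i = 0" "0 \<le> s"
  then show "\<exists>p q. (i, s) # w = map (Pair i) p @ q \<and> (\<forall>t \<in> set p. 0 \<le> t \<and> t \<le> s) \<and> Fword_target q k i = 0"
    by (intro exI[of _ "s # p"] exI[of _ q]) auto
qed

text \<open>
  The words of tuples of Young diagrams have this property (lemma \<open>block_word_lam_word\<close>).  It is inherited by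
  suffixes, which makes induction on the word possible.
\<close>

fun block_word :: "nat \<Rightarrow> nat \<Rightarrow> (nat \<times> int) list \<Rightarrow> weight \<Rightarrow> bool" where
  "block_word n N [] k \<longleftrightarrow> k \<in> Cwt n N"
| "block_word n N ((i, s) # w) k \<longleftrightarrow> block_word n N w k \<and> i \<in> {1..n - 1} \<and>
     0 \<le> s \<and> s < Fword_target w k (i + 1) \<and> leading_block i s w k"

lemma block_word_target: "block_word n N w k \<Longrightarrow> Fword_target w k \<in> Cwt n N"
  by (induction n N w k rule: block_word.induct) (auto intro!: Cwt_minus_alpha)

lemma block_word_suffix: "block_word n N (u @ w) k \<Longrightarrow> block_word n N w k"
proof (induction u)
  case (Cons a u)
  then show ?case by (cases a) auto
qed simp

lemma block_word_source: "block_word n N w k \<Longrightarrow> k \<in> Zn n"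
  using block_word_suffix[of n N w "[]" k] Cwt_Zn by simp

context partial_categorical_action
begin

lemma Fword_obj: "block_word n N w j \<Longrightarrow> Fword K w j \<in> Obj (Hm K j (Fword_target w j))"
proof (induction w)
  case Nil
  then show ?case using id1 Cwt_Zn by simp
next
  case (Cons a w)
  obtain i s where a: "a = (i, s)" by fastforce
  have w: "block_word n N w j" "i \<in> {1..n - 1}" "F_range i s (Fword_target w j)"
    using Cons.prems a by (auto simp: F_range_def)
  have m: "Fword_target w j \<in> Zn n" using block_word_target[OF w(1)] Cwt_Zn by blast
  show ?case
    unfolding a Fword.simps Fword_target.simps
    using cmp1[OF block_word_source[OF w(1)] m Zn_alpha(1)[OF w(2) m] Cons.IH[OF w(1)] F_obj[OF w(2) m w(3)]] .
qed

text \<open>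
  Moving \<open>E\<^sub>i \<Psi>\<^sup>-\<^sup>c\<close> through the leading block one arrives at a weight with \<open>i\<close>-th coordinate \<open>0\<close>, and \<open>E\<^sub>i\<close> leads
  out of the set of weights there.  Coordinate \<open>i + 1\<close> of the weights grows towards the inside of the block, so the
  bound on \<open>t + c\<close> at the outermost weight implies the bounds under which \<open>E\<close> and \<open>F\<close> commute inside.
\<close>

lemma E_Psi_block_zero:
  assumes i: "i \<in> {1..n - 1}" and c: "2 \<le> c"
    and w: "block_word n N (map (Pair i) p @ q) j" and q: "Fword_target q j i = 0"
    and p: "\<And>t. t \<in> set p \<Longrightarrow> 0 \<le> t \<and> t + int c \<le> Fword_target (map (Pair i) p @ q) j (i + 1) + 1"
  shows "zero_object (Hm K j (Fword_target (map (Pair i) p @ q) j + alpha i))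
           (Ef K i (- 1) (Fword_target (map (Pair i) p @ q) j)
              \<star> Qpow i c (Fword_target (map (Pair i) p @ q) j) \<star> Fword K (map (Pair i) p @ q) j)"
  using w p
proof (induction p)
  case Nil
  let ?m = "Fword_target q j"
  have m: "?m \<in> Zn n" "0 \<le> ?m i" using block_word_target[of n N q j] Nil.prems(1) Cwt_Zn q by auto
  note j = block_word_source[OF Nil.prems(1)]
  have "(?m + alpha i) i < 0" using q by simp
  then have "?m + alpha i \<notin> Cwt n N" using Cwt_nonneg[of "?m + alpha i" n N i] by linarith
  moreover have "Fword K q j \<in> Obj (Hm K j ?m)" using Fword_obj Nil.prems(1) by simp
  ultimately show ?case
    unfolding list.map append.simps
    using zero_of_target[OF j Zn_alpha(2)[OF i m(1)]] E_top_obj[OF i m] Qpow_obj[OF i m(1)]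
      cmp1[OF j m(1) m(1)] cmp1[OF j m(1) Zn_alpha(2)[OF i m(1)]] by blast
next
  case (Cons t p)
  let ?w = "map (Pair i) p @ q"
  let ?m = "Fword_target ?w j"
  have w: "block_word n N ?w j" using Cons.prems(1) by simp
  have m: "?m \<in> Zn n" "0 \<le> ?m i" using block_word_target[OF w] Cwt_Zn Cwt_nonneg by blast+
  have top: "Fword_target (map (Pair i) (t # p) @ q) j = ?m - alpha i" by simp
  have b: "0 \<le> t' \<and> t' + int c \<le> ?m (i + 1)" if "t' \<in> set (t # p)" for t'
    using Cons.prems(2)[OF that] unfolding top by simp
  have "0 \<le> t' \<and> t' + int c \<le> ?m (i + 1) + 1" if "t' \<in> set p" for t'
    using b[of t'] that by simp
  then have z: "zero_object (Hm K j (?m + alpha i)) (Ef K i (- 1) ?m \<star> Qpow i c ?m \<star> Fword K ?w j)"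
    by (rule Cons.IH[OF w])
  have t: "0 \<le> t" "2 \<le> t + int c" "t + int c \<le> ?m (i + 1)" using b[of t] c by auto
  have e: "?m - alpha i + alpha i = ?m" by simp
  show ?case
    unfolding list.map append.simps Fword.simps Fword_target.simps e
    using E_Psi_F_zero[OF i block_word_source[OF w] m Fword_obj[OF w] t z] .
qed

lemma E_Psi_leading_block_zero:
  assumes i: "i \<in> {1..n - 1}" and w: "block_word n N w j" and b: "leading_block i s w j"
    and c: "2 \<le> c" "s + int c \<le> Fword_target w j (i + 1) + 1"
  shows "zero_object (Hm K j (Fword_target w j + alpha i))
           (Ef K i (- 1) (Fword_target w j) \<star> Qpow i c (Fword_target w j) \<star> Fword K w j)"
proof -
  obtain p q where pq: "w = map (Pair i) p @ q" "\<forall>t \<in> set p. 0 \<le> t \<and> t \<le> s" "Fword_target q j i = 0"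
    using b unfolding leading_block_def by blast
  have "0 \<le> t \<and> t + int c \<le> Fword_target (map (Pair i) p @ q) j (i + 1) + 1" if "t \<in> set p" for t
    using pq c(2) that by force
  then show ?thesis using E_Psi_block_zero[OF i c(1) _ pq(3)] w unfolding pq(1) by blast
qed

text \<open>The strict bound on \<open>s\<close> in a block word is what makes the exponent that leads to the critical index at least \<open>2\<close>.\<close>

lemma critical_exponent:
  assumes "block_word n N ((i, s) # w) j"
  obtains c :: nat where "s + int c = Fword_target w j (i + 1) + 1" "2 \<le> c"
proof (rule that[of "nat (Fword_target w j (i + 1) + 1 - s)"])
  have "s < Fword_target w j (i + 1)" using assms by simp
  then show "s + int (nat (Fword_target w j (i + 1) + 1 - s)) = Fword_target w j (i + 1) + 1"
    "2 \<le> nat (Fword_target w j (i + 1) + 1 - s)"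
    by linarith+
qed

lemma full_Fword: "block_word n N w j \<Longrightarrow> full1 j (Fword_target w j) (Fword K w j)"
proof (induction w)
  case Nil
  then show ?case using full1_Id1 Cwt_Zn by simp
next
  case (Cons a w)
  obtain i s where a: "a = (i, s)" by fastforce
  obtain c where c: "s + int c = Fword_target w j (i + 1) + 1" "2 \<le> c"
    using critical_exponent Cons.prems a by blast
  have w: "block_word n N w j" "i \<in> {1..n - 1}" "0 \<le> s" "s < Fword_target w j (i + 1)"
    "leading_block i s w j"
    using Cons.prems a by auto
  note z = E_Psi_leading_block_zero[OF w(2,1,5) c(2) eq_refl[OF c(1)]]
  show ?case
    unfolding a Fword.simps Fword_target.simps
    using full_F[OF w(2) block_word_source[OF w(1)] block_word_target[OF w(1)] Fword_obj[OF w(1)] w(3,4) c(1) z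
        Cons.IH[OF w(1)]] .
qed

lemma coreflective_Fword: "block_word n N w j \<Longrightarrow> coreflective1 j (Fword_target w j) (Fword K w j)"
proof (induction w)
  case Nil
  then show ?case using coreflective1_Id1 Cwt_Zn by simp
next
  case (Cons a w)
  obtain i s where a: "a = (i, s)" by fastforce
  have w: "block_word n N w j" "i \<in> {1..n - 1}" "0 \<le> s" "s < Fword_target w j (i + 1)"
    using Cons.prems a by auto
  let ?m = "Fword_target w j"
  have m: "?m \<in> Cwt n N" "?m \<in> Zn n" using block_word_target[OF w(1)] Cwt_Zn by blast+
  have F: "Ff K i s ?m \<in> Obj (Hm K ?m (?m - alpha i))"
    using F_obj[OF w(2) m(2)] w by (simp add: F_range_def)
  show ?case
    unfolding a Fword.simps Fword_target.simps
    using coreflective1_cmp[OF block_word_source[OF w(1)] m(2) Zn_alpha(1)[OF w(2) m(2)] Fword_obj[OF w(1)] F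
        Cons.IH[OF w(1)] F_coreflective[OF w(2) m(1) w(3,4)]] .
qed

text \<open>
  A common prefix is removed letter by letter with the left adjoints.  At the first difference \<open>t < s\<close> the left
  adjoint of \<open>F\<^sub>i\<^sub>,\<^sub>s\<close> kills the word that starts with \<open>F\<^sub>i\<^sub>,\<^sub>t\<close>, because the indices in its leading block are at most
  \<open>t\<close>.  The right adjoints would not do here: commuting \<open>E\<^sub>i\<close> inwards they would meet decreasing indices, which
  may leave the range of commutation.
\<close>

lemma orth_Fword:
  assumes "block_word n N (u @ (i, s) # v) j" "block_word n N (u @ (i, t) # v') j"
    and "map fst v = map fst v'" "t < s"
  shows "orth1 j (Fword_target (u @ (i, s) # v) j)
           (Fword K (u @ (i, t) # v') j) (Fword K (u @ (i, s) # v) j)"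
  using assms
proof (induction u)
  case Nil
  obtain c where c: "s + int c = Fword_target v j (i + 1) + 1" "2 \<le> c"
    using critical_exponent[OF Nil.prems(1)[unfolded append.simps]] by blast
  let ?m = "Fword_target v j"
  have m': "Fword_target v' j = ?m" using Fword_target_cong[OF Nil.prems(3)] by simp
  have w: "block_word n N v j" "i \<in> {1..n - 1}" "0 \<le> s" "s < ?m (i + 1)"
    using Nil.prems(1) by auto
  have w': "block_word n N ((i, t) # v') j" using Nil.prems(2) by simp
  have m: "?m \<in> Cwt n N" "?m \<in> Zn n" "0 \<le> ?m i"
    using block_word_target[OF w(1)] Cwt_Zn Cwt_nonneg by blast+
  note k = Zn_alpha(1)[OF w(2) m(2)] and j = block_word_source[OF w(1)]
  have "leading_block i t ((i, t) # v') j" using w' by (auto intro: leading_block_Cons)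
  from E_Psi_leading_block_zero[OF w(2) w' this c(2)]
  moreover have "Fword_target ((i, t) # v') j = ?m - alpha i" using m' by simp
  moreover have "t + int c \<le> (?m - alpha i) (i + 1) + 1" using c(1) Nil.prems(4) by simp
  moreover have "?m - alpha i + alpha i = ?m" by simp
  ultimately have "zero_object (Hm K j ?m)
      (Ef K i (- 1) (?m - alpha i) \<star> Qpow i c (?m - alpha i) \<star> Fword K ((i, t) # v') j)"
    by metis
  then have "orth1 j ?m (Ef K i (- 1) (?m - alpha i) \<star> Qpow i c (?m - alpha i) \<star> Fword K ((i, t) # v') j)
      (Psi K Plus i ?m \<star> Qpow i c ?m \<star> Fword K v j)"
    by (rule orth1_zero[OF j m(2)])
  moreover have "Fword K ((i, t) # v') j \<in> Obj (Hm K j (?m - alpha i))"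
    using Fword_obj[OF w'] unfolding Fword_target.simps m' .
  ultimately have "orth1 j (?m - alpha i) (Fword K ((i, t) # v') j) (Ff K i s ?m \<star> Fword K v j)"
    using orth_F[OF w(2) j m(2,3) Fword_obj[OF w(1)] w(3,4) c(1)] by blast
  then show ?case unfolding append.simps Fword.simps(2)[of K i s] Fword_target.simps .
next
  case (Cons a u)
  obtain i' s' where a: "a = (i', s')" by fastforce
  let ?w = "u @ (i, s) # v" and ?w' = "u @ (i, t) # v'"
  let ?m = "Fword_target ?w j"
  have m': "Fword_target ?w' j = ?m"
    using Fword_target_cong[of ?w' ?w j] Cons.prems(3) by simp
  obtain c where c: "s' + int c = ?m (i' + 1) + 1" "2 \<le> c"
    using critical_exponent[OF Cons.prems(1)[unfolded append.simps a]] by blast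
  have w: "block_word n N ?w j" "i' \<in> {1..n - 1}" "0 \<le> s'" "s' < ?m (i' + 1)"
    using Cons.prems(1) a by auto
  have w': "block_word n N ?w' j" "leading_block i' s' ?w' j" using Cons.prems(2) a by auto
  have z: "zero_object (Hm K j (?m + alpha i')) (Ef K i' (- 1) ?m \<star> Qpow i' c ?m \<star> Fword K ?w' j)"
    using E_Psi_leading_block_zero[OF w(2) w' c(2)] c(1) unfolding m' by simp
  have o': "Fword K ?w' j \<in> Obj (Hm K j ?m)" using Fword_obj[OF w'(1)] m' by simp
  have "orth1 j (?m - alpha i') (Ff K i' s' ?m \<star> Fword K ?w' j) (Ff K i' s' ?m \<star> Fword K ?w j)"
    using orth_F_same[OF w(2) block_word_source[OF w(1)] block_word_target[OF w(1)] Fword_obj[OF w(1)] o'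
        w(3,4) c(1) z Cons.IH[OF w(1) w'(1) Cons.prems(3,4)]] .
  then show ?case unfolding a append.simps Fword.simps Fword_target.simps m' .
qed

end

text \<open>
  Each letter lowers coordinate \<open>i + 1\<close> by one, so it exceeds \<open>a\<close>, hence the entry, before each of the \<open>b\<close> letters.  That the
  list is decreasing gives the bound on the leading block below each letter.
\<close>

lemma block_word_append:
  assumes w: "block_word n N w k" and i: "i \<in> {1..n - 1}" and z: "Fword_target w k i = 0"
    and p: "p \<in> P a b" "a + int b \<le> Fword_target w k (i + 1)"
  shows "block_word n N (map (Pair i) p @ w) k \<and>
    Fword_target (map (Pair i) p @ w) k = (\<lambda>j. Fword_target w k j - int b * alpha i j)"
  using p
proof (induction p arbitrary: b)
  case Nil
  then show ?case using w by (simp add: P_def)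
next
  case (Cons s p)
  let ?m = "Fword_target (map (Pair i) p @ w) k"
  obtain b' where b: "b = Suc b'" using Cons.prems(1) unfolding P_def by auto
  have p: "p \<in> P a b'" and s: "0 \<le> s" "s \<le> a" and le: "\<forall>t \<in> set p. 0 \<le> t \<and> t \<le> s"
    using Cons.prems(1) b unfolding P_def by auto
  have IH: "block_word n N (map (Pair i) p @ w) k" "?m = (\<lambda>j. Fword_target w k j - int b' * alpha i j)"
    using Cons.IH[OF p] Cons.prems(2) b by auto
  have "?m (i + 1) = Fword_target w k (i + 1) - int b'" by (simp add: IH(2))
  then have "s < ?m (i + 1)" using s Cons.prems(2) b by simp
  moreover have "leading_block i s (map (Pair i) p @ w) k"
    unfolding leading_block_def using le z by blast
  moreover have "?m - alpha i = (\<lambda>j. Fword_target w k j - int b * alpha i j)"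
    unfolding IH(2) b by (rule ext) (simp add: algebra_simps)
  ultimately show ?case using IH(1) i s by simp
qed

lemma Ksum_int:
  assumes "k \<in> Cwt n N"
  shows "int (Ksum k i) = (\<Sum>j = 1..i. k j)"
  unfolding Ksum_def using Cwt_nonneg[OF assms] by (simp add: sum_nonneg)

text \<open>
  The block with index \<open>j\<close> splits the coordinate \<open>K\<^sub>j\<^sub>+\<^sub>1 = K\<^sub>j + k\<^sub>j\<^sub>+\<^sub>1\<close> by moving \<open>K\<^sub>j\<close> of it to position \<open>j\<close>, which was
  still \<open>0\<close>.
\<close>

lemma block_word_blocks:
  assumes k: "k \<in> Cwt n N" and lam: "lam \<in> Lam n k" and j: "1 \<le> j" "j \<le> n"
  shows "block_word n N (concat (map (\<lambda>i. map (Pair i) (lam i)) [j..<n])) (eta n N) \<and>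
    Fword_target (concat (map (\<lambda>i. map (Pair i) (lam i)) [j..<n])) (eta n N) =
      (\<lambda>l. if l < j then 0 else if l = j then int (Ksum k j) else k l)"
  using j(2,1)
proof (induction rule: inc_induct)
  case base
  have N: "int (Ksum k n) = int N" using Ksum_int[OF k] k unfolding Cwt_def by simp
  have "eta n N \<in> Cwt n N" using base unfolding Cwt_def Zn_def eta_def by auto
  moreover have "eta n N = (\<lambda>l. if l < n then 0 else if l = n then int (Ksum k n) else k l)"
    using N k unfolding Cwt_def Zn_def eta_def by auto
  ultimately show ?case by simp
next
  case (step j)
  let ?w = "concat (map (\<lambda>i. map (Pair i) (lam i)) [Suc j..<n])"
  have IH: "block_word n N ?w (eta n N)"
    "Fword_target ?w (eta n N) = (\<lambda>l. if l < Suc j then 0 else if l = Suc j then int (Ksum k (Suc j)) else k l)"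
    using step by auto
  have i: "j \<in> {1..n - 1}" using step by auto
  have K: "int (Ksum k (Suc j)) = int (Ksum k j) + k (Suc j)" using Ksum_int[OF k] by simp
  have "lam j \<in> P (k (j + 1)) (Ksum k j)" using lam i unfolding Lam_def by blast
  from block_word_append[OF IH(1) i _ this]
  have "block_word n N (map (Pair j) (lam j) @ ?w) (eta n N)"
    "Fword_target (map (Pair j) (lam j) @ ?w) (eta n N) =
       (\<lambda>l. Fword_target ?w (eta n N) l - int (Ksum k j) * alpha j l)"
    using K unfolding IH(2) by simp_all
  moreover have "(\<lambda>l. Fword_target ?w (eta n N) l - int (Ksum k j) * alpha j l) =
      (\<lambda>l. if l < j then 0 else if l = j then int (Ksum k j) else k l)"
    unfolding IH(2) using K by (auto simp: alpha_def)
  moreover have "[j..<n] = j # [Suc j..<n]" using step by (simp add: upt_conv_Cons)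
  ultimately show ?case by simp
qed

lemma block_word_lam_word:
  assumes n: "1 \<le> n" and k: "k \<in> Cwt n N" and lam: "lam \<in> Lam n k"
  shows "block_word n N (lam_word n lam) (eta n N)" "Fword_target (lam_word n lam) (eta n N) = k"
proof -
  have "(\<lambda>l. if l < 1 then 0 else if l = 1 then int (Ksum k 1) else k l) = k"
    using Ksum_int[OF k, of 1] k unfolding Cwt_def Zn_def by auto
  then show "block_word n N (lam_word n lam) (eta n N)" "Fword_target (lam_word n lam) (eta n N) = k"
    using block_word_blocks[OF k lam order_refl n] unfolding lam_word_def by auto
qed

section \<open>Lexicographic orders on tuples and words\<close>

lemma lt_l_split:
  assumes "ys <\<^sub>l xs"
  obtains u s t v v' where "xs = u @ s # v" "ys = u @ t # v'" "t < s"
proof -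
  obtain j where j: "j < length ys" "j < length xs" "\<forall>a < j. ys ! a = xs ! a" "ys ! j < xs ! j"
    using assms unfolding lt_l_def by blast
  have "take j ys = take j xs" using j by (intro nth_take_lemma) auto
  then have "ys = take j xs @ ys ! j # drop (Suc j) ys" using id_take_nth_drop[OF j(1)] by simp
  moreover have "xs = take j xs @ xs ! j # drop (Suc j) xs" using id_take_nth_drop[OF j(2)] .
  ultimately show thesis using that j(4) by blast
qed

text \<open>
  All tuples give words with the same sequence of first components, so the order on tuples is the lexicographic
  order of the words.
\<close>

lemma lt_pl_split:
  assumes x: "x \<in> Lam n k" and y: "y \<in> Lam n k" and lt: "lt_pl n y x"
  obtains u i s t v v' where "lam_word n x = u @ (i, s) # v" "lam_word n y = u @ (i, t) # v'"
    "map fst v = map fst v'" "t < s"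
proof -
  obtain i where i: "i \<in> {1..n - 1}" "\<forall>j \<in> {1..<i}. y j = x j" "y i <\<^sub>l x i"
    using lt unfolding lt_pl_def by blast
  obtain u s t v v' where xy: "x i = u @ s # v" "y i = u @ t # v'" "t < s"
    using i(3) by (rule lt_l_split)
  have len: "length (x j) = length (y j)" if "j \<in> {1..n - 1}" for j
    using that x y unfolding Lam_def P_def by (fastforce dest: PiE_mem)
  define B where "B z l = concat (map (\<lambda>i. map (Pair i) (z i)) l)" for z :: "nat \<Rightarrow> int list" and l
  have e: "[1..<n] = [1..<i] @ i # [Suc i..<n]"
    using i(1) upt_add_eq_append[of 1 i "n - i"] upt_conv_Cons[of i n] by auto
  have X: "lam_word n z = B z [1..<i] @ map (Pair i) (z i) @ B z [Suc i..<n]" for z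
    unfolding lam_word_def e B_def by simp
  have "map (\<lambda>i. map (Pair i) (y i)) [1..<i] = map (\<lambda>i. map (Pair i) (x i)) [1..<i]"
    using i(2) by simp
  then have pre: "B y [1..<i] = B x [1..<i]" unfolding B_def by metis
  have rest: "map fst (B x l) = map fst (B y l)" if "set l \<subseteq> {1..n - 1}" for l
    using that by (induction l) (auto simp: B_def len comp_def map_replicate_const)
  have later: "set [Suc i..<n] \<subseteq> {1..n - 1}" by auto
  have "length v = length v'" using len[OF i(1)] xy by simp
  then have "map fst (map (Pair i) v @ B x [Suc i..<n]) = map fst (map (Pair i) v' @ B y [Suc i..<n])"
    using rest[OF later] by (simp add: comp_def map_replicate_const)
  then show thesis
    using that[of "B x [1..<i] @ map (Pair i) u" i s "map (Pair i) v @ B x [Suc i..<n]"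
        t "map (Pair i) v' @ B y [Suc i..<n]"] xy X[of x] X[of y] pre by simp
qed

lemma lt_l_trans:
  assumes "xs <\<^sub>l ys" "ys <\<^sub>l zs"
  shows "xs <\<^sub>l zs"
proof -
  obtain i where i: "i < length xs" "i < length ys" "\<forall>a < i. xs ! a = ys ! a" "xs ! i < ys ! i"
    using assms(1) unfolding lt_l_def by blast
  obtain j where j: "j < length ys" "j < length zs" "\<forall>a < j. ys ! a = zs ! a" "ys ! j < zs ! j"
    using assms(2) unfolding lt_l_def by blast
  show ?thesis
    unfolding lt_l_def
  proof (intro exI[of _ "min i j"] conjI allI impI)
    show "xs ! min i j < zs ! min i j"
      using i j by (cases i j rule: linorder_cases) auto
  qed (use i j in auto)
qed

lemma lt_l_total:
  assumes "length xs = length ys" "xs \<noteq> ys"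
  shows "xs <\<^sub>l ys \<or> ys <\<^sub>l xs"
proof -
  define j where "j = (LEAST j. j < length xs \<and> xs ! j \<noteq> ys ! j)"
  have ex: "\<exists>j. j < length xs \<and> xs ! j \<noteq> ys ! j" using assms nth_equalityI by blast
  have j: "j < length xs" "xs ! j \<noteq> ys ! j" using LeastI_ex[OF ex] unfolding j_def by auto
  have "\<forall>a < j. xs ! a = ys ! a" using not_less_Least j(1) unfolding j_def by fastforce
  then show ?thesis unfolding lt_l_def using j assms(1) by (metis linorder_neqE)
qed

lemma lt_pl_trans:
  assumes "lt_pl n x y" "lt_pl n y z"
  shows "lt_pl n x z"
proof -
  obtain i where i: "i \<in> {1..n - 1}" "\<forall>a \<in> {1..<i}. x a = y a" "x i <\<^sub>l y i"
    using assms(1) unfolding lt_pl_def by blast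
  obtain j where j: "j \<in> {1..n - 1}" "\<forall>a \<in> {1..<j}. y a = z a" "y j <\<^sub>l z j"
    using assms(2) unfolding lt_pl_def by blast
  show ?thesis
    unfolding lt_pl_def
  proof (intro bexI[of _ "min i j"] conjI)
    show "x (min i j) <\<^sub>l z (min i j)"
      using i j lt_l_trans by (cases i j rule: linorder_cases) auto
  qed (use i j in auto)
qed

lemma lt_pl_total:
  assumes x: "x \<in> Lam n k" and y: "y \<in> Lam n k" and "x \<noteq> y"
  shows "lt_pl n x y \<or> lt_pl n y x"
proof -
  have ex: "\<exists>i. i \<in> {1..n - 1} \<and> x i \<noteq> y i"
    using assms PiE_ext[OF x[unfolded Lam_def] y[unfolded Lam_def]] by blast
  define i where "i = (LEAST i. i \<in> {1..n - 1} \<and> x i \<noteq> y i)"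
  have i: "i \<in> {1..n - 1}" "x i \<noteq> y i" using LeastI_ex[OF ex] unfolding i_def by auto
  have e: "\<forall>j \<in> {1..<i}. x j = y j"
  proof
    fix j assume "j \<in> {1..<i}"
    then show "x j = y j" using not_less_Least[of j "\<lambda>i. i \<in> {1..n - 1} \<and> x i \<noteq> y i"] i(1)
      unfolding i_def[symmetric] by auto
  qed
  have "x i \<in> P (k (i + 1)) (Ksum k i)" "y i \<in> P (k (i + 1)) (Ksum k i)"
    using x y i(1) unfolding Lam_def by blast+
  then have "length (x i) = length (y i)" unfolding P_def by simp
  from lt_l_total[OF this i(2)] show ?thesis
    unfolding lt_pl_def using i(1) e by metis
qed

lemma finite_Lam: "finite (Lam n k)"
proof -
  have "finite (P a b)" for a b
    by (rule finite_subset[OF _ finite_lists_length_eq[of "{0..a}" b]]) (auto simp: P_def)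
  then show ?thesis unfolding Lam_def by (intro finite_PiE) auto
qed

lemma finite_sorted_wrt_list:
  assumes "finite A" and trans: "\<And>x y z. R x y \<Longrightarrow> R y z \<Longrightarrow> R x z"
    and total: "\<And>x y. x \<in> A \<Longrightarrow> y \<in> A \<Longrightarrow> x \<noteq> y \<Longrightarrow> R x y \<or> R y x"
  shows "\<exists>xs. set xs = A \<and> sorted_wrt R xs"
  using assms(1) total
proof (induction A)
  case (insert x A)
  obtain xs where xs: "set xs = A" "sorted_wrt R xs" using insert by blast
  have "\<And>y. y \<in> A \<Longrightarrow> R y x \<or> R x y" using insert.prems insert.hyps(2) by (metis insertCI)
  then have "set (filter (\<lambda>y. R y x) xs @ x # filter (\<lambda>y. R x y) xs) = insert x A"
    using xs(1) by auto
  moreover have "sorted_wrt R (filter (\<lambda>y. R y x) xs @ x # filter (\<lambda>y. R x y) xs)"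
    using xs(2) by (auto simp: sorted_wrt_append sorted_wrt_filter intro: trans)
  ultimately show ?case by blast
qed simp

section \<open>The decomposition\<close>

context partial_categorical_action
begin

lemma lam_word_obj:
  assumes "1 \<le> n" "k \<in> Cwt n N" "lam \<in> Lam n k"
  shows "eta n N \<in> Zn n" "Fword K (lam_word n lam) (eta n N) \<in> Obj (Hm K (eta n N) k)"
  using Fword_obj[of "lam_word n lam" "eta n N"] block_word_lam_word[OF assms] block_word_source by auto

text \<open>
  Each component is the hull of the essential image of a functor that is full and has a right adjoint, so
  \<open>approximation\<close> applies; \<open>orth_Fword\<close> gives the orthogonality between different components.
\<close>

lemma ImF_semiorthogonal_decomposition:
  assumes n: "1 \<le> n" and k: "k \<in> Cwt n N"
    and Ls: "set Ls = Lam n k" "sorted_wrt (\<lambda>x y. lt_pl n y x) Ls"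
  shows "semiorthogonal_decomposition (Ct K k) (Aorth n N K k # map (ImF n N K k) Ls)"
proof -
  let ?e = "eta n N"
  let ?F = "\<lambda>lam. Fword K (lam_word n lam) ?e"
  let ?B = "\<lambda>lam. ess_image (Ct K ?e) (Ct K k) (FOb K (?F lam))"
  have kZ: "k \<in> Zn n" using Cwt_Zn k .
  interpret D: triangulated_category "Ct K k" using ct_triangulated kZ .
  note W = lam_word_obj(1)[OF n k] and o = lam_word_obj(2)[OF n k]
  have act: "triangulated_functor (Ct K ?e) (Ct K k) (FOb K (?F lam)) (FMo K (?F lam))"
    if "lam \<in> Lam n k" for lam
    using act_functor[OF W[OF that] kZ o[OF that]] .
  have "sorted_wrt (\<lambda>x y. \<forall>b \<in> ?B x. \<forall>b' \<in> ?B y. no_mor (Ct K k) b' b) Ls"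
  proof (rule sorted_wrt_mono_rel[OF _ Ls(2)], intro ballI)
    fix x y b b' assume "x \<in> set Ls" "y \<in> set Ls" and lt: "lt_pl n y x" and b: "b \<in> ?B x" "b' \<in> ?B y"
    then have xy: "x \<in> Lam n k" "y \<in> Lam n k" using Ls(1) by auto
    obtain u i s t v v' where w: "lam_word n x = u @ (i, s) # v" "lam_word n y = u @ (i, t) # v'"
      "map fst v = map fst v'" "t < s"
      using xy lt by (rule lt_pl_split)
    note good = block_word_lam_word[OF n k]
    have "orth1 ?e k (?F y) (?F x)"
      using orth_Fword[of u i s v ?e t v'] w good[OF xy(1)] good[OF xy(2)] by simp
    then show "no_mor (Ct K k) b' b"
      using b D.no_mor_iso unfolding orth1_def ess_image_def by blast
  qed
  then have so: "sorted_wrt (\<lambda>B B'. \<forall>b \<in> B. \<forall>b' \<in> B'. no_mor (Ct K k) b' b) (map ?B Ls)"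
    by (simp add: sorted_wrt_map)
  have ap: "\<exists>b Z f g h. Tri (Ct K k) b Y Z f g h \<and> b \<in> ?B lam \<and> Z \<in> right_orth (Ct K k) (?B lam)"
    if lam: "lam \<in> Lam n k" and Y: "Y \<in> Obj (Ct K k)" for lam Y
    using triangulated_functor.approximation[OF act[OF lam] _ _ Y]
      full_Fword[OF block_word_lam_word(1)[OF n k lam]]
      coreflective_Fword[OF block_word_lam_word(1)[OF n k lam]]
    unfolding block_word_lam_word(2)[OF n k lam] full1_def coreflective1_def by blast
  have cl: "?B lam \<subseteq> Obj (Ct K k) \<and> (\<forall>b \<in> ?B lam. \<forall>m. Sh (Ct K k) m b \<in> ?B lam)"
    if "lam \<in> Lam n k" for lam
    using triangulated_functor.ess_image_subset[OF act[OF that]]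
      triangulated_functor.ess_image_sh[OF act[OF that]] by blast
  have im: "ImF n N K k lam = tri_hull (Ct K k) (?B lam)" for lam
    unfolding ImF_def ess_image_def ..
  have "semiorthogonal_decomposition (Ct K k)
      (right_orth (Ct K k) (tri_hull (Ct K k) (\<Union>B \<in> set (map ?B Ls). tri_hull (Ct K k) B))
        # map (tri_hull (Ct K k)) (map ?B Ls))"
    by (rule D.semiorthogonal_decomposition_of_approximations[OF _ so]) (use cl ap Ls(1) in auto)
  moreover have "(\<Union>B \<in> set (map ?B Ls). tri_hull (Ct K k) B) = (\<Union>lam \<in> Lam n k. ImF n N K k lam)"
    using Ls(1) im by simp
  moreover have "map (tri_hull (Ct K k)) (map ?B Ls) = map (ImF n N K k) Ls" using im by simp
  ultimately show ?thesis unfolding Aorth_def by metis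
qed

end

theorem corollary1p3:
  fixes n N :: nat and K :: "('o, 'm, 'f, 't, 'z) action_scheme" and k :: weight
  assumes "n \<ge> 2" and "N \<ge> 2"
    and "partial_categorical_action n N K"
    and "k \<in> Cwt n N"
  shows "\<exists>Ls. set Ls = Lam n k \<and> sorted_wrt (\<lambda>x y. lt_pl n y x) Ls \<and>
           semiorthogonal_decomposition (Ct K k) (Aorth n N K k # map (ImF n N K k) Ls)"
proof -
  interpret partial_categorical_action n N K using assms(3) .
  have "\<exists>Ls. set Ls = Lam n k \<and> sorted_wrt (\<lambda>x y. lt_pl n y x) Ls"
  proof (rule finite_sorted_wrt_list[OF finite_Lam])
    show "\<And>x y z. lt_pl n y x \<Longrightarrow> lt_pl n z y \<Longrightarrow> lt_pl n z x" by (rule lt_pl_trans)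
    show "\<And>x y. x \<in> Lam n k \<Longrightarrow> y \<in> Lam n k \<Longrightarrow> x \<noteq> y \<Longrightarrow> lt_pl n y x \<or> lt_pl n x y"
      using lt_pl_total by blast
  qed
  then obtain Ls where "set Ls = Lam n k" "sorted_wrt (\<lambda>x y. lt_pl n y x) Ls" by blast
  then show ?thesis using ImF_semiorthogonal_decomposition assms(1,4) by auto
qed

end
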